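(* Being a Garside group and being a Garside monoid are $\Sigma_1^0$ (i.e. recursively enumerable) properties: the set of finite group presentations that define a Garside group is recursively enumerable, and the set of finite monoid presentations that define a Garside monoid is recursively enumerable.
   Context: Finite presentations are coded, in a standard effective way, as finite objects (a finite alphabet together with a finite list of pairs of words). Let $M$ be a monoid. For $x,y\in M$, $x$ is a left divisor of $y$ (equivalently $y$ is a right multiple of $x$) if $xz=y$ for some $z\in M$; right divisors and left multiples are defined symmetrically. A right lcm of $x,y$ is a right multiple of both that is a left divisor of every common right multiple; a left gcd of $x,y$ is a common left divisor that is a right multiple of every common left divisor. Left lcm's and right gcd's are defined symmetrically. An atom of $M$ is an element $x\neq 1$ such that $x=yz$ implies $y=1$ or $z=1$. $M$ is atomic if it is generated by its atoms and, for every $x\in M$, the supremum $\|x\|$ of the lengths of the expressions of $x$ as a product of atoms is finite. $M$ is Gaussian if it is atomic, left and right cancellative, and any two elements admit a right lcm, a left lcm, a right gcd and a left gcd. A Garside element in a Gaussian monoid $M$ is an element $\Delta$ such that the left divisors of $\Delta$ coincide with the right divisors of $\Delta$, they are finite in number, and they generate $M$. A Garside monoid is a Gaussian monoid that contains a Garside element. Every Gaussian monoid satisfies Ore's conditions, hence embeds in a group of fractions. A group is a Garside group if it is the group of fractions of some Garside monoid. *)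

theory Defs
  imports "HOL-Algebra.Divisibility" "HOL-Library.Extended_Nat" "HOL-Library.Nat_Bijection"
begin

section \<open>Garside monoids and Garside groups\<close>

text \<open>
  The library notions \<open>divides\<close>, \<open>gcdof\<close>, \<open>lcmof\<close> do not require commutativity: in a
  monoid they are left divisibility, left gcd and right lcm. The symmetric notions (right
  divisibility, right gcd, left lcm) are the same notions in the opposite monoid.
\<close>

definition opposite :: "'a monoid \<Rightarrow> 'a monoid" where
  "opposite M = \<lparr>carrier = carrier M, mult = (\<lambda>x y. y \<otimes>\<^bsub>M\<^esub> x), one = \<one>\<^bsub>M\<^esub>\<rparr>"

definition left_divisors :: "'a monoid \<Rightarrow> 'a \<Rightarrow> 'a set" where
  "left_divisors M x = {y \<in> carrier M. y divides\<^bsub>M\<^esub> x}"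

definition right_divisors :: "'a monoid \<Rightarrow> 'a \<Rightarrow> 'a set" where
  "right_divisors M x = {y \<in> carrier M. y divides\<^bsub>opposite M\<^esub> x}"

definition atoms :: "'a monoid \<Rightarrow> 'a set" where
  "atoms M = {x \<in> carrier M. x \<noteq> \<one>\<^bsub>M\<^esub> \<and>
     (\<forall>y\<in>carrier M. \<forall>z\<in>carrier M. x = y \<otimes>\<^bsub>M\<^esub> z \<longrightarrow> y = \<one>\<^bsub>M\<^esub> \<or> z = \<one>\<^bsub>M\<^esub>)}"

definition expressions :: "'a monoid \<Rightarrow> 'a set \<Rightarrow> 'a \<Rightarrow> 'a list set" where
  "expressions M S x = {w. set w \<subseteq> S \<and> foldr (\<otimes>\<^bsub>M\<^esub>) w \<one>\<^bsub>M\<^esub> = x}"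

definition generates :: "'a monoid \<Rightarrow> 'a set \<Rightarrow> bool" where
  "generates M S \<longleftrightarrow> S \<subseteq> carrier M \<and> (\<forall>x\<in>carrier M. expressions M S x \<noteq> {})"

definition atomic_norm :: "'a monoid \<Rightarrow> 'a \<Rightarrow> enat" where
  "atomic_norm M x = (SUP w \<in> expressions M (atoms M) x. enat (length w))"

definition atomic_monoid :: "'a monoid \<Rightarrow> bool" where
  "atomic_monoid M \<longleftrightarrow>
     monoid M \<and> generates M (atoms M) \<and> (\<forall>x\<in>carrier M. atomic_norm M x < \<infinity>)"

definition gaussian_monoid :: "'a monoid \<Rightarrow> bool" where
  "gaussian_monoid M \<longleftrightarrow> atomic_monoid M \<and> monoid_cancel M \<and>
     (\<forall>x\<in>carrier M. \<forall>y\<in>carrier M.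
        (\<exists>z\<in>carrier M. z lcmof\<^bsub>M\<^esub> x y) \<and>
        (\<exists>z\<in>carrier M. z lcmof\<^bsub>opposite M\<^esub> x y) \<and>
        (\<exists>z\<in>carrier M. z gcdof\<^bsub>M\<^esub> x y) \<and>
        (\<exists>z\<in>carrier M. z gcdof\<^bsub>opposite M\<^esub> x y))"

definition garside_element :: "'a monoid \<Rightarrow> 'a \<Rightarrow> bool" where
  "garside_element M \<Delta> \<longleftrightarrow> \<Delta> \<in> carrier M \<and>
     left_divisors M \<Delta> = right_divisors M \<Delta> \<and>
     finite (left_divisors M \<Delta>) \<and> generates M (left_divisors M \<Delta>)"

definition garside_monoid :: "'a monoid \<Rightarrow> bool" where
  "garside_monoid M \<longleftrightarrow> gaussian_monoid M \<and> (\<exists>\<Delta>. garside_element M \<Delta>)"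

text \<open>
  Right fractions \<open>x y\<inverse>\<close> are used. When any two elements of \<open>M\<close> have a common right multiple
  and a common left multiple, as in a Gaussian monoid, left fractions describe the same groups.
\<close>

definition group_of_fractions :: "'b monoid \<Rightarrow> 'a monoid \<Rightarrow> bool" where
  "group_of_fractions G M \<longleftrightarrow> group G \<and>
     (\<exists>i \<in> hom M G. inj_on i (carrier M) \<and>
        (\<forall>g\<in>carrier G. \<exists>x\<in>carrier M. \<exists>y\<in>carrier M. g = i x \<otimes>\<^bsub>G\<^esub> inv\<^bsub>G\<^esub> (i y)))"

text \<open>
  Since \<open>M\<close> embeds in \<open>G\<close>, taking \<open>M\<close> over the element type of \<open>G\<close> loses no generality.
\<close>

definition garside_group :: "'a monoid \<Rightarrow> bool" where
  "garside_group G \<longleftrightarrow> (\<exists>M :: 'a monoid. garside_monoid M \<and> group_of_fractions G M)"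


section \<open>Presentations\<close>

text \<open>The congruence on the free monoid \<open>lists A\<close> generated by the pairs in \<open>R\<close>.\<close>

inductive_set presentation_cong :: "'x set \<Rightarrow> ('x list \<times> 'x list) set \<Rightarrow> ('x list \<times> 'x list) set"
  for A R where
  base: "\<lbrakk>(u, v) \<in> R; u \<in> lists A; v \<in> lists A; x \<in> lists A; y \<in> lists A\<rbrakk>
          \<Longrightarrow> (x @ u @ y, x @ v @ y) \<in> presentation_cong A R"
| refl: "w \<in> lists A \<Longrightarrow> (w, w) \<in> presentation_cong A R"
| sym: "(u, v) \<in> presentation_cong A R \<Longrightarrow> (v, u) \<in> presentation_cong A R"
| trans: "\<lbrakk>(u, v) \<in> presentation_cong A R; (v, w) \<in> presentation_cong A R\<rbrakk>
          \<Longrightarrow> (u, w) \<in> presentation_cong A R"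

definition monoid_presented_by :: "'x set \<Rightarrow> ('x list \<times> 'x list) set \<Rightarrow> 'x list set monoid" where
  "monoid_presented_by A R =
     \<lparr>carrier = lists A // presentation_cong A R,
      mult = (\<lambda>X Y. \<Union>u\<in>X. \<Union>v\<in>Y. presentation_cong A R `` {u @ v}),
      one = presentation_cong A R `` {[]}\<rparr>"

text \<open>
  A finite presentation consists of the size \<open>n\<close> of the alphabet \<open>{..<n}\<close> and a list of pairs of
  words. In group words, \<open>Inl a\<close> is the generator \<open>a\<close> and \<open>Inr a\<close> its formal inverse.
\<close>

type_synonym monoid_presentation = "nat \<times> (nat list \<times> nat list) list"
type_synonym group_presentation = "nat \<times> ((nat + nat) list \<times> (nat + nat) list) list"

definition signed_alphabet :: "nat \<Rightarrow> (nat + nat) set" where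
  "signed_alphabet n = {..<n} <+> {..<n}"

definition free_reductions :: "nat \<Rightarrow> ((nat + nat) list \<times> (nat + nat) list) set" where
  "free_reductions n = (\<Union>a<n. {([Inl a, Inr a], []), ([Inr a, Inl a], [])})"

fun wf_monoid_presentation :: "monoid_presentation \<Rightarrow> bool" where
  "wf_monoid_presentation (n, R) \<longleftrightarrow> set R \<subseteq> lists {..<n} \<times> lists {..<n}"

fun wf_group_presentation :: "group_presentation \<Rightarrow> bool" where
  "wf_group_presentation (n, R) \<longleftrightarrow>
     set R \<subseteq> lists (signed_alphabet n) \<times> lists (signed_alphabet n)"

fun presented_monoid :: "monoid_presentation \<Rightarrow> nat list set monoid" where
  "presented_monoid (n, R) = monoid_presented_by {..<n} (set R)"

fun presented_group :: "group_presentation \<Rightarrow> (nat + nat) list set monoid" where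
  "presented_group (n, R) =
     monoid_presented_by (signed_alphabet n) (free_reductions n \<union> set R)"

fun monoid_presentation_code :: "monoid_presentation \<Rightarrow> nat" where
  "monoid_presentation_code (n, R) = prod_encode (n,
     list_encode (map (\<lambda>(u, v). prod_encode (list_encode u, list_encode v)) R))"

fun group_presentation_code :: "group_presentation \<Rightarrow> nat" where
  "group_presentation_code (n, R) = prod_encode (n,
     list_encode (map (\<lambda>(u, v). prod_encode
       (list_encode (map sum_encode u), list_encode (map sum_encode v))) R))"


section \<open>Recursively enumerable sets\<close>

text \<open>
  Programs for partial recursive functions of arbitrary arity. Programs carry no arity:
  on an argument list of unsuitable length the value may be undefined.
\<close>

datatype recf =
    Zero
  | Successor
  | Proj nat
  | Comp recf "recf list"
  | PrimRec recf recf
  | Mu recf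

inductive evaluates :: "recf \<Rightarrow> nat list \<Rightarrow> nat \<Rightarrow> bool" where
  "evaluates Zero xs 0"
| "evaluates Successor [x] (Suc x)"
| "i < length xs \<Longrightarrow> evaluates (Proj i) xs (xs ! i)"
| "\<lbrakk>list_all2 (\<lambda>g y. evaluates g xs y) gs ys; evaluates f ys z\<rbrakk> \<Longrightarrow> evaluates (Comp f gs) xs z"
| "evaluates f xs y \<Longrightarrow> evaluates (PrimRec f g) (0 # xs) y"
| "\<lbrakk>evaluates (PrimRec f g) (n # xs) r; evaluates g (n # r # xs) y\<rbrakk>
    \<Longrightarrow> evaluates (PrimRec f g) (Suc n # xs) y"
| "\<lbrakk>evaluates f (n # xs) 0; \<forall>m<n. \<exists>y>0. evaluates f (m # xs) y\<rbrakk> \<Longrightarrow> evaluates (Mu f) xs n"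

definition recursively_enumerable :: "nat set \<Rightarrow> bool" where
  "recursively_enumerable A \<longleftrightarrow> (\<exists>p. A = {x. \<exists>y. evaluates p [x] y})"

end

theory Submission
  imports Defs "HOL-Combinatorics.Cycles"
begin

text \<open>
  For simple elements \<open>x\<close>, \<open>y\<close> of a Garside monoid (the divisors of \<open>\<Delta>\<close>) let \<open>x \<triangleright> y\<close> be the simple
  element with \<open>x (x \<triangleright> y)\<close> the right lcm of \<open>x\<close> and \<open>y\<close>. The finite table of \<open>\<triangleright>\<close> satisfies the cube law
  \<open>(x \<triangleright> y) \<triangleright> (x \<triangleright> z) = (y \<triangleright> x) \<triangleright> (y \<triangleright> z)\<close>, and the monoid is presented by the relations
  \<open>x (x \<triangleright> y) = y (y \<triangleright> x)\<close>. Conversely, for every finite table with the cube law and a top element \<open>\<Delta>\<close>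
  such that \<open>x \<mapsto> x \<triangleright> \<Delta>\<close> is onto, these relations present a Garside monoid: extending \<open>\<triangleright>\<close> to words
  yields left cancellation, right lcms and the finiteness of the sets of right divisors, and conjugation
  by \<open>\<Delta>\<close>, a permutation of the table, yields the rest. The same relations present the group of
  fractions, into which the monoid embeds since it acts faithfully on the fractions \<open>\<Delta>\<^sup>-\<^sup>k w\<close>.
  So a presentation defines a Garside monoid (group) iff the monoid (group) presented by some table is
  isomorphic to it. Being such a table is decidable, and isomorphism of finite presentations is witnessed
  by finitely many words and rewriting sequences, hence recursively enumerable.
\<close>

section \<open>Complement tables\<close>

text \<open>The axioms of a Garside monoid quantify over infinitely many elements. A table replaces
  them by finitely many equations, and the only unbounded search left is the one for an isomorphism.
  The complement of two simple elements is again simple. Hence completing two words to a common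
  right multiple fills a rectangular grid of squares, a structural recursion that always ends and
  never lengthens a word. So every right factor of a word of n letters is represented by n letters,
  which bounds the right divisors and yields atomicity. The obstacle is the missing left-right
  symmetry: a table knows right lcms only. Conjugation by \<Delta> has finite order, so its inverse
  is an iterate of it and respects equality of words; this gives right cancellation. Every element
  right divides a power of \<Delta>, and left lcms are quotients of such powers by left gcds. For
  groups, a derivation between positive words may pass through inverse letters. The action on
  fractions shows that this identifies no further positive words.\<close>

locale complement_table =
  fixes S :: "'a set" and cm :: "'a \<Rightarrow> 'a \<Rightarrow> 'a" (infixl \<open>\<triangleright>\<close> 75) and e :: 'a
  assumes cm_closed [simp]: "\<lbrakk>x \<in> S; y \<in> S\<rbrakk> \<Longrightarrow> x \<triangleright> y \<in> S"
    and e_closed [simp]: "e \<in> S"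
    and cm_self [simp]: "x \<in> S \<Longrightarrow> x \<triangleright> x = e"
    and cm_e [simp]: "x \<in> S \<Longrightarrow> x \<triangleright> e = e"
    and e_cm [simp]: "x \<in> S \<Longrightarrow> e \<triangleright> x = x"
    and cube: "\<lbrakk>x \<in> S; y \<in> S; z \<in> S\<rbrakk> \<Longrightarrow> (x \<triangleright> y) \<triangleright> (x \<triangleright> z) = (y \<triangleright> x) \<triangleright> (y \<triangleright> z)"
begin

text \<open>\<open>cw u w\<close> is the word that completes \<open>u\<close> to the right lcm of \<open>u\<close> and \<open>w\<close>; \<open>lw\<close> and \<open>wl\<close> are the cases
  where \<open>u\<close>, respectively \<open>w\<close>, is a letter. Letters \<open>e\<close> are kept, so that \<open>cw u w\<close> is as long as \<open>w\<close>.\<close>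

fun lw :: "'a \<Rightarrow> 'a list \<Rightarrow> 'a list" where
  "lw x [] = []"
| "lw x (y # w) = (x \<triangleright> y) # lw (y \<triangleright> x) w"

abbreviation cw :: "'a list \<Rightarrow> 'a list \<Rightarrow> 'a list" where
  "cw u w \<equiv> fold lw u w"

abbreviation wl :: "'a list \<Rightarrow> 'a \<Rightarrow> 'a" where
  "wl u x \<equiv> fold cm u x"

definition triv :: "'a list \<Rightarrow> bool" where
  "triv w \<longleftrightarrow> set w \<subseteq> {e}"

text \<open>\<open>triv (cw u v)\<close> means that v left divides u, as nothing but
  \<open>e\<close> is needed to complete u to the lcm. So \<open>sim\<close> is mutual left
  divisibility, which is equality in a cancellative monoid without invertible elements other than
  1.\<close>

definition sim :: "'a list \<Rightarrow> 'a list \<Rightarrow> bool" where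
  "sim u v \<longleftrightarrow> triv (cw u v) \<and> triv (cw v u)"

lemma length_lw [simp]: "length (lw x w) = length w"
  by (induction w arbitrary: x) auto

lemma length_cw [simp]: "length (cw u w) = length w"
  by (induction u arbitrary: w) auto

lemma lw_closed [simp]: "\<lbrakk>x \<in> S; w \<in> lists S\<rbrakk> \<Longrightarrow> lw x w \<in> lists S"
  by (induction w arbitrary: x) auto

lemma cw_closed [simp]: "\<lbrakk>u \<in> lists S; w \<in> lists S\<rbrakk> \<Longrightarrow> cw u w \<in> lists S"
  by (induction u arbitrary: w) auto

lemma wl_closed [simp]: "\<lbrakk>u \<in> lists S; x \<in> S\<rbrakk> \<Longrightarrow> wl u x \<in> S"
  by (induction u arbitrary: x) auto

lemma cw_Nil [simp]: "cw u [] = []"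
  by (induction u) auto

lemma lw_append: "lw x (v @ w) = lw x v @ lw (wl v x) w"
  by (induction v arbitrary: x) auto

text \<open>\<open>cw\<close> is defined by recursion on its first word. This is the recursion on
  the second word, which fills the same grid in the other direction.\<close>

lemma cw_Cons: "cw v (x # u) = wl v x # cw (lw x v) u"
  by (induction v arbitrary: x u) auto

lemma cw_append: "cw u (v @ w) = cw u v @ cw (cw v u) w"
  by (induction u arbitrary: v w) (auto simp: lw_append cw_Cons)

lemma triv_append [simp]: "triv (u @ v) \<longleftrightarrow> triv u \<and> triv v"
  by (auto simp: triv_def)

lemma triv_Nil [simp]: "triv []"
  by (simp add: triv_def)

lemma triv_Cons [simp]: "triv (x # u) \<longleftrightarrow> x = e \<and> triv u"
  by (auto simp: triv_def)

lemma lw_e [simp]: "w \<in> lists S \<Longrightarrow> lw e w = w"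
  by (induction w) auto

lemma cw_triv_left: "\<lbrakk>triv u; w \<in> lists S\<rbrakk> \<Longrightarrow> cw u w = w"
  by (induction u) auto

lemma lw_triv: "\<lbrakk>triv w; x \<in> S\<rbrakk> \<Longrightarrow> triv (lw x w)"
  by (induction w arbitrary: x) auto

lemma cw_triv_right: "\<lbrakk>triv w; u \<in> lists S\<rbrakk> \<Longrightarrow> triv (cw u w)"
  by (induction u arbitrary: w) (auto simp: lw_triv)

lemma wl_e [simp]: "u \<in> lists S \<Longrightarrow> wl u e = e"
  by (induction u) auto

lemma cw_self: "u \<in> lists S \<Longrightarrow> triv (cw u u)"
  by (induction u) (auto simp: cw_Cons)

lemma cube_lw:
  "\<lbrakk>x \<in> S; y \<in> S; w \<in> lists S\<rbrakk> \<Longrightarrow> lw (x \<triangleright> y) (lw x w) = lw (y \<triangleright> x) (lw y w)"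
proof (induction w arbitrary: x y)
  case (Cons z w)
  then have "lw ((z \<triangleright> x) \<triangleright> (z \<triangleright> y)) (lw (z \<triangleright> x) w) = lw ((z \<triangleright> y) \<triangleright> (z \<triangleright> x)) (lw (z \<triangleright> y) w)"
    by auto
  \<comment> \<open>The first letters agree by the first instance of the cube law. The other two
    rewrite the letters carried on to \<open>w\<close> as \<open>(z \<triangleright> x)
    \<triangleright> (z \<triangleright> y)\<close> and \<open>(z \<triangleright> y)
    \<triangleright> (z \<triangleright> x)\<close>, to which the induction hypothesis
    applies.\<close>
  with Cons.prems show ?case
    using cube[of x y z] cube[of x z y] cube[of y z x] by auto
qed auto

lemma cube_cw_letter:
  "\<lbrakk>x \<in> S; v \<in> lists S; w \<in> lists S\<rbrakk> \<Longrightarrow> cw (lw x v) (lw x w) = lw (wl v x) (cw v w)"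
proof (induction v arbitrary: x w)
  case (Cons y v)
  then show ?case using cube_lw[of x y w] by auto
qed auto

text \<open>The cube law passes from letters to words because a cube of words is a stack of
  unit cubes, each of which closes exactly.\<close>

lemma cube_cw:
  "\<lbrakk>u \<in> lists S; v \<in> lists S; w \<in> lists S\<rbrakk> \<Longrightarrow> cw (cw u v) (cw u w) = cw (cw v u) (cw v w)"
  by (induction u arbitrary: v w) (auto simp: cw_Cons cube_cw_letter)

section \<open>Left divisibility and right lcms of words\<close>

lemma sim_refl [simp]: "u \<in> lists S \<Longrightarrow> sim u u"
  by (simp add: sim_def cw_self)

lemma sim_sym: "sim u v \<Longrightarrow> sim v u"
  by (simp add: sim_def)

text \<open>Transitivity of left divisibility is the cube law in a degenerate case: a trivial
  \<open>cw u v\<close> acts as the identity, so one side is \<open>cw u w\<close>, and the other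
  side is trivial with \<open>cw v w\<close>.\<close>

lemma triv_cw_trans:
  assumes "u \<in> lists S" "v \<in> lists S" "w \<in> lists S" "triv (cw u v)" "triv (cw v w)"
  shows "triv (cw u w)"
  using cube_cw[of u v w] assms by (metis cw_closed cw_triv_left cw_triv_right)

lemma sim_trans:
  assumes "u \<in> lists S" "v \<in> lists S" "w \<in> lists S" "sim u v" "sim v w"
  shows "sim u w"
  using assms triv_cw_trans unfolding sim_def by blast

text \<open>The source of left cancellation: the two copies of w meet first in the grid and leave
  only the trivial word \<open>cw w w\<close>, so that u and v are compared unchanged.\<close>

lemma cw_append_left_cancel:
  assumes "u \<in> lists S" "v \<in> lists S" "w \<in> lists S"
  shows "triv (cw (w @ u) (w @ v)) \<longleftrightarrow> triv (cw u v)"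
proof -
  have t: "triv (cw w w)" using assms by (simp add: cw_self)
  have "cw (w @ u) (w @ v) = cw u (cw w w) @ cw (cw (cw w w) u) v"
    using assms t by (simp add: cw_append cw_triv_left)
  then show ?thesis using t assms by (simp add: cw_triv_left cw_triv_right)
qed

lemma sim_left_cancel:
  "\<lbrakk>u \<in> lists S; v \<in> lists S; w \<in> lists S\<rbrakk> \<Longrightarrow> sim (w @ u) (w @ v) \<longleftrightarrow> sim u v"
  unfolding sim_def by (simp only: cw_append_left_cancel)

lemma sim_append_right:
  assumes "u \<in> lists S" "v \<in> lists S" "w \<in> lists S" "sim u v"
  shows "sim (u @ w) (v @ w)"
proof -
  have "triv (cw (u @ w) (v @ w))"
    if "u \<in> lists S" "v \<in> lists S" "triv (cw u v)" "triv (cw v u)" for u v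
    using that assms(3) by (simp add: cw_append cw_triv_left cw_triv_right cw_self)
  then show ?thesis using assms by (simp add: sim_def)
qed

lemma sim_append:
  assumes "u \<in> lists S" "v \<in> lists S" "u' \<in> lists S" "v' \<in> lists S" "sim u u'" "sim v v'"
  shows "sim (u @ v) (u' @ v')"
  using sim_trans[of "u @ v" "u' @ v" "u' @ v'"] assms
  by (simp add: sim_append_right sim_left_cancel)

lemma sim_lcm:
  assumes "u \<in> lists S" "v \<in> lists S"
  shows "sim (u @ cw u v) (v @ cw v u)"
proof -
  have "triv (cw (u @ cw u v) (v @ cw v u))" if "u \<in> lists S" "v \<in> lists S" for u v
    using that by (simp add: cw_append cw_self cw_triv_left)
  then show ?thesis using assms by (simp add: sim_def)
qed

lemma sim_triv: "triv t \<Longrightarrow> sim t []"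
  by (simp add: sim_def cw_triv_right)

lemma triv_closed: "triv t \<Longrightarrow> t \<in> lists S"
  by (auto simp: triv_def)

lemma sim_append_triv: "\<lbrakk>u \<in> lists S; triv t\<rbrakk> \<Longrightarrow> sim (u @ t) u"
  using sim_append[of u t u "[]"] by (simp add: sim_triv triv_closed)

text \<open>If \<open>cw z u\<close> is trivial, then the lcm of both words is z itself and
  \<open>cw u z\<close> is the quotient. Left divisibility thus becomes a computation in the
  table.\<close>

lemma triv_cw_iff_left_divisor:
  assumes "u \<in> lists S" "z \<in> lists S"
  shows "triv (cw z u) \<longleftrightarrow> (\<exists>w\<in>lists S. sim (u @ w) z)"
proof
  assume "triv (cw z u)"
  then have "sim (u @ cw u z) z"
    using sim_lcm[of u z] sim_append_triv[of z "cw z u"] sim_trans[of "u @ cw u z" "z @ cw z u" z] assms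
    by simp
  moreover have "cw u z \<in> lists S" using assms by simp
  ultimately show "\<exists>w\<in>lists S. sim (u @ w) z" by blast
next
  assume "\<exists>w\<in>lists S. sim (u @ w) z"
  then obtain w where w: "w \<in> lists S" "sim (u @ w) z" by auto
  have "triv (cw (u @ w) u)" using assms w by (simp add: cw_self cw_triv_right)
  then show "triv (cw z u)"
    using triv_cw_trans[of z "u @ w" u] w assms by (simp add: sim_def)
qed

text \<open>The representative \<open>cw u w\<close> of the right factor has the length of w. This
  will bound the number of right divisors, however long the words are that represent them at
  first.\<close>

lemma right_factor_unique:
  assumes "u \<in> lists S" "v \<in> lists S" "w \<in> lists S" "sim (u @ v) w"
  shows "sim v (cw u w)"
proof -
  have "triv (cw w u)" using assms triv_cw_iff_left_divisor by blast
  then have "sim (w @ cw w u) w" using assms by (simp add: sim_append_triv)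
  then have "sim (u @ v) (u @ cw u w)"
    using sim_lcm[of u w] assms sim_trans[of "u @ v" w "u @ cw u w"]
      sim_trans[of "u @ cw u w" "w @ cw w u" w] sim_sym by auto
  then show ?thesis using assms by (simp add: sim_left_cancel)
qed

lemma sim_Nil_iff: "sim u [] \<longleftrightarrow> triv u"
  by (auto simp: sim_def)

text \<open>The part of \<open>cw z (u @ cw u v)\<close> beyond \<open>cw z u\<close> is one side of
  the cube law for u, z, v. The other side, \<open>cw (cw z u) (cw z v)\<close>, is trivial with
  \<open>cw z v\<close>.\<close>

lemma lcm_least:
  assumes "u \<in> lists S" "v \<in> lists S" "z \<in> lists S" "triv (cw z u)" "triv (cw z v)"
  shows "triv (cw z (u @ cw u v))"
  using assms cube_cw[of u z v] cw_triv_right[of "cw z v" "cw z u"]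
  by (simp add: cw_append)

end

text \<open>By \<open>d_cm\<close> every letter left divides \<open>d\<close>. By
  \<open>cm_d_surj\<close> every letter right divides it, since y (y \<triangleright> d) = d. An
  onto map of a finite set to itself is a bijection, which makes conjugation by \<open>d\<close>
  invertible on letters.\<close>

locale garside_table = complement_table +
  fixes d
  assumes finite_S: "finite S"
    and d_closed [simp]: "d \<in> S"
    and d_cm [simp]: "x \<in> S \<Longrightarrow> d \<triangleright> x = e"
    and cm_d_surj: "x \<in> S \<Longrightarrow> \<exists>y\<in>S. y \<triangleright> d = x"
begin

text \<open>In the monoid, \<open>x (st x) = d\<close> and \<open>x d = d (ph x)\<close>.\<close>

definition st :: "'a \<Rightarrow> 'a" where "st x = x \<triangleright> d"
definition ph :: "'a \<Rightarrow> 'a" where "ph x = st (st x)"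

lemma st_closed [simp]: "x \<in> S \<Longrightarrow> st x \<in> S"
  by (simp add: st_def)

lemma ph_closed [simp]: "x \<in> S \<Longrightarrow> ph x \<in> S"
  by (simp add: ph_def)

lemma bij_st: "bij_betw st S S"
  using finite_S cm_d_surj unfolding bij_betw_def
  by (metis (no_types, lifting) equalityI finite_surj_inj image_subsetI st_closed st_def subsetI image_eqI)

lemma bij_ph: "bij_betw ph S S"
  using bij_betw_trans[OF bij_st bij_st] by (simp add: ph_def comp_def bij_betw_def inj_on_def image_def)

lemma map_ph_closed [simp]: "u \<in> lists S \<Longrightarrow> map ph u \<in> lists S"
  by auto

lemma sim_st: "x \<in> S \<Longrightarrow> sim [x, st x] [d]"
  by (simp add: sim_def st_def)

section \<open>Conjugation by the top element and right cancellation\<close>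

lemma sim_d_letter:
  assumes "x \<in> S"
  shows "sim [x, d] [d, ph x]"
proof -
  \<comment> \<open>Both words equal x (st x) (ph x), because the last two letters multiply to
    \<open>d\<close>, and so do the first two.\<close>
  have "sim [x, d] [x, st x, st (st x)]"
    using sim_left_cancel[of "[d]" "[st x, st (st x)]" "[x]"] sim_st[of "st x"] assms
    by (simp add: sim_sym)
  moreover have "sim [x, st x, st (st x)] [d, ph x]"
    using sim_append_right[of "[x, st x]" "[d]" "[st (st x)]"] sim_st assms by (simp add: ph_def)
  ultimately show ?thesis using sim_trans[of "[x,d]" "[x, st x, st (st x)]" "[d, ph x]"] assms by simp
qed

lemma sim_d_word: "u \<in> lists S \<Longrightarrow> sim (u @ [d]) (d # map ph u)"
proof (induction u)
  case (Cons x u)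
  then have "sim ([x] @ u @ [d]) ([x] @ d # map ph u)"
    by (subst sim_left_cancel) auto
  moreover have "sim ([x, d] @ map ph u) ([d, ph x] @ map ph u)"
    using Cons sim_append_right[of "[x,d]" "[d, ph x]" "map ph u"] sim_d_letter by auto
  ultimately show ?case
    using Cons sim_trans[of "x # u @ [d]" "x # d # map ph u" "d # ph x # map ph u"] by simp
qed auto

lemma sim_map_ph:
  assumes "u \<in> lists S" "v \<in> lists S" "sim u v"
  shows "sim (map ph u) (map ph v)"
proof -
  have "sim (u @ [d]) (v @ [d])" using assms by (simp add: sim_append_right)
  then have "sim ([d] @ map ph u) ([d] @ map ph v)"
    using sim_d_word[of u] sim_d_word[of v] assms sim_sym
      sim_trans[of "[d] @ map ph u" "u @ [d]" "v @ [d]"]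
      sim_trans[of "[d] @ map ph u" "v @ [d]" "[d] @ map ph v"] by auto
  then show ?thesis using assms sim_left_cancel[of "map ph u" "map ph v" "[d]"] by simp
qed

lemma ph_finite_order: "\<exists>n. \<forall>x\<in>S. (ph ^^ Suc n) x = x"
proof -
  \<comment> \<open>\<open>permutes\<close> asks for a map that is the identity outside
    \<open>S\<close>.\<close>
  define p where "p x = (if x \<in> S then ph x else x)" for x
  have "bij_betw p S S" using bij_ph by (simp add: p_def cong: bij_betw_cong)
  then have "p permutes S" by (rule bij_imp_permutes) (simp add: p_def)
  then have "permutation p" using finite_S by (auto simp: permutation_permutes)
  then obtain n where n: "p ^^ n = id" "n > 0" by (rule permutation_is_nilpotent)
  have "(ph ^^ k) x = (p ^^ k) x \<and> (ph ^^ k) x \<in> S" if "x \<in> S" for x k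
    using that by (induction k) (auto simp: p_def)
  then show ?thesis using n by (intro exI[of _ "n - 1"]) simp
qed

definition ps :: "'a \<Rightarrow> 'a" where "ps = inv_into S ph"

lemma ps_closed [simp]: "x \<in> S \<Longrightarrow> ps x \<in> S"
  using bij_ph unfolding ps_def by (metis bij_betw_def inv_into_into)

lemma ph_ps [simp]: "x \<in> S \<Longrightarrow> ph (ps x) = x"
  using bij_ph unfolding ps_def by (metis bij_betw_def f_inv_into_f)

lemma ps_ph [simp]: "x \<in> S \<Longrightarrow> ps (ph x) = x"
  using bij_ph unfolding ps_def by (metis bij_betw_def inv_into_f_f)

lemma map_ps_closed [simp]: "u \<in> lists S \<Longrightarrow> map ps u \<in> lists S"
  by auto

lemma map_ph_ps [simp]: "u \<in> lists S \<Longrightarrow> map ph (map ps u) = u"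
  by (induction u) auto

lemma map_ps_ph [simp]: "u \<in> lists S \<Longrightarrow> map ps (map ph u) = u"
  by (induction u) auto

text \<open>Finite order makes the inverse of the letter permutation \<open>ph\<close> a power of it, so it
  respects \<open>sim\<close> as well.\<close>

lemma sim_map_ps:
  assumes "u \<in> lists S" "v \<in> lists S" "sim u v"
  shows "sim (map ps u) (map ps v)"
proof -
  obtain n where n: "\<And>x. x \<in> S \<Longrightarrow> (ph ^^ Suc n) x = x" using ph_finite_order by blast
  have cl: "(ph ^^ k) x \<in> S" if "x \<in> S" for x k using that by (induction k) auto
  have "(ph ^^ n) x = ps x" if "x \<in> S" for x
    using n[OF that] ps_ph[OF cl[OF that, of n]] by simp
  then have eq: "map ps w = map (ph ^^ n) w" if "w \<in> lists S" for w using that by auto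
  have "sim (map (ph ^^ k) u) (map (ph ^^ k) v)" for k
  proof (induction k)
    case (Suc k)
    have "map (ph ^^ k) w \<in> lists S" if "w \<in> lists S" for w using that cl by auto
    then have "sim (map ph (map (ph ^^ k) u)) (map ph (map (ph ^^ k) v))"
      using Suc sim_map_ph[of "map (ph ^^ k) u" "map (ph ^^ k) v"] assms by metis
    then show ?case by (simp add: comp_def)
  qed (use assms in auto)
  then show ?thesis using eq[OF assms(1)] eq[OF assms(2)] by metis
qed

lemma sim_map_ph_iff:
  "\<lbrakk>u \<in> lists S; v \<in> lists S\<rbrakk> \<Longrightarrow> sim (map ph u) (map ph v) \<longleftrightarrow> sim u v"
  using sim_map_ph sim_map_ps[of "map ph u" "map ph v"] by (metis map_ph_closed map_ps_ph)

text \<open>Moving \<open>d\<close> to the front by \<open>sim_d_word\<close> makes it a left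
  factor, which cancels; \<open>sim_map_ph_iff\<close> then removes \<open>ph\<close>.\<close>

lemma sim_right_cancel_d:
  assumes "u \<in> lists S" "v \<in> lists S" "sim (u @ [d]) (v @ [d])"
  shows "sim u v"
proof -
  have "sim ([d] @ map ph u) ([d] @ map ph v)"
    using sim_d_word[of u] sim_d_word[of v] assms sim_sym
      sim_trans[of "[d] @ map ph u" "u @ [d]" "v @ [d]"]
      sim_trans[of "[d] @ map ph u" "v @ [d]" "[d] @ map ph v"] by auto
  then show ?thesis using assms sim_left_cancel[of "map ph u" "map ph v" "[d]"]
    by (simp add: sim_map_ph_iff)
qed

text \<open>Appending \<open>st s\<close> turns a last letter s into \<open>d\<close>, which
  \<open>sim_right_cancel_d\<close> removes.\<close>

lemma sim_right_cancel:
  "\<lbrakk>u \<in> lists S; v \<in> lists S; w \<in> lists S; sim (u @ w) (v @ w)\<rbrakk> \<Longrightarrow> sim u v"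
proof (induction w rule: rev_induct)
  case (snoc s w)
  then have s: "s \<in> S" "w \<in> lists S" by auto
  have "sim ((u @ w) @ [s, st s]) ((v @ w) @ [s, st s])"
    using snoc.prems s sim_append_right[of "u @ w @ [s]" "v @ w @ [s]" "[st s]"] by simp
  moreover have "sim (x @ [s, st s]) (x @ [d])" if "x \<in> lists S" for x
    using that s by (subst sim_left_cancel) (auto simp: sim_st)
  ultimately have "sim ((u @ w) @ [d]) ((v @ w) @ [d])"
    using sim_trans[of "(u @ w) @ [d]" "(u @ w) @ [s, st s]" "(v @ w) @ [s, st s]"]
      sim_trans[of "(u @ w) @ [d]" "(v @ w) @ [s, st s]" "(v @ w) @ [d]"] snoc.prems s
      sim_sym[of "(u @ w) @ [s, st s]" "(u @ w) @ [d]"]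
    by (metis append_in_lists_conv d_closed lists.simps st_closed)
  then have "sim (u @ w) (v @ w)" using snoc.prems s sim_right_cancel_d[of "u @ w" "v @ w"] by simp
  then show ?case using snoc.IH snoc.prems s by simp
qed auto

section \<open>Powers of the top element as common multiples\<close>

text \<open>One letter \<open>d\<close> absorbs the first letter x and leaves
  \<open>lw (st x) u\<close>, a word as long as u, for which the remaining letters \<open>d\<close>
  suffice.\<close>

lemma cw_d_power: "w \<in> lists S \<Longrightarrow> triv (cw (replicate (length w) d) w)"
proof (induction "length w" arbitrary: w)
  case (Suc n)
  then obtain x u where w: "w = x # u" by (cases w) auto
  have "triv (cw (replicate (length u) d) (lw (st x) u))"
    using Suc.hyps(1)[of "lw (st x) u"] Suc.hyps(2) Suc.prems w by simp
  moreover have "replicate (length u) d \<in> lists S" by auto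
  ultimately show ?case using Suc.prems w
    by (simp add: cw_Cons st_def del: fold_replicate)
qed auto

lemma sim_d_power:
  "u \<in> lists S \<Longrightarrow> sim (u @ replicate k d) (replicate k d @ map (ph ^^ k) u)"
proof (induction k)
  case (Suc k)
  have cl: "map (ph ^^ k) u \<in> lists S" for k
    using Suc.prems by (induction k) auto
  have cr: "replicate k d \<in> lists S" by auto
  have "sim ((u @ replicate k d) @ [d]) ((replicate k d @ map (ph ^^ k) u) @ [d])"
    using Suc cl[of k] cr sim_append_right[of "u @ replicate k d" "replicate k d @ map (ph ^^ k) u" "[d]"]
    by (simp del: map_map)
  moreover have "sim (replicate k d @ map (ph ^^ k) u @ [d]) (replicate k d @ [d] @ map ph (map (ph ^^ k) u))"
    using sim_d_word[OF cl[of k]] cl[of k] cr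
      sim_left_cancel[of "map (ph ^^ k) u @ [d]" "[d] @ map ph (map (ph ^^ k) u)" "replicate k d"]
    by (simp del: map_map)
  moreover have "map ph (map (ph ^^ k) u) = map (ph ^^ Suc k) u" by simp
  ultimately have "sim (u @ replicate k d @ [d]) (replicate k d @ [d] @ map (ph ^^ Suc k) u)"
    using sim_trans[of "u @ replicate k d @ [d]" "replicate k d @ map (ph ^^ k) u @ [d]" "replicate k d @ [d] @ map (ph ^^ Suc k) u"]
      Suc.prems cl[of k] cl[of "Suc k"] cr by simp
  moreover have "replicate (Suc k) d = replicate k d @ [d]" by (simp add: replicate_append_same)
  ultimately show ?case by (simp add: comp_def)
qed auto

lemma right_divides_d_power:
  assumes "w \<in> lists S"
  shows "\<exists>v\<in>lists S. sim (v @ w) (replicate (length w) d)"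
proof -
  let ?n = "length w" and ?D = "replicate (length w) d"
  have D: "?D \<in> lists S" by auto
  have cl: "map (ps ^^ k) w \<in> lists S" for k
    using assms by (induction k) auto
  have inv: "map (ph ^^ k) (map (ps ^^ k) w) = w" for k
  proof (induction k)
    case (Suc k)
    have "map (ph ^^ Suc k) (map (ps ^^ Suc k) w) = map (ph ^^ k) (map ph (map ps (map (ps ^^ k) w)))"
      by (simp add: funpow_swap1 comp_def)
    then show ?case using Suc cl[of k] by (simp only: map_ph_ps)
  qed simp
  \<comment> \<open>Chosen so that u d^n = d^n w, with n the length of w. As u left divides d^n, say
    u v = d^n, it follows that u v w = d^n w = u d^n, and u cancels.\<close>
  define u where "u = map (ps ^^ ?n) w"
  have u: "u \<in> lists S" "length u = ?n" "map (ph ^^ ?n) u = w" using cl inv by (auto simp: u_def)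
  obtain v where v: "v \<in> lists S" "sim (u @ v) ?D"
    using cw_d_power[of u] u triv_cw_iff_left_divisor[of u ?D] D by auto
  have "sim (u @ (v @ w)) (?D @ w)"
    using v u D assms sim_append_right[of "u @ v" ?D w] by simp
  moreover have "sim (?D @ w) (u @ ?D)" using sim_d_power[of u ?n] u by (simp add: sim_sym)
  ultimately have "sim (u @ (v @ w)) (u @ ?D)"
    using sim_trans[of "u @ v @ w" "?D @ w" "u @ ?D"] u v D assms by simp
  then show ?thesis using v u D assms by (auto simp: sim_left_cancel)
qed

text \<open>If v w = d, then v w ph(v) = d ph(v) = v d, and cancelling v gives w ph(v) = d. The
  converse uses \<open>ps\<close> in the same way and cancels on the right.\<close>

lemma right_divisor_d_iff:
  assumes "w \<in> lists S"
  shows "(\<exists>v\<in>lists S. sim (v @ w) [d]) \<longleftrightarrow> (\<exists>v\<in>lists S. sim (w @ v) [d])"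
proof
  assume "\<exists>v\<in>lists S. sim (v @ w) [d]"
  then obtain v where v: "v \<in> lists S" "sim (v @ w) [d]" by auto
  have "sim (v @ [d]) ([d] @ map ph v)" using sim_d_word v by simp
  moreover have "sim ((v @ w) @ map ph v) ([d] @ map ph v)"
    using v assms sim_append_right[of "v @ w" "[d]" "map ph v"] by simp
  ultimately have "sim (v @ (w @ map ph v)) (v @ [d])"
    using sim_trans[of "v @ w @ map ph v" "[d] @ map ph v" "v @ [d]"] v assms sim_sym by simp
  then have "sim (w @ map ph v) [d]" using v assms sim_left_cancel[of "w @ map ph v" "[d]" v] by simp
  then show "\<exists>v\<in>lists S. sim (w @ v) [d]" using map_ph_closed[OF v(1)] by blast
next
  assume "\<exists>v\<in>lists S. sim (w @ v) [d]"
  then obtain v where v: "v \<in> lists S" "sim (w @ v) [d]" by auto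
  let ?p = "map ps v"
  have "sim (?p @ [d]) ([d] @ v)" using sim_d_word[of ?p] v by (simp del: map_map)
  moreover have "sim (?p @ (w @ v)) (?p @ [d])" using v assms by (subst sim_left_cancel) auto
  ultimately have "sim ((?p @ w) @ v) ([d] @ v)"
    using sim_trans[of "?p @ w @ v" "?p @ [d]" "[d] @ v"] v assms by simp
  then have "sim (?p @ w) [d]" using v assms sim_right_cancel[of "?p @ w" "[d]" v] by simp
  then show "\<exists>v\<in>lists S. sim (v @ w) [d]" using map_ps_closed[OF v(1)] by blast
qed

end

section \<open>Presented monoids\<close>

abbreviation mprod :: "('b, 'm) monoid_scheme \<Rightarrow> ('x \<Rightarrow> 'b) \<Rightarrow> 'x list \<Rightarrow> 'b" where
  "mprod N f w \<equiv> foldr (\<otimes>\<^bsub>N\<^esub>) (map f w) \<one>\<^bsub>N\<^esub>"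

lemma (in monoid) mprod_closed [simp]:
  "\<lbrakk>f ` A \<subseteq> carrier G; w \<in> lists A\<rbrakk> \<Longrightarrow> mprod G f w \<in> carrier G"
  by (induction w) auto

lemma (in monoid) mprod_append:
  "\<lbrakk>f ` A \<subseteq> carrier G; u \<in> lists A; v \<in> lists A\<rbrakk>
    \<Longrightarrow> mprod G f (u @ v) = mprod G f u \<otimes> mprod G f v"
proof (induction u)
  case (Cons x u)
  then have "f x \<in> carrier G" "mprod G f u \<in> carrier G" "mprod G f v \<in> carrier G"
    using mprod_closed[of f A] by auto
  then show ?case using Cons by (simp add: m_assoc)
qed (use mprod_closed[of f A] in auto)

lemma presentation_cong_in_lists:
  "(u, v) \<in> presentation_cong A R \<Longrightarrow> u \<in> lists A \<and> v \<in> lists A"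
  by (induction rule: presentation_cong.induct) auto

lemma equiv_presentation_cong: "equiv (lists A) (presentation_cong A R)"
proof (rule equivI)
  show "presentation_cong A R \<subseteq> lists A \<times> lists A"
    using presentation_cong_in_lists by fast
  show "refl_on (lists A) (presentation_cong A R)"
    by (rule refl_onI) (rule presentation_cong.refl)
  show "sym (presentation_cong A R)" by (rule symI) (rule presentation_cong.sym)
  show "trans (presentation_cong A R)" by (rule transI) (rule presentation_cong.trans)
qed

lemma presentation_cong_append_left:
  "\<lbrakk>(u, v) \<in> presentation_cong A R; w \<in> lists A\<rbrakk> \<Longrightarrow> (w @ u, w @ v) \<in> presentation_cong A R"
proof (induction rule: presentation_cong.induct)
  case (base u v x y)
  then show ?case using presentation_cong.base[of u v R A "w @ x" y] by simp
next
  case (refl u) then show ?case by (simp add: presentation_cong.refl)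
next
  case (sym u v) then show ?case using presentation_cong.sym by blast
next
  case (trans u v x) then show ?case using presentation_cong.trans by blast
qed

lemma presentation_cong_append_right:
  "\<lbrakk>(u, v) \<in> presentation_cong A R; w \<in> lists A\<rbrakk> \<Longrightarrow> (u @ w, v @ w) \<in> presentation_cong A R"
proof (induction rule: presentation_cong.induct)
  case (base u v x y)
  then show ?case using presentation_cong.base[of u v R A x "y @ w"] by simp
next
  case (refl u) then show ?case by (simp add: presentation_cong.refl)
next
  case (sym u v) then show ?case using presentation_cong.sym by blast
next
  case (trans u v x) then show ?case using presentation_cong.trans by blast
qed

lemma presentation_cong_append:
  assumes "(u, u') \<in> presentation_cong A R" "(v, v') \<in> presentation_cong A R"
  shows "(u @ v, u' @ v') \<in> presentation_cong A R"
proof (rule presentation_cong.trans)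
  show "(u @ v, u' @ v) \<in> presentation_cong A R"
    using assms presentation_cong_append_right presentation_cong_in_lists[OF assms(2)] by metis
  show "(u' @ v, u' @ v') \<in> presentation_cong A R"
    using assms presentation_cong_append_left presentation_cong_in_lists[OF assms(1)] by metis
qed

lemma presentation_cong_relation:
  "\<lbrakk>(u, v) \<in> R; u \<in> lists A; v \<in> lists A\<rbrakk> \<Longrightarrow> (u, v) \<in> presentation_cong A R"
  using presentation_cong.base[of u v R A "[]" "[]"] by simp

definition pcl :: "'x set \<Rightarrow> ('x list \<times> 'x list) set \<Rightarrow> 'x list \<Rightarrow> 'x list set" where
  "pcl A R w = presentation_cong A R `` {w}"

lemma pcl_eq_iff:
  "\<lbrakk>u \<in> lists A; v \<in> lists A\<rbrakk> \<Longrightarrow> pcl A R u = pcl A R v \<longleftrightarrow> (u, v) \<in> presentation_cong A R"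
  unfolding pcl_def using eq_equiv_class_iff[OF equiv_presentation_cong] by metis

lemma pcl_closed [simp]: "w \<in> lists A \<Longrightarrow> pcl A R w \<in> carrier (monoid_presented_by A R)"
  by (simp add: monoid_presented_by_def pcl_def quotientI)

lemma carrier_presented: "carrier (monoid_presented_by A R) = pcl A R ` lists A"
  by (auto simp: monoid_presented_by_def pcl_def quotient_def)

lemma carrier_presentedE:
  assumes "X \<in> carrier (monoid_presented_by A R)"
  obtains w where "w \<in> lists A" "X = pcl A R w"
  using assms unfolding carrier_presented by (rule imageE)

lemma pcl_self: "w \<in> lists A \<Longrightarrow> w \<in> pcl A R w"
  by (simp add: pcl_def presentation_cong.refl)

lemma pcl_mult:
  assumes "u \<in> lists A" "v \<in> lists A"
  shows "pcl A R u \<otimes>\<^bsub>monoid_presented_by A R\<^esub> pcl A R v = pcl A R (u @ v)"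
proof -
  have "u \<in> pcl A R u" "v \<in> pcl A R v"
    using assms by (simp_all add: pcl_self)
  have "presentation_cong A R `` {u' @ v'} = pcl A R (u @ v)"
    if "u' \<in> pcl A R u" "v' \<in> pcl A R v" for u' v'
  proof -
    have "(u, u') \<in> presentation_cong A R" "(v, v') \<in> presentation_cong A R"
      using that by (simp_all add: pcl_def)
    from equiv_class_eq[OF equiv_presentation_cong presentation_cong_append[OF this]]
    show ?thesis by (simp add: pcl_def)
  qed
  then have eq: "(\<Union>v'\<in>pcl A R v. presentation_cong A R `` {u' @ v'}) = pcl A R (u @ v)"
    if "u' \<in> pcl A R u" for u'
    using that \<open>v \<in> pcl A R v\<close> by blast
  have "pcl A R u \<otimes>\<^bsub>monoid_presented_by A R\<^esub> pcl A R v
      = (\<Union>u'\<in>pcl A R u. \<Union>v'\<in>pcl A R v. presentation_cong A R `` {u' @ v'})"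
    unfolding monoid_presented_by_def by (simp only: monoid.select_convs)
  also have "\<dots> = pcl A R (u @ v)" using eq \<open>u \<in> pcl A R u\<close> by blast
  finally show ?thesis .
qed

lemma one_presented: "\<one>\<^bsub>monoid_presented_by A R\<^esub> = pcl A R []"
  by (simp add: monoid_presented_by_def pcl_def)

lemma monoid_presented: "monoid (monoid_presented_by A R)"
proof (rule monoidI, goal_cases)
  case (1 x y)
  then obtain u v where "u \<in> lists A" "x = pcl A R u" "v \<in> lists A" "y = pcl A R v"
    unfolding carrier_presented by blast
  then show ?case by (simp add: pcl_mult)
next
  case 2 then show ?case by (simp add: one_presented)
next
  case (3 x y z)
  then obtain u v w where "u \<in> lists A" "x = pcl A R u" "v \<in> lists A" "y = pcl A R v"
    "w \<in> lists A" "z = pcl A R w" unfolding carrier_presented by blast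
  then show ?case by (simp add: pcl_mult)
next
  case (4 x)
  then obtain w where "w \<in> lists A" "x = pcl A R w" unfolding carrier_presented by blast
  then show ?case by (simp add: one_presented pcl_mult)
next
  case (5 x)
  then obtain w where "w \<in> lists A" "x = pcl A R w" unfolding carrier_presented by blast
  then show ?case by (simp add: one_presented pcl_mult)
qed

lemma mprod_pcl:
  "w \<in> lists A \<Longrightarrow> mprod (monoid_presented_by A R) (\<lambda>a. pcl A R [a]) w = pcl A R w"
  by (induction w) (auto simp: one_presented pcl_mult)

text \<open>The universal property of a presented monoid. The equation is demanded only for pairs of
  words over \<open>A\<close>, the only ones that enter the congruence.\<close>

lemma presented_hom:
  fixes N :: "('b, 'm) monoid_scheme"
  assumes "monoid N" "f ` A \<subseteq> carrier N"
    and rel: "\<And>u v. \<lbrakk>(u, v) \<in> R; u \<in> lists A; v \<in> lists A\<rbrakk> \<Longrightarrow> mprod N f u = mprod N f v"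
  obtains h where "h \<in> hom (monoid_presented_by A R) N"
    "\<And>w. w \<in> lists A \<Longrightarrow> h (pcl A R w) = mprod N f w"
proof -
  interpret N: monoid N by fact
  have cong: "mprod N f u = mprod N f v" if "(u, v) \<in> presentation_cong A R" for u v
    using that
  proof (induction rule: presentation_cong.induct)
    case (base u v x y)
    then show ?case
      using rel[of u v] N.mprod_append[OF assms(2), of x "u @ y"] N.mprod_append[OF assms(2), of x "v @ y"]
        N.mprod_append[OF assms(2), of u y] N.mprod_append[OF assms(2), of v y]
      by (simp del: map_append foldr_append)
  qed simp_all
  \<comment> \<open>A class is evaluated at a chosen representative; by \<open>cong\<close> the
    choice does not matter.\<close>
  define h where "h X = mprod N f (SOME w. w \<in> X)" for X
  have h: "h (pcl A R w) = mprod N f w" if "w \<in> lists A" for w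
  proof -
    have "w \<in> pcl A R w" using that by (rule pcl_self)
    then have "(SOME x. x \<in> pcl A R w) \<in> pcl A R w" by (rule someI)
    then have "(w, SOME x. x \<in> pcl A R w) \<in> presentation_cong A R" by (simp add: pcl_def)
    from cong[OF this] show ?thesis by (simp add: h_def)
  qed
  have "h \<in> hom (monoid_presented_by A R) N"
  proof (rule homI)
    fix x assume "x \<in> carrier (monoid_presented_by A R)"
    then obtain w where "w \<in> lists A" "x = pcl A R w" by (rule carrier_presentedE)
    then show "h x \<in> carrier N" using h N.mprod_closed[OF assms(2)] by simp
  next
    fix x y assume x: "x \<in> carrier (monoid_presented_by A R)" and y: "y \<in> carrier (monoid_presented_by A R)"
    obtain u where "u \<in> lists A" "x = pcl A R u" using x by (rule carrier_presentedE)
    moreover obtain v where "v \<in> lists A" "y = pcl A R v" using y by (rule carrier_presentedE)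
    ultimately show "h (x \<otimes>\<^bsub>monoid_presented_by A R\<^esub> y) = h x \<otimes>\<^bsub>N\<^esub> h y"
      using N.mprod_append[OF assms(2), of u v] by (simp add: pcl_mult h del: map_append foldr_append)
  qed
  with h that show ?thesis by blast
qed

text \<open>Membership in \<open>hom\<close> does not make a map of monoids preserve the unit.
  Surjectivity provides a preimage of the unit of N, against which the image of the unit of M is
  computed.\<close>

lemma iso_one:
  assumes "monoid M" "monoid N" "h \<in> iso M N"
  shows "h \<one>\<^bsub>M\<^esub> = \<one>\<^bsub>N\<^esub>"
proof -
  interpret M: monoid M by fact
  interpret N: monoid N by fact
  have hom: "h \<in> hom M N" and surj: "h ` carrier M = carrier N" using assms(3) by (auto simp: iso_iff)
  obtain x where x: "x \<in> carrier M" "h x = \<one>\<^bsub>N\<^esub>" using surj N.one_closed by (metis imageE)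
  have "h \<one>\<^bsub>M\<^esub> = h \<one>\<^bsub>M\<^esub> \<otimes>\<^bsub>N\<^esub> h x" using x hom_in_carrier[OF hom M.one_closed] by simp
  also have "\<dots> = h (\<one>\<^bsub>M\<^esub> \<otimes>\<^bsub>M\<^esub> x)" using hom_mult[OF hom M.one_closed x(1)] by simp
  finally show ?thesis using x by (simp del: M.r_one)
qed

lemma iso_mprod:
  assumes "monoid M" "monoid N" "h \<in> iso M N" "f ` A \<subseteq> carrier M" "w \<in> lists A"
  shows "h (mprod M f w) = mprod N (h \<circ> f) w"
  using assms(5)
proof (induction w)
  case Nil then show ?case using iso_one[OF assms(1-3)] by simp
next
  case (Cons a w)
  then have "f a \<in> carrier M" "mprod M f w \<in> carrier M"
    using assms monoid.mprod_closed[OF assms(1) assms(4)] by auto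
  moreover have "h \<in> hom M N" using assms(3) by (simp add: iso_iff)
  ultimately show ?case using Cons by (simp add: hom_mult)
qed

section \<open>Isomorphisms of presented monoids as substitutions of words\<close>

abbreviation subst_word :: "('x \<Rightarrow> 'y list) \<Rightarrow> 'x list \<Rightarrow> 'y list" where
  "subst_word \<sigma> w \<equiv> concat (map \<sigma> w)"

lemma subst_word_closed: "\<lbrakk>\<And>a. a \<in> A \<Longrightarrow> \<sigma> a \<in> lists B; w \<in> lists A\<rbrakk> \<Longrightarrow> subst_word \<sigma> w \<in> lists B"
  by (induction w) auto

lemma mprod_subst_word:
  assumes "\<And>a. a \<in> A \<Longrightarrow> \<sigma> a \<in> lists B" "w \<in> lists A"
  shows "mprod (monoid_presented_by B Q) (\<lambda>a. pcl B Q (\<sigma> a)) w = pcl B Q (subst_word \<sigma> w)"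
  using assms(2)
proof (induction w)
  case (Cons a w)
  then show ?case using assms(1) subst_word_closed[of A \<sigma> B w] by (simp add: pcl_mult)
qed (simp add: one_presented)

text \<open>A certificate of isomorphism: two substitutions that respect the relations and are
  inverse to each other on letters. For finite presentations it amounts to finitely many words and
  finitely many congruences, each witnessed by a derivation, and so it can be searched for.\<close>

definition iso_words ::
  "'x set \<Rightarrow> ('x list \<times> 'x list) set \<Rightarrow> 'y set \<Rightarrow> ('y list \<times> 'y list) set \<Rightarrow>
   ('x \<Rightarrow> 'y list) \<Rightarrow> ('y \<Rightarrow> 'x list) \<Rightarrow> bool" where
  "iso_words A R B Q \<sigma> \<tau> \<longleftrightarrow>
     (\<forall>a\<in>A. \<sigma> a \<in> lists B \<and> (subst_word \<tau> (\<sigma> a), [a]) \<in> presentation_cong A R) \<and>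
     (\<forall>b\<in>B. \<tau> b \<in> lists A \<and> (subst_word \<sigma> (\<tau> b), [b]) \<in> presentation_cong B Q) \<and>
     (\<forall>(u, v)\<in>R. (subst_word \<sigma> u, subst_word \<sigma> v) \<in> presentation_cong B Q) \<and>
     (\<forall>(u, v)\<in>Q. (subst_word \<tau> u, subst_word \<tau> v) \<in> presentation_cong A R)"

lemma iso_words_hom:
  assumes "iso_words A R B Q \<sigma> \<tau>"
  obtains h where "h \<in> hom (monoid_presented_by A R) (monoid_presented_by B Q)"
    "\<And>w. w \<in> lists A \<Longrightarrow> h (pcl A R w) = pcl B Q (subst_word \<sigma> w)"
proof -
  have \<sigma>: "\<sigma> a \<in> lists B" if "a \<in> A" for a using assms that by (auto simp: iso_words_def)
  have "mprod (monoid_presented_by B Q) (\<lambda>a. pcl B Q (\<sigma> a)) u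
      = mprod (monoid_presented_by B Q) (\<lambda>a. pcl B Q (\<sigma> a)) v"
    if "(u, v) \<in> R" "u \<in> lists A" "v \<in> lists A" for u v
    using that assms mprod_subst_word[of A \<sigma> B _ Q] \<sigma> subst_word_closed[of A \<sigma> B]
    unfolding iso_words_def by (auto simp: pcl_eq_iff)
  then obtain h where "h \<in> hom (monoid_presented_by A R) (monoid_presented_by B Q)"
    "\<And>w. w \<in> lists A \<Longrightarrow> h (pcl A R w) = mprod (monoid_presented_by B Q) (\<lambda>a. pcl B Q (\<sigma> a)) w"
    using presented_hom[OF monoid_presented[of B Q], of "\<lambda>a. pcl B Q (\<sigma> a)" A R] \<sigma>
    by (metis (no_types, lifting) image_subsetI pcl_closed)
  then show ?thesis using that mprod_subst_word[of A \<sigma> B _ Q] \<sigma> by simp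
qed

lemma iso_words_inverse:
  assumes "iso_words A R B Q \<sigma> \<tau>" "w \<in> lists A"
  shows "(subst_word \<tau> (subst_word \<sigma> w), w) \<in> presentation_cong A R"
  using assms(2)
proof (induction w)
  case (Cons a w)
  then have "(subst_word \<tau> (\<sigma> a) @ subst_word \<tau> (subst_word \<sigma> w), [a] @ w) \<in> presentation_cong A R"
    using assms(1) by (intro presentation_cong_append) (auto simp: iso_words_def)
  then show ?case by simp
qed (auto intro: presentation_cong.refl)

lemma iso_words_sym: "iso_words A R B Q \<sigma> \<tau> \<Longrightarrow> iso_words B Q A R \<tau> \<sigma>"
  by (auto simp: iso_words_def)

lemma iso_words_imp_iso:
  assumes "iso_words A R B Q \<sigma> \<tau>"
  shows "monoid_presented_by A R \<cong> monoid_presented_by B Q"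
proof -
  obtain h where h: "h \<in> hom (monoid_presented_by A R) (monoid_presented_by B Q)"
    "\<And>w. w \<in> lists A \<Longrightarrow> h (pcl A R w) = pcl B Q (subst_word \<sigma> w)"
    using iso_words_hom[OF assms] by blast
  obtain k where k: "k \<in> hom (monoid_presented_by B Q) (monoid_presented_by A R)"
    "\<And>w. w \<in> lists B \<Longrightarrow> k (pcl B Q w) = pcl A R (subst_word \<tau> w)"
    using iso_words_hom[OF iso_words_sym[OF assms]] by blast
  have \<sigma>: "subst_word \<sigma> w \<in> lists B" if "w \<in> lists A" for w
    using assms that subst_word_closed[of A \<sigma> B w] by (auto simp: iso_words_def)
  have \<tau>: "subst_word \<tau> w \<in> lists A" if "w \<in> lists B" for w
    using assms that subst_word_closed[of B \<tau> A w] by (auto simp: iso_words_def)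
  have kh: "k (h x) = x" if x: "x \<in> carrier (monoid_presented_by A R)" for x
  proof -
    obtain w where w: "w \<in> lists A" "x = pcl A R w" using x by (rule carrier_presentedE)
    show ?thesis
      using h k w \<sigma> \<tau> iso_words_inverse[OF assms] by (simp add: pcl_eq_iff)
  qed
  have hk: "h (k x) = x" if x: "x \<in> carrier (monoid_presented_by B Q)" for x
  proof -
    obtain w where w: "w \<in> lists B" "x = pcl B Q w" using x by (rule carrier_presentedE)
    show ?thesis
      using h k w \<sigma> \<tau> iso_words_inverse[OF iso_words_sym[OF assms]] by (simp add: pcl_eq_iff)
  qed
  have "bij_betw h (carrier (monoid_presented_by A R)) (carrier (monoid_presented_by B Q))"
    using bij_betw_byWitness[of _ k h] kh hk hom_carrier[OF h(1)] hom_carrier[OF k(1)] by simp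
  then have "h \<in> iso (monoid_presented_by A R) (monoid_presented_by B Q)"
    using h by (simp add: iso_def)
  then show ?thesis by (rule is_isoI)
qed

text \<open>\<open>\<sigma>\<close> spells the images of the letters and \<open>\<tau>\<close> the
  preimages. Congruences over \<open>A\<close> are verified after applying the isomorphism, which is
  injective.\<close>

lemma iso_imp_iso_words:
  assumes "monoid_presented_by A R \<cong> monoid_presented_by B Q"
    and R: "R \<subseteq> lists A \<times> lists A" and Q: "Q \<subseteq> lists B \<times> lists B"
  shows "\<exists>\<sigma> \<tau>. iso_words A R B Q \<sigma> \<tau>"
proof -
  let ?M = "monoid_presented_by A R" and ?N = "monoid_presented_by B Q"
  obtain h where h: "h \<in> iso ?M ?N" using assms(1) by (auto simp: is_iso_def)
  then have hom: "h \<in> hom ?M ?N" and surj: "h ` carrier ?M = carrier ?N"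
    and inj: "inj_on h (carrier ?M)" by (auto simp: iso_iff)
  have "\<exists>w\<in>lists B. h (pcl A R [a]) = pcl B Q w" if "a \<in> A" for a
    using that hom_in_carrier[OF hom, of "pcl A R [a]"] unfolding carrier_presented by force
  then obtain \<sigma> where \<sigma>: "\<And>a. a \<in> A \<Longrightarrow> \<sigma> a \<in> lists B \<and> h (pcl A R [a]) = pcl B Q (\<sigma> a)"
    by metis
  have "\<exists>w\<in>lists A. h (pcl A R w) = pcl B Q [b]" if "b \<in> B" for b
  proof -
    have "pcl B Q [b] \<in> h ` carrier ?M" using that surj by simp
    then show ?thesis unfolding carrier_presented by force
  qed
  then obtain \<tau> where \<tau>: "\<And>b. b \<in> B \<Longrightarrow> \<tau> b \<in> lists A \<and> h (pcl A R (\<tau> b)) = pcl B Q [b]"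
    by metis
  have \<sigma>c: "subst_word \<sigma> w \<in> lists B" if "w \<in> lists A" for w
    using that subst_word_closed[of A \<sigma> B w] \<sigma> by auto
  have \<tau>c: "subst_word \<tau> w \<in> lists A" if "w \<in> lists B" for w
    using that subst_word_closed[of B \<tau> A w] \<tau> by auto
  have one: "h (pcl A R []) = pcl B Q []"
    using iso_one[OF monoid_presented monoid_presented h] by (simp add: one_presented)
  have h\<sigma>: "h (pcl A R w) = pcl B Q (subst_word \<sigma> w)" if "w \<in> lists A" for w
    using that
  proof (induction w)
    case (Cons a w)
    then have "h (pcl A R ([a] @ w)) = h (pcl A R [a]) \<otimes>\<^bsub>?N\<^esub> h (pcl A R w)"
      using hom_mult[OF hom, of "pcl A R [a]" "pcl A R w"] by (simp add: pcl_mult)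
    then show ?case using Cons \<sigma> \<sigma>c by (simp add: pcl_mult)
  qed (simp add: one)
  have h\<tau>: "h (pcl A R (subst_word \<tau> w)) = pcl B Q w" if "w \<in> lists B" for w
    using that
  proof (induction w)
    case (Cons b w)
    then have "h (pcl A R (\<tau> b @ subst_word \<tau> w)) = h (pcl A R (\<tau> b)) \<otimes>\<^bsub>?N\<^esub> h (pcl A R (subst_word \<tau> w))"
      using hom_mult[OF hom, of "pcl A R (\<tau> b)" "pcl A R (subst_word \<tau> w)"] \<tau> \<tau>c by (simp add: pcl_mult)
    then show ?case using Cons \<tau> \<tau>c by (simp add: pcl_mult)
  qed (simp add: one)
  have inj': "(u, v) \<in> presentation_cong A R"
    if "u \<in> lists A" "v \<in> lists A" "h (pcl A R u) = h (pcl A R v)" for u v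
    using that inj_onD[OF inj] pcl_eq_iff[of u A v R] by simp
  have "iso_words A R B Q \<sigma> \<tau>"
    unfolding iso_words_def
  proof (intro conjI ballI, goal_cases)
    case (1 a) then show ?case using \<sigma> by simp
  next
    case (2 a) then show ?case using \<sigma>[of a] \<tau>c h\<tau> by (intro inj') auto
  next
    case (3 b) then show ?case using \<tau> by simp
  next
    case (4 b) then show ?case
      using \<tau>[of b] \<sigma>c[of "\<tau> b"] h\<sigma>[of "\<tau> b"] by (simp add: pcl_eq_iff[symmetric])
  next
    case (5 p)
    then obtain u v where uv: "p = (u, v)" "(u, v) \<in> R" "u \<in> lists A" "v \<in> lists A" using R by blast
    then have "pcl A R u = pcl A R v" by (simp add: pcl_eq_iff presentation_cong_relation)
    then have "pcl B Q (subst_word \<sigma> u) = pcl B Q (subst_word \<sigma> v)" using h\<sigma> uv by metis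
    then show ?case using uv \<sigma>c by (simp add: pcl_eq_iff)
  next
    case (6 p)
    then obtain u v where uv: "p = (u, v)" "(u, v) \<in> Q" "u \<in> lists B" "v \<in> lists B" using Q by blast
    then have "pcl B Q u = pcl B Q v" by (simp add: pcl_eq_iff presentation_cong_relation)
    then show ?case using uv \<tau>c h\<tau> inj' by simp
  qed
  then show ?thesis by blast
qed

section \<open>Recognising Garside monoids\<close>

lemma opposite_simps [simp]:
  "carrier (opposite M) = carrier M" "x \<otimes>\<^bsub>opposite M\<^esub> y = y \<otimes>\<^bsub>M\<^esub> x" "\<one>\<^bsub>opposite M\<^esub> = \<one>\<^bsub>M\<^esub>"
  by (simp_all add: opposite_def)

lemma divides_opposite: "x divides\<^bsub>opposite M\<^esub> y \<longleftrightarrow> (\<exists>c\<in>carrier M. y = c \<otimes>\<^bsub>M\<^esub> x)"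
  by (simp add: factor_def)

lemma monoid_opposite: "monoid M \<Longrightarrow> monoid (opposite M)"
  by (rule monoidI) (simp_all add: monoid.m_assoc monoid.m_closed monoid.one_closed monoid.l_one monoid.r_one)

lemma left_divisors_opposite: "left_divisors (opposite M) x = right_divisors M x"
  by (simp add: left_divisors_def right_divisors_def)

section \<open>Divisor sets, atoms, gcds and left lcms\<close>

lemma finite_lcm:
  fixes M :: "'a monoid" (structure)
  assumes "monoid M" "finite F" "F \<subseteq> carrier M"
    and lcm: "\<And>x y. \<lbrakk>x \<in> carrier M; y \<in> carrier M\<rbrakk> \<Longrightarrow> \<exists>z\<in>carrier M. z lcmof x y"
  shows "\<exists>j\<in>carrier M. (\<forall>f\<in>F. f divides j) \<and>
           (\<forall>z\<in>carrier M. (\<forall>f\<in>F. f divides z) \<longrightarrow> j divides z)"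
  using assms(2,3)
proof (induction rule: finite_induct)
  case empty
  interpret monoid M by fact
  show ?case by (intro bexI[of _ "\<one>"]) (auto simp: factor_def)
next
  case (insert f F)
  interpret monoid M by fact
  obtain j where j: "j \<in> carrier M" "\<forall>f\<in>F. f divides j"
    "\<forall>z\<in>carrier M. (\<forall>f\<in>F. f divides z) \<longrightarrow> j divides z" using insert by auto
  obtain k where k: "k \<in> carrier M" "k lcmof f j" using lcm[of f j] j insert by auto
  then have fk: "f divides k" and jk: "j divides k"
    and least: "\<And>z. \<lbrakk>z \<in> carrier M; f divides z; j divides z\<rbrakk> \<Longrightarrow> k divides z"
    unfolding islcm_def by blast+
  have "g divides k" if "g \<in> F" for g
    using divides_trans[of g j k] jk j(2) that insert.prems by auto
  then show ?case using fk least j(3) k(1) by (intro bexI[of _ k]) auto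
qed

text \<open>The gcd is the lcm of the finitely many common divisors. Applied to the opposite monoid,
  this also turns left lcms into right gcds.\<close>

lemma gcd_of_lcm:
  fixes M :: "'a monoid" (structure)
  assumes "monoid M" "x \<in> carrier M" "y \<in> carrier M" "finite (left_divisors M x)"
    and lcm: "\<And>x y. \<lbrakk>x \<in> carrier M; y \<in> carrier M\<rbrakk> \<Longrightarrow> \<exists>z\<in>carrier M. z lcmof x y"
  shows "\<exists>z\<in>carrier M. z gcdof x y"
proof -
  let ?F = "left_divisors M x \<inter> left_divisors M y"
  have "\<exists>j\<in>carrier M. (\<forall>f\<in>?F. f divides j) \<and>
      (\<forall>z\<in>carrier M. (\<forall>f\<in>?F. f divides z) \<longrightarrow> j divides z)"
    using assms(4) by (intro finite_lcm assms(1) lcm) (auto simp: left_divisors_def)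
  then obtain j where j: "j \<in> carrier M" "\<And>f. f \<in> ?F \<Longrightarrow> f divides j"
    and least: "\<And>z. \<lbrakk>z \<in> carrier M; \<And>f. f \<in> ?F \<Longrightarrow> f divides z\<rbrakk> \<Longrightarrow> j divides z" by meson
  have "j divides x" "j divides y"
    using assms(2,3) by (auto intro!: least simp: left_divisors_def)
  then show ?thesis
    using j by (intro bexI[of _ j]) (auto simp: isgcd_def left_divisors_def)
qed

locale conical_cancel = monoid_cancel M for M :: "'a monoid" (structure) +
  assumes conical: "\<lbrakk>x \<in> carrier M; y \<in> carrier M; x \<otimes> y = \<one>\<rbrakk> \<Longrightarrow> x = \<one>"
begin

lemma conical': "\<lbrakk>x \<in> carrier M; y \<in> carrier M; x \<otimes> y = \<one>\<rbrakk> \<Longrightarrow> y = \<one>"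
  using conical[of x y] by auto

lemma right_divisors_trans:
  assumes "x \<in> carrier M" "y \<in> carrier M"
  shows "right_divisors M y \<subseteq> right_divisors M (x \<otimes> y)"
  using assms by (auto simp: right_divisors_def divides_opposite m_assoc[symmetric])

lemma right_divisors_strict:
  assumes "x \<in> carrier M" "y \<in> carrier M" "x \<noteq> \<one>"
  shows "right_divisors M y \<subset> right_divisors M (x \<otimes> y)"
proof -
  have "x \<otimes> y \<in> right_divisors M (x \<otimes> y)"
    using assms by (auto simp: right_divisors_def divides_opposite intro!: bexI[of _ \<one>])
  moreover have "x \<otimes> y \<notin> right_divisors M y"
  proof
    assume "x \<otimes> y \<in> right_divisors M y"
    then obtain c where c: "c \<in> carrier M" "y = c \<otimes> (x \<otimes> y)"
      by (auto simp: right_divisors_def divides_opposite)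
    then have "\<one> \<otimes> y = (c \<otimes> x) \<otimes> y" using assms by (simp add: m_assoc)
    then have "\<one> = c \<otimes> x" using r_cancel[of \<one> y "c \<otimes> x"] assms c by blast
    then show False using conical'[of c x] assms c by metis
  qed
  ultimately show ?thesis using right_divisors_trans[OF assms(1,2)] by blast
qed

context
  assumes fin: "\<And>x. x \<in> carrier M \<Longrightarrow> finite (right_divisors M x)"
begin

text \<open>Each factor other than 1 strictly enlarges the set of right divisors of the
  product.\<close>

lemma length_expression_le:
  "\<lbrakk>set w \<subseteq> carrier M - {\<one>}; foldr (\<otimes>) w \<one> = x\<rbrakk> \<Longrightarrow> length w \<le> card (right_divisors M x)"
proof (induction w arbitrary: x)
  case (Cons a w)
  let ?y = "foldr (\<otimes>) w \<one>"
  have y: "?y \<in> carrier M" using Cons.prems mprod_closed[of id "carrier M" w] by auto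
  have "card (right_divisors M ?y) < card (right_divisors M (a \<otimes> ?y))"
    using right_divisors_strict[of a ?y] Cons.prems y fin by (intro psubset_card_mono) auto
  then show ?case using Cons by fastforce
qed auto

lemma generates_atoms: "generates M (atoms M)"
proof -
  have "expressions M (atoms M) x \<noteq> {}" if "x \<in> carrier M" for x
    using that
  proof (induction "card (right_divisors M x)" arbitrary: x rule: less_induct)
    case less
    show ?case
    proof (cases "x = \<one> \<or> x \<in> atoms M")
      case True
      then have "[] \<in> expressions M (atoms M) x \<or> [x] \<in> expressions M (atoms M) x"
        using less by (auto simp: expressions_def)
      then show ?thesis by blast
    next
      case False
      then obtain y z where yz: "y \<in> carrier M" "z \<in> carrier M" "x = y \<otimes> z" "y \<noteq> \<one>" "z \<noteq> \<one>"
        using less by (auto simp: atoms_def)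
      have cz: "card (right_divisors M z) < card (right_divisors M x)"
        using right_divisors_strict[of y z] yz fin less by (intro psubset_card_mono) auto
      \<comment> \<open>The right divisors of the left factor y need not right divide x. Right
        multiplication by z embeds them into those of x and misses 1, because z is not 1 and the
        monoid is conical.\<close>
      have cz1: "c \<otimes> z \<in> right_divisors M x - {\<one>}" if c: "c \<in> right_divisors M y" for c
      proof -
        obtain b where "b \<in> carrier M" "y = b \<otimes> c" "c \<in> carrier M"
          using c by (auto simp: right_divisors_def divides_opposite)
        then show ?thesis
          using yz conical'[of c z] by (auto simp: right_divisors_def divides_opposite m_assoc)
      qed
      have sub: "(\<lambda>c. c \<otimes> z) ` right_divisors M y \<subseteq> right_divisors M x - {\<one>}"
        by (rule image_subsetI) (rule cz1)
      have inj: "inj_on (\<lambda>c. c \<otimes> z) (right_divisors M y)"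
        using yz(2) r_cancel by (auto simp: inj_on_def right_divisors_def)
      have "card (right_divisors M y) \<le> card (right_divisors M x - {\<one>})"
        using card_mono[OF _ sub] fin[OF less.prems] by (simp add: card_image[OF inj])
      also have "\<dots> < card (right_divisors M x)"
        using fin[OF less.prems] less.prems
        by (intro card_Diff1_less) (auto simp: right_divisors_def divides_opposite)
      finally have cy: "card (right_divisors M y) < card (right_divisors M x)" .
      obtain u v where "u \<in> expressions M (atoms M) y" "v \<in> expressions M (atoms M) z"
        using less.hyps[OF cy yz(1)] less.hyps[OF cz yz(2)] by fast
      moreover have "atoms M \<subseteq> carrier M" by (auto simp: atoms_def)
      ultimately have "u @ v \<in> expressions M (atoms M) x"
        using mprod_append[of id "carrier M" u v] yz by (auto simp: expressions_def)
      then show ?thesis by fast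
    qed
  qed
  then show ?thesis by (auto simp: generates_def atoms_def)
qed

lemma atomic: "atomic_monoid M"
proof -
  have "atomic_norm M x \<le> enat (card (right_divisors M x))" for x
    unfolding atomic_norm_def
  proof (rule SUP_least)
    fix w assume "w \<in> expressions M (atoms M) x"
    then have "set w \<subseteq> carrier M - {\<one>}" "foldr (\<otimes>) w \<one> = x"
      by (auto simp: expressions_def atoms_def)
    then show "enat (length w) \<le> enat (card (right_divisors M x))"
      using length_expression_le by simp
  qed
  then have "atomic_norm M x < \<infinity>" for x
    by (metis enat_ord_simps(4) le_less_trans enat.simps(3))
  then show ?thesis by (simp add: atomic_monoid_def generates_atoms monoid_axioms)
qed

text \<open>By right cancellation a left divisor is determined by its cofactor, which is a right
  divisor.\<close>

lemma finite_left_divisors: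
  assumes "x \<in> carrier M"
  shows "finite (left_divisors M x)"
proof -
  have "left_divisors M x \<subseteq> (\<lambda>c. THE y. y \<in> carrier M \<and> y \<otimes> c = x) ` right_divisors M x"
  proof
    fix y assume "y \<in> left_divisors M x"
    then obtain c where c: "y \<in> carrier M" "c \<in> carrier M" "x = y \<otimes> c"
      by (auto simp: left_divisors_def factor_def)
    then have "(THE y. y \<in> carrier M \<and> y \<otimes> c = x) = y" by (intro the_equality) (auto dest: r_cancel)
    moreover have "c \<in> right_divisors M x" using c by (auto simp: right_divisors_def divides_opposite)
    ultimately show "y \<in> (\<lambda>c. THE y. y \<in> carrier M \<and> y \<otimes> c = x) ` right_divisors M x" by force
  qed
  then show ?thesis using fin[OF assms] by (meson finite_surj)
qed

text \<open>With \<open>\<Delta>\<^sup>k = x' x = y' y\<close> and \<open>g\<close> the left gcd of \<open>x'\<close> and \<open>y'\<close>, the left lcm of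
  \<open>x\<close> and \<open>y\<close> is \<open>g\<inverse>\<Delta>\<^sup>k\<close>.\<close>

lemma left_lcm_exists:
  assumes lcm: "\<And>x y. \<lbrakk>x \<in> carrier M; y \<in> carrier M\<rbrakk> \<Longrightarrow> \<exists>z\<in>carrier M. z lcmof x y"
    and D: "\<Delta> \<in> carrier M"
    and power: "\<And>x. x \<in> carrier M \<Longrightarrow> \<exists>k::nat. \<exists>c\<in>carrier M. c \<otimes> x = \<Delta> [^] k"
    and x: "x \<in> carrier M" and y: "y \<in> carrier M"
  shows "\<exists>z\<in>carrier M. z lcmof\<^bsub>opposite M\<^esub> x y"
proof -
  have gcd: "\<exists>z\<in>carrier M. z gcdof x y" if "x \<in> carrier M" "y \<in> carrier M" for x y
    using gcd_of_lcm[OF monoid_axioms that finite_left_divisors] that lcm by blast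
  obtain i j :: nat and c c' where c: "c \<in> carrier M" "c' \<in> carrier M"
    "c \<otimes> x = \<Delta> [^] i" "c' \<otimes> y = \<Delta> [^] j" using power x y by meson
  \<comment> \<open>Further left factors bring both multiples to the same power of \<Delta>.\<close>
  define k where "k = j + i"
  define x' where "x' = \<Delta> [^] j \<otimes> c"
  define y' where "y' = \<Delta> [^] i \<otimes> c'"
  have c': "x' \<in> carrier M" "y' \<in> carrier M" "x' \<otimes> x = \<Delta> [^] k" "y' \<otimes> y = \<Delta> [^] k"
    using c x y D by (auto simp: x'_def y'_def k_def m_assoc nat_pow_mult add.commute)
  obtain g where g: "g \<in> carrier M" "g gcdof x' y'" using gcd c' by blast
  then obtain a b where ab: "a \<in> carrier M" "b \<in> carrier M" "x' = g \<otimes> a" "y' = g \<otimes> b"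
    by (auto simp: isgcd_def factor_def)
  define z where "z = a \<otimes> x"
  have z: "z \<in> carrier M" "g \<otimes> z = \<Delta> [^] k" using ab x c' g by (auto simp: z_def m_assoc)
  have "g \<otimes> z = g \<otimes> (b \<otimes> y)" using z ab y c' g by (simp add: m_assoc)
  then have zb: "z = b \<otimes> y" using l_cancel[of g z "b \<otimes> y"] ab g z y by simp
  have "z divides\<^bsub>opposite M\<^esub> w"
    if w: "w \<in> carrier M" "x divides\<^bsub>opposite M\<^esub> w" "y divides\<^bsub>opposite M\<^esub> w" for w
  proof -
    obtain p q where pq: "p \<in> carrier M" "q \<in> carrier M" "w = p \<otimes> x" "w = q \<otimes> y"
      using w by (auto simp: divides_opposite)
    obtain l :: nat and r0 where r0: "r0 \<in> carrier M" "r0 \<otimes> w = \<Delta> [^] l" using power w by meson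
    \<comment> \<open>The extra factor \<Delta>^k makes r w end in \<Delta>^k = x' x = y' y, so that
      x and y can be cancelled on the right.\<close>
    define r where "r = \<Delta> [^] k \<otimes> r0"
    let ?D = "\<Delta> [^] l"
    have Dc: "?D \<in> carrier M" using D by simp
    have r: "r \<in> carrier M" "r \<otimes> w = ?D \<otimes> \<Delta> [^] k"
      using r0 D w by (auto simp: r_def m_assoc nat_pow_mult add.commute)
    have "(r \<otimes> p) \<otimes> x = (?D \<otimes> x') \<otimes> x" "(r \<otimes> q) \<otimes> y = (?D \<otimes> y') \<otimes> y"
      using r pq c' x y Dc by (simp_all add: m_assoc)
    then have rp: "r \<otimes> p = ?D \<otimes> x'" "r \<otimes> q = ?D \<otimes> y'"
      using r pq c' x y Dc r_cancel[of "r \<otimes> p" x "?D \<otimes> x'"] r_cancel[of "r \<otimes> q" y "?D \<otimes> y'"] by auto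
    \<comment> \<open>Left multiplication by D is compatible with gcds: G is a multiple D g h of D
      g, and cancelling D shows that g h divides x' and y', hence g, so h = 1. As r divides D x' and
      D y', it divides D g, and the cofactor expresses w as a multiple of z.\<close>
    obtain G where G: "G \<in> carrier M" "G gcdof (?D \<otimes> x') (?D \<otimes> y')"
      using gcd[of "?D \<otimes> x'" "?D \<otimes> y'"] c' Dc by auto
    have Gx: "G divides ?D \<otimes> x'" and Gy: "G divides ?D \<otimes> y'"
      and Gl: "\<And>z. \<lbrakk>z \<in> carrier M; z divides ?D \<otimes> x'; z divides ?D \<otimes> y'\<rbrakk> \<Longrightarrow> z divides G"
      using G(2) by (simp_all add: isgcd_def)
    have "?D \<otimes> x' = (?D \<otimes> g) \<otimes> a" "?D \<otimes> y' = (?D \<otimes> g) \<otimes> b"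
      using ab g Dc by (simp_all add: m_assoc)
    then have "?D \<otimes> g divides ?D \<otimes> x'" "?D \<otimes> g divides ?D \<otimes> y'"
      using ab(1,2) unfolding factor_def by blast+
    then have "(?D \<otimes> g) divides G"
      using Gl[of "?D \<otimes> g"] Dc g(1) by simp
    then obtain h where h: "h \<in> carrier M" "G = (?D \<otimes> g) \<otimes> h" by (auto simp: factor_def)
    have "g \<otimes> h divides t" if t: "t \<in> carrier M" "G divides ?D \<otimes> t" for t
    proof -
      obtain s where "s \<in> carrier M" "?D \<otimes> t = G \<otimes> s" using t by (auto simp: factor_def)
      then have "?D \<otimes> t = ?D \<otimes> (g \<otimes> h \<otimes> s)" using h g Dc by (simp add: m_assoc)
      then have "t = g \<otimes> h \<otimes> s"
        using l_cancel[of ?D t "g \<otimes> h \<otimes> s"] Dc t h g \<open>s \<in> carrier M\<close> by simp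
      then show ?thesis using \<open>s \<in> carrier M\<close> by (auto simp: factor_def)
    qed
    then have "g \<otimes> h divides x'" "g \<otimes> h divides y'"
      using c'(1,2) Gx Gy by simp_all
    then have "g \<otimes> h divides g"
      using g h(1) by (simp add: isgcd_def)
    then obtain s where s: "s \<in> carrier M" "g = g \<otimes> h \<otimes> s" by (auto simp: factor_def)
    then have "g \<otimes> \<one> = g \<otimes> (h \<otimes> s)" using g h by (simp add: m_assoc)
    then have "h \<otimes> s = \<one>" using l_cancel[of g \<one> "h \<otimes> s"] g h s by auto
    then have "h = \<one>" using conical h s by blast
    then have "G = ?D \<otimes> g" using h g Dc by simp
    moreover have "r divides ?D \<otimes> x'" "r divides ?D \<otimes> y'"
      using rp[symmetric] pq(1,2) unfolding factor_def by blast+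
    then have "r divides G" using Gl[of r] r(1) by simp
    ultimately obtain t where t: "t \<in> carrier M" "?D \<otimes> g = r \<otimes> t" by (auto simp: factor_def)
    have "r \<otimes> w = ?D \<otimes> g \<otimes> z" using r(2) z g Dc by (simp add: m_assoc)
    then have "r \<otimes> w = r \<otimes> (t \<otimes> z)" using r(1) t z(1) by (simp add: m_assoc)
    then have "w = t \<otimes> z" using l_cancel[of r w "t \<otimes> z"] r t z w by simp
    then show ?thesis using t by (auto simp: divides_opposite)
  qed
  moreover have "x divides\<^bsub>opposite M\<^esub> z" "y divides\<^bsub>opposite M\<^esub> z"
    using ab(1) ab(2) zb unfolding z_def divides_opposite by blast+
  ultimately show ?thesis using z(1) by (auto simp: islcm_def)
qed

text \<open>Right lcms and \<Delta> suffice: finite divisor sets turn lcms into gcds, and powers of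
  \<Delta> supply the left lcms.\<close>

lemma garside_monoidI:
  assumes lcm: "\<And>x y. \<lbrakk>x \<in> carrier M; y \<in> carrier M\<rbrakk> \<Longrightarrow> \<exists>z\<in>carrier M. z lcmof x y"
    and D: "\<Delta> \<in> carrier M" "left_divisors M \<Delta> = right_divisors M \<Delta>" "generates M (left_divisors M \<Delta>)"
    and power: "\<And>x. x \<in> carrier M \<Longrightarrow> \<exists>k::nat. \<exists>c\<in>carrier M. c \<otimes> x = \<Delta> [^] k"
  shows "garside_monoid M"
proof -
  have llcm: "\<exists>z\<in>carrier M. z lcmof\<^bsub>opposite M\<^esub> x y" if "x \<in> carrier M" "y \<in> carrier M" for x y
    using left_lcm_exists[OF lcm D(1) power that] by blast
  have gcd: "\<exists>z\<in>carrier M. z gcdof x y" if "x \<in> carrier M" "y \<in> carrier M" for x y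
    using gcd_of_lcm[OF monoid_axioms that finite_left_divisors] that lcm by blast
  have rgcd: "\<exists>z\<in>carrier M. z gcdof\<^bsub>opposite M\<^esub> x y" if "x \<in> carrier M" "y \<in> carrier M" for x y
    using gcd_of_lcm[OF monoid_opposite[OF monoid_axioms], of x y] that llcm fin
    by (simp add: left_divisors_opposite)
  have "monoid_cancel M" ..
  then have "gaussian_monoid M"
    unfolding gaussian_monoid_def by (intro conjI ballI atomic lcm llcm gcd rgcd)
  moreover have "garside_element M \<Delta>"
    unfolding garside_element_def using D finite_left_divisors by blast
  ultimately show ?thesis unfolding garside_monoid_def by blast
qed

end
end

text \<open>M is any monoid in which words have equal values exactly when they are related by
  \<open>sim\<close>. This form serves both the monoids isomorphic to the presented one and the
  positive submonoid of a group.\<close>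

lemma (in garside_table) garside_monoid_of_table:
  fixes M :: "'b monoid" (structure)
  assumes "monoid M" and f: "f ` S \<subseteq> carrier M"
    and surj: "\<And>x. x \<in> carrier M \<Longrightarrow> \<exists>w\<in>lists S. x = mprod M f w"
    and eq: "\<And>u v. \<lbrakk>u \<in> lists S; v \<in> lists S\<rbrakk> \<Longrightarrow> mprod M f u = mprod M f v \<longleftrightarrow> sim u v"
  shows "garside_monoid M"
proof -
  interpret M: monoid M by fact
  define r where "r w = mprod M f w" for w
  have r_closed [simp]: "r w \<in> carrier M" if "w \<in> lists S" for w
    using M.mprod_closed[OF f that] by (simp add: r_def)
  have r_app: "r (u @ v) = r u \<otimes> r v" if "u \<in> lists S" "v \<in> lists S" for u v
    using M.mprod_append[OF f that] by (simp add: r_def)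
  have r_eq: "r u = r v \<longleftrightarrow> sim u v" if "u \<in> lists S" "v \<in> lists S" for u v
    using eq[OF that] by (simp add: r_def)
  have r_mult_eq: "r z = r u \<otimes> r w \<longleftrightarrow> sim (u @ w) z"
    if "u \<in> lists S" "w \<in> lists S" "z \<in> lists S" for u w z
    using r_app[of u w] r_eq[of "u @ w" z] that by auto
  have r_Nil: "r [] = \<one>" by (simp add: r_def)
  have rE: "\<exists>w\<in>lists S. x = r w" if "x \<in> carrier M" for x
    using surj[OF that] by (simp add: r_def)
  have div: "r u divides r z \<longleftrightarrow> triv (cw z u)" if "u \<in> lists S" "z \<in> lists S" for u z
  proof -
    have "r u divides r z \<longleftrightarrow> (\<exists>w\<in>lists S. r z = r u \<otimes> r w)"
      unfolding factor_def using rE r_closed by metis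
    also have "\<dots> \<longleftrightarrow> (\<exists>w\<in>lists S. sim (u @ w) z)"
      using that by (intro bex_cong) (simp_all add: r_mult_eq)
    also have "\<dots> \<longleftrightarrow> triv (cw z u)" using triv_cw_iff_left_divisor[OF that] by simp
    finally show ?thesis .
  qed
  have rdiv: "r u divides\<^bsub>opposite M\<^esub> r z \<longleftrightarrow> (\<exists>w\<in>lists S. sim (w @ u) z)"
    if "u \<in> lists S" "z \<in> lists S" for u z
  proof -
    have "r u divides\<^bsub>opposite M\<^esub> r z \<longleftrightarrow> (\<exists>w\<in>lists S. r z = r w \<otimes> r u)"
      unfolding divides_opposite using rE r_closed by metis
    also have "\<dots> \<longleftrightarrow> (\<exists>w\<in>lists S. sim (w @ u) z)"
      using that by (intro bex_cong) (simp_all add: r_mult_eq)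
    finally show ?thesis .
  qed
  interpret M: conical_cancel M
  proof (unfold_locales, goal_cases)
    case (1 x y z)
    obtain u v w where uvw: "u \<in> lists S" "z = r u" "v \<in> lists S" "x = r v" "w \<in> lists S" "y = r w"
      using rE 1 by meson
    then show ?case using 1(1) r_eq sim_left_cancel[of w u v] by (simp add: r_app[symmetric])
  next
    case (2 x z y)
    obtain u v w where uvw: "u \<in> lists S" "z = r u" "v \<in> lists S" "x = r v" "w \<in> lists S" "y = r w"
      using rE 2 by meson
    then show ?case using 2(1) r_eq sim_right_cancel[of v w u] by (simp add: r_app[symmetric])
  next
    case (3 x y)
    obtain u v where uv: "u \<in> lists S" "x = r u" "v \<in> lists S" "y = r v"
      using rE 3 by meson
    then have "triv (u @ v)"
      using 3(3) r_eq[of "u @ v" "[]"] by (simp add: r_app[symmetric] r_Nil[symmetric] sim_Nil_iff)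
    then show ?case using uv r_eq[of u "[]"] by (simp add: r_Nil sim_triv)
  qed
  have fin: "finite (right_divisors M x)" if x: "x \<in> carrier M" for x
  proof -
    obtain z where z: "z \<in> lists S" "x = r z" using rE x by blast
    \<comment> \<open>By \<open>right_factor_unique\<close>, every right divisor of the value of z
      is the value of a word as long as z, and there are finitely many such words.\<close>
    have "right_divisors M x \<subseteq> r ` {w. set w \<subseteq> S \<and> length w = length z}"
    proof
      fix y assume y: "y \<in> right_divisors M x"
      then obtain u where u: "u \<in> lists S" "y = r u" using rE by (auto simp: right_divisors_def)
      then obtain v where v: "v \<in> lists S" "sim (v @ u) z"
        using y z rdiv by (auto simp: right_divisors_def)
      have "y = r (cw v z)" using right_factor_unique[of v u z] r_eq[of u "cw v z"] u v z by simp
      moreover have "cw v z \<in> lists S" using v z by simp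
      ultimately show "y \<in> r ` {w. set w \<subseteq> S \<and> length w = length z}" by auto
    qed
    then show ?thesis using finite_lists_length_eq[OF finite_S] by (meson finite_surj)
  qed
  have r_letter: "r [x] = f x" if "x \<in> S" for x using that f by (auto simp: r_def)
  show ?thesis
  proof (rule M.garside_monoidI[OF fin])
    fix x y assume "x \<in> carrier M" "y \<in> carrier M"
    then obtain u v where uv: "u \<in> lists S" "x = r u" "v \<in> lists S" "y = r v" using rE by meson
    let ?l = "u @ cw u v"
    have l: "?l \<in> lists S" using uv by simp
    have "r ?l lcmof x y"
      unfolding islcm_def
    proof (intro conjI ballI impI)
      show "x divides r ?l"
        using div[of u ?l] l uv triv_cw_iff_left_divisor[of u ?l] by (metis cw_closed sim_refl)
      have "sim (v @ cw v u) ?l" using sim_lcm[of v u] uv by simp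
      moreover have "cw v u \<in> lists S" using uv by simp
      ultimately show "y divides r ?l"
        using div[of v ?l] l uv triv_cw_iff_left_divisor[of v ?l] by metis
    next
      fix z assume "z \<in> carrier M" and z: "x divides z \<and> y divides z"
      then obtain t where "t \<in> lists S" "z = r t" using rE by blast
      then show "r ?l divides z" using z uv div l lcm_least[of u v t] by metis
    qed
    then show "\<exists>z\<in>carrier M. z lcmof x y" using l by (intro bexI[of _ "r ?l"]) auto
  next
    show "r [d] \<in> carrier M" by simp
    have "r u divides r [d] \<longleftrightarrow> r u divides\<^bsub>opposite M\<^esub> r [d]" if "u \<in> lists S" for u
      using div[of u "[d]"] rdiv[of u "[d]"] right_divisor_d_iff[of u]
        triv_cw_iff_left_divisor[of u "[d]"] that by simp
    then show "left_divisors M (r [d]) = right_divisors M (r [d])"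
      using rE unfolding left_divisors_def right_divisors_def by (intro Collect_cong) metis
    have "f x \<in> left_divisors M (r [d])" if "x \<in> S" for x
    proof -
      have "triv (cw [d] [x])" using that by simp
      then have "r [x] divides r [d]" using div[of "[x]" "[d]"] that by simp
      then show ?thesis using that r_letter[OF that] r_closed[of "[x]"] by (simp add: left_divisors_def)
    qed
    then have "map f w \<in> expressions M (left_divisors M (r [d])) (r w)" if "w \<in> lists S" for w
      using that by (auto simp: expressions_def r_def)
    then show "generates M (left_divisors M (r [d]))"
      using rE unfolding generates_def left_divisors_def by (metis (no_types, lifting) empty_iff mem_Collect_eq subsetI)
  next
    fix x assume "x \<in> carrier M"
    then obtain u where u: "u \<in> lists S" "x = r u" using rE by blast
    have pow: "r (replicate k d) = r [d] [^] k" for k :: nat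
    proof (induction k)
      case (Suc k)
      have "r (replicate (Suc k) d) = r (replicate k d @ [d])" by (simp add: replicate_append_same)
      also have "\<dots> = r (replicate k d) \<otimes> r [d]" by (rule r_app) auto
      finally show ?case using Suc by simp
    qed (simp add: r_Nil)
    obtain v where v: "v \<in> lists S" "sim (v @ u) (replicate (length u) d)"
      using right_divides_d_power[OF u(1)] by blast
    have "replicate (length u) d \<in> lists S" by auto
    then have "r v \<otimes> r u = r (replicate (length u) d)"
      using v u r_eq[of "v @ u"] by (simp add: r_app)
    then have "r v \<otimes> x = r [d] [^] length u" using pow u(2) by simp
    then show "\<exists>k::nat. \<exists>c\<in>carrier M. c \<otimes> x = r [d] [^] k" using v(1) r_closed by blast
  qed
qed

section \<open>The monoid presented by a table\<close>

context complement_table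
begin

text \<open>The pairs of words of length two preserve length, so the triviality of the letter
  \<open>e\<close> has to be a relation of its own.\<close>

definition rels :: "('a list \<times> 'a list) set" where
  "rels = insert ([e], []) {([x, x \<triangleright> y], [y, y \<triangleright> x]) | x y. x \<in> S \<and> y \<in> S}"

abbreviation tmon :: "'a list set monoid" where
  "tmon \<equiv> monoid_presented_by S rels"

abbreviation tcl :: "'a list \<Rightarrow> 'a list set" where
  "tcl \<equiv> pcl S rels"

lemma rels_closed: "rels \<subseteq> lists S \<times> lists S"
  by (auto simp: rels_def)

context
  fixes N :: "('b, 'm) monoid_scheme" (structure) and f :: "'a \<Rightarrow> 'b"
  assumes N: "monoid N" and f: "f ` S \<subseteq> carrier N"
    and rel: "\<And>x y. \<lbrakk>x \<in> S; y \<in> S\<rbrakk> \<Longrightarrow> f x \<otimes> f (x \<triangleright> y) = f y \<otimes> f (y \<triangleright> x)"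
begin

interpretation N: monoid N by (rule N)

lemma letter_closed [simp]: "x \<in> S \<Longrightarrow> f x \<in> carrier N"
  using f by auto

lemma mprod_S_closed [simp]: "w \<in> lists S \<Longrightarrow> mprod N f w \<in> carrier N"
  by (rule N.mprod_closed[OF f])

text \<open>The assumption \<open>rel\<close> says that one square of the lcm grid commutes in N.
  Pasting squares along v gives a row, and pasting rows gives \<open>mprod_lcm\<close>.\<close>

lemma mprod_lcm_letter:
  "\<lbrakk>x \<in> S; v \<in> lists S\<rbrakk> \<Longrightarrow> f x \<otimes> mprod N f (lw x v) = mprod N f v \<otimes> f (wl v x)"
proof (induction v arbitrary: x)
  case (Cons y v)
  then have c: "x \<in> S" "y \<in> S" "v \<in> lists S" "x \<triangleright> y \<in> S" "y \<triangleright> x \<in> S"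
    "lw (y \<triangleright> x) v \<in> lists S" "wl v (y \<triangleright> x) \<in> S" by simp_all
  have "f x \<otimes> mprod N f (lw x (y # v)) = (f x \<otimes> f (x \<triangleright> y)) \<otimes> mprod N f (lw (y \<triangleright> x) v)"
    using c by (simp add: N.m_assoc)
  also have "\<dots> = f y \<otimes> (f (y \<triangleright> x) \<otimes> mprod N f (lw (y \<triangleright> x) v))"
    using c by (simp add: rel[of x y] N.m_assoc)
  also have "\<dots> = f y \<otimes> (mprod N f v \<otimes> f (wl v (y \<triangleright> x)))"
    using Cons.IH[of "y \<triangleright> x"] c by simp
  finally show ?case using c by (simp add: N.m_assoc)
qed simp

lemma mprod_lcm:
  "\<lbrakk>u \<in> lists S; v \<in> lists S\<rbrakk>
    \<Longrightarrow> mprod N f u \<otimes> mprod N f (cw u v) = mprod N f v \<otimes> mprod N f (cw v u)"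
proof (induction u arbitrary: v)
  case (Cons x u)
  then have c: "x \<in> S" "u \<in> lists S" "v \<in> lists S" "lw x v \<in> lists S" "wl v x \<in> S"
    "cw u (lw x v) \<in> lists S" "cw (lw x v) u \<in> lists S" by simp_all
  have "mprod N f (x # u) \<otimes> mprod N f (cw (x # u) v)
      = f x \<otimes> (mprod N f u \<otimes> mprod N f (cw u (lw x v)))"
    using c by (simp add: N.m_assoc)
  also have "\<dots> = (f x \<otimes> mprod N f (lw x v)) \<otimes> mprod N f (cw (lw x v) u)"
    using Cons.IH[of "lw x v"] c by (simp add: N.m_assoc)
  also have "\<dots> = mprod N f v \<otimes> (f (wl v x) \<otimes> mprod N f (cw (lw x v) u))"
    using mprod_lcm_letter[of x v] c by (simp add: N.m_assoc)
  finally show ?case by (simp add: cw_Cons)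
qed simp

lemma mprod_triv:
  assumes "f e = \<one>" "triv t"
  shows "mprod N f t = \<one>"
  using assms(2) by (induction t) (simp_all add: assms(1))

text \<open>When both completions are trivial, \<open>mprod_lcm\<close> degenerates to this
  equality.\<close>

lemma mprod_sim:
  assumes "f e = \<one>" "u \<in> lists S" "v \<in> lists S" "sim u v"
  shows "mprod N f u = mprod N f v"
  using mprod_lcm[OF assms(2,3)] assms mprod_triv[of "cw u v"] mprod_triv[of "cw v u"]
  by (simp add: sim_def)

end

lemma pcl_rel:
  assumes "x \<in> S" "y \<in> S"
  shows "tcl [x] \<otimes>\<^bsub>tmon\<^esub> tcl [x \<triangleright> y]
    = tcl [y] \<otimes>\<^bsub>tmon\<^esub> tcl [y \<triangleright> x]"
proof -
  have "([x, x \<triangleright> y], [y, y \<triangleright> x]) \<in> rels" using assms by (auto simp: rels_def)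
  then show ?thesis using assms by (simp add: pcl_mult pcl_eq_iff presentation_cong_relation)
qed

lemma pcl_e: "tcl [e] = \<one>\<^bsub>tmon\<^esub>"
  by (simp add: one_presented pcl_eq_iff presentation_cong_relation rels_def)

lemma sim_rels: "(u, v) \<in> rels \<Longrightarrow> sim u v"
  by (auto simp: rels_def sim_triv) (simp add: sim_def)

text \<open>\<open>sim\<close> is a congruence that contains the relations. Conversely,
  \<open>mprod_sim\<close> applies in the presented monoid itself, where the relations hold.\<close>

lemma sim_iff_presentation_cong:
  assumes "u \<in> lists S" "v \<in> lists S"
  shows "(u, v) \<in> presentation_cong S rels \<longleftrightarrow> sim u v"
proof
  assume "(u, v) \<in> presentation_cong S rels"
  then show "sim u v"
  proof (induction rule: presentation_cong.induct)
    case (base u v x y)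
    then show ?case using sim_append_right[of u v y] sim_rels by (simp add: sim_left_cancel)
  next
    case (trans u v w)
    then show ?case using sim_trans presentation_cong_in_lists by metis
  qed (simp_all add: sim_sym)
next
  assume "sim u v"
  then have "mprod tmon (\<lambda>x. tcl [x]) u
      = mprod tmon (\<lambda>x. tcl [x]) v"
    using assms by (intro mprod_sim monoid_presented) (auto simp: pcl_rel pcl_e)
  then show "(u, v) \<in> presentation_cong S rels" using assms by (simp add: mprod_pcl pcl_eq_iff)
qed

end

lemma (in garside_table) garside_monoid_iso_table:
  fixes M :: "'b monoid"
  assumes "monoid M" "tmon \<cong> M"
  shows "garside_monoid M"
proof -
  obtain h where h: "h \<in> iso tmon M" using assms(2) by (auto simp: is_iso_def)
  then have hom: "h \<in> hom tmon M"
    and surj: "h ` carrier tmon = carrier M"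
    and inj: "inj_on h (carrier tmon)" by (simp_all add: iso_iff)
  let ?p = "\<lambda>x. tcl [x]"
  have "?p ` S \<subseteq> carrier tmon" by auto
  then have mp: "mprod M (h \<circ> ?p) w = h (tcl w)" if "w \<in> lists S" for w
    using iso_mprod[OF monoid_presented assms(1) h, of ?p S w] mprod_pcl[of w S rels] that by simp
  show ?thesis
  proof (rule garside_monoid_of_table[OF assms(1), of "h \<circ> ?p"])
    show "(h \<circ> ?p) ` S \<subseteq> carrier M" using hom_in_carrier[OF hom] by auto
  next
    fix x assume "x \<in> carrier M"
    then obtain X where X: "X \<in> carrier tmon" "x = h X" using surj by blast
    then obtain w where "w \<in> lists S" "X = tcl w" by (meson carrier_presentedE)
    then show "\<exists>w\<in>lists S. x = mprod M (h \<circ> ?p) w" using mp X by metis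
  next
    fix u v assume uv: "u \<in> lists S" "v \<in> lists S"
    then have "h (tcl u) = h (tcl v) \<longleftrightarrow> tcl u = tcl v"
      using inj_on_eq_iff[OF inj] by simp
    then show "mprod M (h \<circ> ?p) u = mprod M (h \<circ> ?p) v \<longleftrightarrow> sim u v"
      using uv mp by (simp add: pcl_eq_iff sim_iff_presentation_cong)
  qed
qed

section \<open>The table of a Garside monoid\<close>

context
  fixes M :: "'a monoid" (structure)
  assumes gauss: "gaussian_monoid M"
begin

lemma gaussian_monoid_cancel: "monoid_cancel M"
  using gauss by (simp add: gaussian_monoid_def)

interpretation M: monoid_cancel M by (rule gaussian_monoid_cancel)

text \<open>A nonempty expression of 1 by atoms could be repeated any number of times, against the
  finiteness of the norm of 1.\<close>

lemma gaussian_conical: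
  assumes "x \<in> carrier M" "y \<in> carrier M" "x \<otimes> y = \<one>"
  shows "x = \<one>"
proof (rule ccontr)
  assume "x \<noteq> \<one>"
  have at: "atomic_monoid M" using gauss by (simp add: gaussian_monoid_def)
  then obtain u v where uv: "u \<in> expressions M (atoms M) x" "v \<in> expressions M (atoms M) y"
    using assms unfolding atomic_monoid_def generates_def by blast
  then have "u \<noteq> []" using \<open>x \<noteq> \<one>\<close> by (auto simp: expressions_def)
  have atc: "atoms M \<subseteq> carrier M" by (auto simp: atoms_def)
  define w where "w = u @ v"
  have w: "w \<in> expressions M (atoms M) \<one>"
    using uv M.mprod_append[of id "carrier M" u v] atc assms by (auto simp: expressions_def w_def)
  have pow: "concat (replicate n w) \<in> expressions M (atoms M) \<one>" for n
  proof (induction n)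
    case (Suc n)
    then show ?case
      using w M.mprod_append[of id "carrier M" w "concat (replicate n w)"] atc
      by (auto simp: expressions_def)
  qed (simp add: expressions_def)
  have len: "n \<le> length (concat (replicate n w))" for n
  proof (induction n)
    case (Suc n)
    have "Suc 0 \<le> length w" using \<open>u \<noteq> []\<close> by (simp add: w_def Suc_le_eq)
    then have "Suc n \<le> length w + length (concat (replicate n w))" using Suc by linarith
    then show ?case by simp
  qed simp
  have "enat n \<le> atomic_norm M \<one>" for n
  proof -
    have "enat n \<le> enat (length (concat (replicate n w)))" using len[of n] by simp
    also have "\<dots> \<le> atomic_norm M \<one>" unfolding atomic_norm_def by (rule SUP_upper[OF pow])
    finally show ?thesis .
  qed
  note norm = this
  have "atomic_norm M \<one> < \<infinity>" using at by (auto simp: atomic_monoid_def)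
  then obtain k where "atomic_norm M \<one> = enat k" by auto
  then show False using norm[of "Suc k"] by simp
qed

lemma divides_antisym:
  assumes "x \<in> carrier M" "y \<in> carrier M" "x divides y" "y divides x"
  shows "x = y"
proof -
  obtain a b where ab: "a \<in> carrier M" "b \<in> carrier M" "y = x \<otimes> a" "x = y \<otimes> b"
    using assms by (auto simp: factor_def)
  have "x \<otimes> (a \<otimes> b) = x \<otimes> \<one>" using assms ab(1,2) M.m_assoc[of x a b] ab(3,4)[symmetric] by simp
  then have "a \<otimes> b = \<one>"
    using M.l_cancel ab(1,2) assms(1) M.m_closed M.one_closed by blast
  then have "a = \<one>" by (rule gaussian_conical[OF ab(1,2)])
  then show ?thesis using ab(3) assms(1) by simp
qed

lemma lcm_unique:
  assumes "x \<in> carrier M" "y \<in> carrier M" "x lcmof a b" "y lcmof a b"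
  shows "x = y"
  using assms divides_antisym[of x y] by (simp add: islcm_def)

lemma lcmof_self: "x \<in> carrier M \<Longrightarrow> y \<in> carrier M \<Longrightarrow> y divides x \<Longrightarrow> x lcmof x y \<and> x lcmof y x"
  by (auto simp: islcm_def)

lemma divides_mult_cancel:
  assumes "a \<in> carrier M" "x \<in> carrier M" "y \<in> carrier M"
  shows "a \<otimes> x divides a \<otimes> y \<longleftrightarrow> x divides y"
  using assms M.l_cancel[of a y "x \<otimes> _"] by (auto simp: factor_def M.m_assoc)

end

text \<open>The cube law holds because both of its sides complete to the lcm of the same three
  elements. Here \<open>xy\<close>, \<open>xz\<close> and \<open>c\<close> stand for x
  \<triangleright> y, x \<triangleright> z and (x \<triangleright> y) \<triangleright> (x
  \<triangleright> z).\<close>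

lemma lcm_complements:
  fixes M :: "'a monoid" (structure)
  assumes gauss: "gaussian_monoid M"
    and x: "x \<in> carrier M" and y: "y \<in> carrier M" and z: "z \<in> carrier M"
    and c: "xy \<in> carrier M" "xz \<in> carrier M" "c \<in> carrier M"
    and l: "(x \<otimes> xy) lcmof x y" "(x \<otimes> xz) lcmof x z" "(xy \<otimes> c) lcmof xy xz"
  shows "x divides x \<otimes> xy \<otimes> c \<and> y divides x \<otimes> xy \<otimes> c \<and> z divides x \<otimes> xy \<otimes> c \<and>
    (\<forall>t\<in>carrier M. x divides t \<and> y divides t \<and> z divides t \<longrightarrow> x \<otimes> xy \<otimes> c divides t)"
proof -
  interpret M: monoid_cancel M by (rule gaussian_monoid_cancel[OF gauss])
  let ?t = "x \<otimes> xy \<otimes> c"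
  have t: "?t = x \<otimes> (xy \<otimes> c)" using x c by (simp add: M.m_assoc)
  have "x \<otimes> xy divides ?t" using x c by (auto simp: factor_def)
  moreover have "x \<otimes> xz divides ?t"
    using l(3) x c by (simp add: t islcm_def divides_mult_cancel[OF gauss])
  moreover have "x divides x \<otimes> xy" "y divides x \<otimes> xy" "z divides x \<otimes> xz"
    using l by (simp_all add: islcm_def)
  ultimately have "x divides ?t" "y divides ?t" "z divides ?t"
    using M.divides_trans[of x "x \<otimes> xy" ?t] M.divides_trans[of y "x \<otimes> xy" ?t]
      M.divides_trans[of z "x \<otimes> xz" ?t] x y z c by simp_all
  moreover have "?t divides s" if s: "s \<in> carrier M" "x divides s" "y divides s" "z divides s" for s
  proof -
    obtain r where r: "r \<in> carrier M" "s = x \<otimes> r" using s by (auto simp: factor_def)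
    have "x \<otimes> xy divides s" "x \<otimes> xz divides s" using l s by (simp_all add: islcm_def)
    then have "xy divides r" "xz divides r" using r x c by (simp_all add: divides_mult_cancel[OF gauss])
    then have "xy \<otimes> c divides r" using l(3) r by (simp add: islcm_def)
    then show ?thesis using r x c by (simp add: t divides_mult_cancel[OF gauss])
  qed
  ultimately show ?thesis by blast
qed

text \<open>Expresses that M is the monoid of the table through values of words instead of an
  isomorphism, a form that can be carried along an embedding of M into a group.\<close>

definition table_of :: "'a set \<Rightarrow> ('a \<Rightarrow> 'a \<Rightarrow> 'a) \<Rightarrow> 'a \<Rightarrow> 'b monoid \<Rightarrow> ('a \<Rightarrow> 'b) \<Rightarrow> bool" where
  "table_of S cm e M f \<longleftrightarrow> f ` S \<subseteq> carrier M \<and> f e = \<one>\<^bsub>M\<^esub> \<and>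
     (\<forall>x\<in>S. \<forall>y\<in>S. f x \<otimes>\<^bsub>M\<^esub> f (cm x y) = f y \<otimes>\<^bsub>M\<^esub> f (cm y x)) \<and>
     (\<forall>x\<in>carrier M. \<exists>w\<in>lists S. x = mprod M f w) \<and>
     (\<forall>u\<in>lists S. \<forall>v\<in>lists S. mprod M f u = mprod M f v \<longleftrightarrow> complement_table.sim cm e u v)"

lemma garside_monoid_imp_table:
  fixes M :: "'b monoid" (structure)
  assumes "garside_monoid M"
  obtains m :: nat and cm e d f where "garside_table {..<m} cm e d" "table_of {..<m} cm e M f"
proof -
  obtain \<Delta> where gauss: "gaussian_monoid M" and gar: "garside_element M \<Delta>"
    using assms by (auto simp: garside_monoid_def)
  interpret M: monoid_cancel M by (rule gaussian_monoid_cancel[OF gauss])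
  note antisym = divides_antisym[OF gauss]
  have D: "\<Delta> \<in> carrier M" and fin: "finite (left_divisors M \<Delta>)"
    and LR: "left_divisors M \<Delta> = right_divisors M \<Delta>" and gen: "generates M (left_divisors M \<Delta>)"
    using gar unfolding garside_element_def by blast+
  \<comment> \<open>The divisors of \<Delta> are numbered, so that the table becomes finite data
    about numbers.\<close>
  obtain f :: "nat \<Rightarrow> 'b" where "bij_betw f {0..<card (left_divisors M \<Delta>)} (left_divisors M \<Delta>)"
    using ex_bij_betw_nat_finite[OF fin] by blast
  then obtain m :: nat where bij: "bij_betw f {..<m} (left_divisors M \<Delta>)"
    by (metis lessThan_atLeast0)
  let ?S = "{..<m}"
  have f: "f x \<in> carrier M" "f x divides \<Delta>" if "x \<in> ?S" for x
    using bij_betwE[OF bij] that by (auto simp: left_divisors_def)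
  have fD: "\<exists>x\<in>?S. f x = y" if "y \<in> carrier M" "y divides \<Delta>" for y
  proof -
    have "y \<in> f ` ?S" using bij that by (simp add: left_divisors_def bij_betw_def)
    then show ?thesis by blast
  qed
  have inj: "f x = f y \<longleftrightarrow> x = y" if "x \<in> ?S" "y \<in> ?S" for x y
    using bij that by (auto simp: bij_betw_def inj_on_def)
  have lcm: "\<exists>z\<in>carrier M. z lcmof x y" if "x \<in> carrier M" "y \<in> carrier M" for x y
    using gauss that by (simp add: gaussian_monoid_def)
  have rdiv: "x divides \<Delta> \<longleftrightarrow> (\<exists>c\<in>carrier M. \<Delta> = c \<otimes> x)" if "x \<in> carrier M" for x
    using LR that by (auto simp: left_divisors_def right_divisors_def divides_opposite set_eq_iff)
  \<comment> \<open>Complements of simple elements are simple: the lcm of two divisors of \<Delta>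
    divides \<Delta>, say \<Delta> = f(x) c t. Then c t right divides \<Delta>, hence left divides
    it, and so does c.\<close>
  have ex: "\<exists>z. z \<in> ?S \<and> (f x \<otimes> f z) lcmof (f x) (f y)" if xy: "x \<in> ?S" "y \<in> ?S" for x y
  proof -
    obtain l where l: "l \<in> carrier M" "l lcmof (f x) (f y)" using lcm f xy by blast
    then have "f x divides l" "l divides \<Delta>" using f[OF xy(1)] f[OF xy(2)] D by (simp_all add: islcm_def)
    then obtain c t where c: "c \<in> carrier M" "l = f x \<otimes> c" "t \<in> carrier M" "\<Delta> = l \<otimes> t"
      by (auto simp: factor_def)
    then have "\<Delta> = f x \<otimes> (c \<otimes> t)" using f xy by (simp add: M.m_assoc)
    then have "c \<otimes> t divides \<Delta>" using rdiv[of "c \<otimes> t"] c f xy by auto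
    moreover have "c divides c \<otimes> t" using c by (auto simp: factor_def)
    ultimately have "c divides \<Delta>" using M.divides_trans[of c "c \<otimes> t" \<Delta>] c D by simp
    then obtain z where "z \<in> ?S" "f z = c" using fD c by blast
    then show ?thesis using c l by blast
  qed
  define cm where "cm x y = (SOME z. z \<in> ?S \<and> (f x \<otimes> f z) lcmof (f x) (f y))" for x y
  have cm: "cm x y \<in> ?S" "(f x \<otimes> f (cm x y)) lcmof (f x) (f y)" if "x \<in> ?S" "y \<in> ?S" for x y
    using someI_ex[OF ex[OF that]] by (simp_all add: cm_def)
  have cm_eq: "cm x y = z" if "x \<in> ?S" "y \<in> ?S" "z \<in> ?S" "(f x \<otimes> f z) lcmof (f x) (f y)" for x y z
  proof -
    have "f x \<otimes> f (cm x y) = f x \<otimes> f z"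
      using lcm_unique[OF gauss, of "f x \<otimes> f (cm x y)" "f x \<otimes> f z" "f x" "f y"] f cm that by simp
    then have "f (cm x y) = f z" using M.l_cancel[of "f x"] f cm that by simp
    then show ?thesis using inj[of "cm x y" z] cm that by simp
  qed
  have cm_comm: "f x \<otimes> f (cm x y) = f y \<otimes> f (cm y x)" if "x \<in> ?S" "y \<in> ?S" for x y
  proof -
    have "(f y \<otimes> f (cm y x)) lcmof (f x) (f y)" using cm[of y x] that by (simp add: islcm_def)
    then show ?thesis
      using lcm_unique[OF gauss, of "f x \<otimes> f (cm x y)" "f y \<otimes> f (cm y x)" "f x" "f y"] f cm that by simp
  qed
  obtain e where e: "e \<in> ?S" "f e = \<one>" using fD[of \<one>] D by (auto simp: factor_def)
  obtain d where d: "d \<in> ?S" "f d = \<Delta>" using fD[of \<Delta>] D M.divides_refl[of \<Delta>] by blast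
  have one_div: "\<one> divides x" if "x \<in> carrier M" for x using that by (auto simp: factor_def)
  have self: "cm x y = e" if "x \<in> ?S" "y \<in> ?S" "f y divides f x" for x y
    using cm_eq[of x y e] lcmof_self[OF gauss, of "f x" "f y"] f e that by simp
  have cube: "cm (cm x y) (cm x z) = cm (cm y x) (cm y z)" if xyz: "x \<in> ?S" "y \<in> ?S" "z \<in> ?S" for x y z
  proof -
    \<comment> \<open>A and B are both lcms of the same three elements and hence equal. By
      \<open>cm_comm\<close> their first two factors have the same product, which cancels.\<close>
    define A where "A = f x \<otimes> f (cm x y) \<otimes> f (cm (cm x y) (cm x z))"
    define B where "B = f y \<otimes> f (cm y x) \<otimes> f (cm (cm y x) (cm y z))"
    have c: "cm x y \<in> ?S" "cm x z \<in> ?S" "cm y x \<in> ?S" "cm y z \<in> ?S" using cm xyz by simp_all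
    have c': "cm (cm x y) (cm x z) \<in> ?S" "cm (cm y x) (cm y z) \<in> ?S" using cm c by simp_all
    have AB: "A \<in> carrier M" "B \<in> carrier M" using f c c' xyz by (simp_all add: A_def B_def)
    have A: "f x divides A \<and> f y divides A \<and> f z divides A \<and>
        (\<forall>t\<in>carrier M. f x divides t \<and> f y divides t \<and> f z divides t \<longrightarrow> A divides t)"
      unfolding A_def using cm xyz f c c'
      by (intro lcm_complements[OF gauss, of "f x" "f y" "f z" "f (cm x y)" "f (cm x z)" "f (cm (cm x y) (cm x z))"]) simp_all
    have B: "f y divides B \<and> f x divides B \<and> f z divides B \<and>
        (\<forall>t\<in>carrier M. f y divides t \<and> f x divides t \<and> f z divides t \<longrightarrow> B divides t)"
      unfolding B_def using cm xyz f c c'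
      by (intro lcm_complements[OF gauss, of "f y" "f x" "f z" "f (cm y x)" "f (cm y z)" "f (cm (cm y x) (cm y z))"]) simp_all
    have "A = B" using antisym[of A B] A B AB by simp
    then have "f (cm (cm x y) (cm x z)) = f (cm (cm y x) (cm y z))"
      using cm_comm[of x y] M.l_cancel[of "f x \<otimes> f (cm x y)"] f c c' xyz by (simp add: A_def B_def)
    then show ?thesis using inj c' by simp
  qed
  have ct: "complement_table ?S cm e"
  proof (unfold_locales, goal_cases)
    case (3 x) then show ?case using self[of x x] f M.divides_refl by simp
  next
    case (4 x) then show ?case using self[of x e] e f one_div by simp
  next
    case (5 x) then show ?case
      using cm_eq[of e x x] lcmof_self[OF gauss, of "f x" \<one>] e f one_div by simp
  qed (use cm e cube in simp_all)
  then interpret T: complement_table ?S cm e .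
  have gt: "garside_table ?S cm e d"
  proof (unfold_locales, goal_cases)
    case (3 x) then show ?case using self[of d x] d f by simp
  next
    case (4 x)
    then obtain c where c: "c \<in> carrier M" "\<Delta> = c \<otimes> f x" using rdiv[of "f x"] f by auto
    then have "c divides \<Delta>" using f 4 by (auto simp: factor_def)
    then obtain y where y: "y \<in> ?S" "f y = c" using fD c by blast
    then have "cm y d = x" using cm_eq[of y d x] lcmof_self[OF gauss, of \<Delta> c] c d D 4 \<open>c divides \<Delta>\<close> by simp
    then show ?case using y by blast
  qed (use d in simp_all)
  have fS: "f ` ?S \<subseteq> carrier M" using f by auto
  have pc: "mprod M f w \<in> carrier M" if "w \<in> lists ?S" for w using M.mprod_closed[OF fS that] .
  have surj: "\<exists>w\<in>lists ?S. x = mprod M f w" if x: "x \<in> carrier M" for x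
  proof -
    obtain l where l: "set l \<subseteq> left_divisors M \<Delta>" "foldr (\<otimes>) l \<one> = x"
      using gen x unfolding generates_def expressions_def by blast
    have "\<exists>w\<in>lists ?S. l = map f w" using l(1)
    proof (induction l)
      case (Cons a l)
      then obtain w where "w \<in> lists ?S" "l = map f w" by auto
      moreover obtain s where "s \<in> ?S" "f s = a"
        using Cons.prems fD by (auto simp: left_divisors_def)
      ultimately show ?case by (intro bexI[of _ "s # w"]) auto
    qed auto
    then show ?thesis using l by auto
  qed
  \<comment> \<open>A converse of \<open>mprod_lcm_letter\<close>: every common multiple of a letter
    and a word factors through their completion in the grid. This shows that M satisfies no
    relations beyond those of the table.\<close>
  have factor_letter: "\<exists>t\<in>carrier M. p = mprod M f (T.lw x v) \<otimes> t \<and> q = f (T.wl v x) \<otimes> t"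
    if "x \<in> ?S" "v \<in> lists ?S" "p \<in> carrier M" "q \<in> carrier M" "f x \<otimes> p = mprod M f v \<otimes> q" for x v p q
    using that
  proof (induction v arbitrary: x p q)
    case Nil then show ?case using f by (intro bexI[of _ p]) auto
  next
    case (Cons y v)
    then have xy: "x \<in> ?S" "y \<in> ?S" and v: "v \<in> lists ?S" and p: "p \<in> carrier M" and q: "q \<in> carrier M"
      by simp_all
    note cl = f(1)[OF xy(1)] f(1)[OF xy(2)] f(1)[OF cm(1)[OF xy]] f(1)[OF cm(1)[OF xy(2,1)]] pc[OF v] p q
    have E: "f x \<otimes> p = f y \<otimes> (mprod M f v \<otimes> q)" using Cons.prems cl by (simp add: M.m_assoc)
    have "f x divides f x \<otimes> p" using cl unfolding factor_def by blast
    moreover have "f y divides f x \<otimes> p" using cl unfolding E factor_def by blast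
    moreover have "f x \<otimes> p \<in> carrier M" using cl by simp
    ultimately have "f x \<otimes> f (cm x y) divides f x \<otimes> p"
      using cm(2)[OF xy] unfolding islcm_def by blast
    then obtain t where t: "t \<in> carrier M" "f x \<otimes> p = f x \<otimes> f (cm x y) \<otimes> t" by (auto simp: factor_def)
    have "f x \<otimes> p = f x \<otimes> (f (cm x y) \<otimes> t)" using t cl by (simp add: M.m_assoc)
    then have p': "p = f (cm x y) \<otimes> t" using M.l_cancel[of "f x" p "f (cm x y) \<otimes> t"] t cl by simp
    have "f y \<otimes> (mprod M f v \<otimes> q) = f y \<otimes> (f (cm y x) \<otimes> t)"
      using t E cm_comm[OF xy] cl by (simp add: M.m_assoc)
    then have "f (cm y x) \<otimes> t = mprod M f v \<otimes> q"
      using M.l_cancel[of "f y" "mprod M f v \<otimes> q" "f (cm y x) \<otimes> t"] t cl by simp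
    from Cons.IH[OF cm(1)[OF xy(2,1)] v t(1) q this]
    obtain s where s: "s \<in> carrier M" "t = mprod M f (T.lw (cm y x) v) \<otimes> s" "q = f (T.wl v (cm y x)) \<otimes> s"
      by blast
    have "mprod M f (T.lw (cm y x) v) \<in> carrier M" using cm(1)[OF xy(2,1)] v by (intro pc) simp
    then have "p = mprod M f (T.lw x (y # v)) \<otimes> s" using p' s cl by (simp add: M.m_assoc)
    then show ?case using s by auto
  qed
  have factor_word: "\<exists>t\<in>carrier M. p = mprod M f (T.cw u v) \<otimes> t \<and> q = mprod M f (T.cw v u) \<otimes> t"
    if "u \<in> lists ?S" "v \<in> lists ?S" "p \<in> carrier M" "q \<in> carrier M"
      "mprod M f u \<otimes> p = mprod M f v \<otimes> q" for u v p q
    using that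
  proof (induction u arbitrary: v p q)
    case Nil then show ?case using pc by (intro bexI[of _ q]) auto
  next
    case (Cons x u)
    then have x: "x \<in> ?S" and u: "u \<in> lists ?S" and v: "v \<in> lists ?S"
      and p: "p \<in> carrier M" and q: "q \<in> carrier M" by simp_all
    note cl = f(1)[OF x] pc[OF u] pc[OF v] p q
    have lwc: "T.lw x v \<in> lists ?S" "T.wl v x \<in> ?S" using x v T.lw_closed[of x v] T.wl_closed[of v x] by simp_all
    have "f x \<otimes> (mprod M f u \<otimes> p) = mprod M f v \<otimes> q" using Cons.prems cl by (simp add: M.m_assoc)
    then obtain t where t: "t \<in> carrier M" "mprod M f u \<otimes> p = mprod M f (T.lw x v) \<otimes> t" "q = f (T.wl v x) \<otimes> t"
      using factor_letter[OF x v, of "mprod M f u \<otimes> p" q] cl by auto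
    obtain s where s: "s \<in> carrier M" "p = mprod M f (T.cw u (T.lw x v)) \<otimes> s"
      "t = mprod M f (T.cw (T.lw x v) u) \<otimes> s"
      using Cons.IH[OF lwc(1) p t(1,2)] u by blast
    have "mprod M f (T.cw (T.lw x v) u) \<in> carrier M" using lwc u by (intro pc T.cw_closed)
    then have "q = mprod M f (T.cw v (x # u)) \<otimes> s"
      using t(3) s f(1)[OF lwc(2)] by (simp add: T.cw_Cons M.m_assoc)
    then show ?case using s by auto
  qed
  have conical: "x = \<one>" if "x \<in> carrier M" "y \<in> carrier M" "x \<otimes> y = \<one>" for x y
    using gaussian_conical[OF gauss that] .
  have triv: "T.triv w" if "w \<in> lists ?S" "mprod M f w = \<one>" for w
    using that
  proof (induction w)
    case (Cons x w)
    then have 1: "f x = \<one>" using conical[of "f x" "mprod M f w"] f pc by simp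
    then have "x = e" using inj[of x e] e Cons by simp
    moreover have "mprod M f w = \<one>" using 1 Cons pc by simp
    ultimately show ?case using Cons by simp
  qed simp
  have tr: "T.triv (T.cw u v)" if uv: "u \<in> lists ?S" "v \<in> lists ?S" and eq: "mprod M f u = mprod M f v" for u v
  proof -
    \<comment> \<open>The case p = q = 1: the completion divides 1 and therefore consists of letters
      \<open>e\<close> only.\<close>
    obtain t where "t \<in> carrier M" "\<one> = mprod M f (T.cw u v) \<otimes> t"
      using factor_word[OF uv, of \<one> \<one>] eq pc uv by auto
    then show ?thesis using conical[of "mprod M f (T.cw u v)" t] pc uv triv T.cw_closed by simp
  qed
  have "mprod M f u = mprod M f v \<longleftrightarrow> T.sim u v" if uv: "u \<in> lists ?S" "v \<in> lists ?S" for u v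
  proof
    assume "mprod M f u = mprod M f v"
    then show "T.sim u v" using tr[OF uv] tr[OF uv(2,1)] by (simp add: T.sim_def)
  next
    assume "T.sim u v"
    then show "mprod M f u = mprod M f v"
      using T.mprod_sim[OF M.monoid_axioms fS cm_comm e(2) uv] by simp
  qed
  then have "table_of ?S cm e M f"
    unfolding table_of_def by (intro conjI ballI fS e(2) cm_comm surj)
  with gt show ?thesis by (rule that)
qed

lemma (in complement_table) table_of_imp_iso:
  fixes M :: "'b monoid"
  assumes "monoid M" "table_of S cm e M f"
  shows "tmon \<cong> M"
proof -
  interpret M: monoid M by fact
  have f: "f ` S \<subseteq> carrier M" and fe: "f e = \<one>\<^bsub>M\<^esub>"
    and rel: "\<And>x y. \<lbrakk>x \<in> S; y \<in> S\<rbrakk> \<Longrightarrow> f x \<otimes>\<^bsub>M\<^esub> f (x \<triangleright> y) = f y \<otimes>\<^bsub>M\<^esub> f (y \<triangleright> x)"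
    and surj: "\<And>x. x \<in> carrier M \<Longrightarrow> \<exists>w\<in>lists S. x = mprod M f w"
    and eq: "\<And>u v. \<lbrakk>u \<in> lists S; v \<in> lists S\<rbrakk> \<Longrightarrow> mprod M f u = mprod M f v \<longleftrightarrow> sim u v"
    using assms(2) by (simp_all add: table_of_def)
  have fc: "f x \<in> carrier M" if "x \<in> S" for x using f that by auto
  have "mprod M f u = mprod M f v" if "(u, v) \<in> rels" "u \<in> lists S" "v \<in> lists S" for u v
    using eq[OF that(2,3)] sim_rels[OF that(1)] by simp
  then obtain h where h: "h \<in> hom tmon M"
    "\<And>w. w \<in> lists S \<Longrightarrow> h (tcl w) = mprod M f w"
    using presented_hom[OF assms(1) f] by blast
  have "inj_on h (carrier tmon)"
  proof (rule inj_onI)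
    fix x y assume x: "x \<in> carrier tmon" and y: "y \<in> carrier tmon"
      and "h x = h y"
    obtain u where "u \<in> lists S" "x = tcl u" using x by (rule carrier_presentedE)
    moreover obtain v where "v \<in> lists S" "y = tcl v" using y by (rule carrier_presentedE)
    ultimately show "x = y"
      using \<open>h x = h y\<close> h(2) eq by (simp add: pcl_eq_iff sim_iff_presentation_cong)
  qed
  moreover have "carrier M \<subseteq> h ` carrier tmon"
  proof
    fix x assume "x \<in> carrier M"
    then obtain w where "w \<in> lists S" "x = h (tcl w)" using surj h(2) by metis
    then show "x \<in> h ` carrier tmon" by simp
  qed
  ultimately have "h \<in> iso tmon M"
    using h(1) hom_carrier[OF h(1)] by (simp add: iso_iff subset_antisym)
  then show ?thesis by (rule is_isoI)
qed

section \<open>The group presented by a table\<close>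

lemma presented_is_group:
  assumes "\<And>a. a \<in> A \<Longrightarrow> \<exists>b\<in>A. ([b, a], []) \<in> presentation_cong A R"
  shows "group (monoid_presented_by A R)"
proof (rule monoid.group_l_invI[OF monoid_presented])
  fix x assume x: "x \<in> carrier (monoid_presented_by A R)"
  obtain w where w: "w \<in> lists A" "x = pcl A R w" using x by (rule carrier_presentedE)
  have "\<exists>v\<in>lists A. (v @ w, []) \<in> presentation_cong A R" using w(1)
  proof (induction w)
    case Nil then show ?case by (intro bexI[of _ "[]"]) (auto intro: presentation_cong.refl)
  next
    case (Cons a w)
    then obtain v where v: "v \<in> lists A" "(v @ w, []) \<in> presentation_cong A R" by fastforce
    obtain b where b: "b \<in> A" "([b, a], []) \<in> presentation_cong A R"
      using assms[of a] Cons by auto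
    have "(v @ [b, a] @ w, v @ [] @ w) \<in> presentation_cong A R"
      using v b Cons.hyps
      by (intro presentation_cong_append_left presentation_cong_append_right) auto
    then have "((v @ [b]) @ a # w, []) \<in> presentation_cong A R"
      using v(2) presentation_cong.trans[of "v @ [b, a] @ w" "v @ w" A R "[]"] by simp
    then show ?case using v b by (intro bexI[of _ "v @ [b]"]) auto
  qed
  then obtain v where v: "v \<in> lists A" "(v @ w, []) \<in> presentation_cong A R" by blast
  show "\<exists>y\<in>carrier (monoid_presented_by A R). y \<otimes>\<^bsub>monoid_presented_by A R\<^esub> x = \<one>\<^bsub>monoid_presented_by A R\<^esub>"
    using v w by (intro bexI[of _ "pcl A R v"]) (simp_all add: pcl_mult one_presented pcl_eq_iff)
qed

definition signed :: "'a set \<Rightarrow> ('a + 'a) set" where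
  "signed A = A <+> A"

definition free_rels :: "'a set \<Rightarrow> (('a + 'a) list \<times> ('a + 'a) list) set" where
  "free_rels A = (\<Union>a\<in>A. {([Inl a, Inr a], []), ([Inr a, Inl a], [])})"

definition signed_map :: "('g, 'm) monoid_scheme \<Rightarrow> ('a \<Rightarrow> 'g) \<Rightarrow> 'a + 'a \<Rightarrow> 'g" where
  "signed_map G f = case_sum f (\<lambda>a. inv\<^bsub>G\<^esub> (f a))"

lemma signed_group:
  assumes "free_rels A \<subseteq> R"
  shows "group (monoid_presented_by (signed A) R)"
proof (rule presented_is_group)
  fix a assume a: "a \<in> signed A"
  have r: "(u, v) \<in> presentation_cong (signed A) R"
    if "(u, v) \<in> free_rels A" "u \<in> lists (signed A)" "v \<in> lists (signed A)" for u v
    using that assms presentation_cong_relation by blast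
  show "\<exists>b\<in>signed A. ([b, a], []) \<in> presentation_cong (signed A) R"
  proof (cases a)
    case (Inl x)
    then show ?thesis using a by (intro bexI[of _ "Inr x"] r) (auto simp: signed_def free_rels_def)
  next
    case (Inr x)
    then show ?thesis using a by (intro bexI[of _ "Inl x"] r) (auto simp: signed_def free_rels_def)
  qed
qed

context complement_table
begin

definition pos_rels :: "(('a + 'a) list \<times> ('a + 'a) list) set" where
  "pos_rels = (\<lambda>(u, v). (map Inl u, map Inl v)) ` rels"

abbreviation grels :: "(('a + 'a) list \<times> ('a + 'a) list) set" where
  "grels \<equiv> free_rels S \<union> pos_rels"

abbreviation gmon :: "('a + 'a) list set monoid" where
  "gmon \<equiv> monoid_presented_by (signed S) grels"

abbreviation gcl :: "('a + 'a) list \<Rightarrow> ('a + 'a) list set" where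
  "gcl \<equiv> pcl (signed S) grels"

lemma map_Inl_signed [simp]: "map Inl w \<in> lists (signed S) \<longleftrightarrow> w \<in> lists S"
  by (induction w) (auto simp: signed_def)

lemma map_Inr_signed [simp]: "map Inr w \<in> lists (signed S) \<longleftrightarrow> w \<in> lists S"
  by (induction w) (auto simp: signed_def)

lemma Inl_signed [simp]: "Inl x \<in> signed S \<longleftrightarrow> x \<in> S"
  by (auto simp: signed_def)

lemma Inr_signed [simp]: "Inr x \<in> signed S \<longleftrightarrow> x \<in> S"
  by (auto simp: signed_def)

lemma gmon_group: "group gmon"
  by (rule signed_group) simp

lemma grels_closed: "grels \<subseteq> lists (signed S) \<times> lists (signed S)"
proof -
  have "pos_rels \<subseteq> lists (signed S) \<times> lists (signed S)"
    using rels_closed unfolding pos_rels_def by fastforce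
  moreover have "free_rels S \<subseteq> lists (signed S) \<times> lists (signed S)"
    by (auto simp: free_rels_def)
  ultimately show ?thesis by simp
qed

lemma pcl_pos_rel:
  assumes "x \<in> S" "y \<in> S"
  shows "gcl [Inl x] \<otimes>\<^bsub>gmon\<^esub> gcl [Inl (x \<triangleright> y)]
    = gcl [Inl y] \<otimes>\<^bsub>gmon\<^esub> gcl [Inl (y \<triangleright> x)]"
proof -
  have "([x, x \<triangleright> y], [y, y \<triangleright> x]) \<in> rels" using assms by (auto simp: rels_def)
  then have "([Inl x, Inl (x \<triangleright> y)], [Inl y, Inl (y \<triangleright> x)]) \<in> grels"
    unfolding pos_rels_def by force
  then show ?thesis using assms by (simp add: pcl_mult pcl_eq_iff presentation_cong_relation)
qed

context
  fixes G :: "('g, 'm) monoid_scheme" (structure) and f :: "'a \<Rightarrow> 'g"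
  assumes G: "group G" and f: "f ` S \<subseteq> carrier G"
    and rel: "\<And>x y. \<lbrakk>x \<in> S; y \<in> S\<rbrakk> \<Longrightarrow> f x \<otimes> f (x \<triangleright> y) = f y \<otimes> f (y \<triangleright> x)"
begin

interpretation G: group G by (rule G)

lemma signed_map_closed: "signed_map G f ` signed S \<subseteq> carrier G"
  using f by (auto simp: signed_map_def signed_def)

lemma mprod_signed_map_Inl: "mprod G (signed_map G f) (map Inl w) = mprod G f w"
  by (induction w) (auto simp: signed_map_def)

text \<open>A positive letter s to the right of a denominator v is moved across it by the lcm v p =
  s q, since v^-1 s = p q^-1. An inverse letter extends the denominator.\<close>

lemma mprod_signed_map_fraction:
  assumes "w \<in> lists (signed S)"
  shows "\<exists>u\<in>lists S. \<exists>v\<in>lists S. mprod G (signed_map G f) w = mprod G f u \<otimes> inv (mprod G f v)"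
  using assms
proof (induction w rule: rev_induct)
  case Nil then show ?case by (intro bexI[of _ "[]"]) auto
next
  case (snoc a w)
  then have a: "a \<in> signed S" and w: "w \<in> lists (signed S)" by auto
  obtain u v where uv: "u \<in> lists S" "v \<in> lists S" "mprod G (signed_map G f) w = mprod G f u \<otimes> inv (mprod G f v)"
    using snoc by auto
  have pc: "mprod G f x \<in> carrier G" if "x \<in> lists S" for x by (rule G.mprod_closed[OF f that])
  have E: "mprod G (signed_map G f) (w @ [a]) = mprod G f u \<otimes> inv (mprod G f v) \<otimes> signed_map G f a"
    using G.mprod_append[OF signed_map_closed w, of "[a]"] a uv(3) signed_map_closed by auto
  show ?case
  proof (cases a)
    case (Inl s)
    then have s: "s \<in> S" using a by simp
    define p where "p = mprod G f (cw v [s])"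
    define q where "q = mprod G f (cw [s] v)"
    have pq: "p \<in> carrier G" "q \<in> carrier G" using pc uv s by (simp_all add: p_def q_def del: fold_simps)
    have fs: "f s \<in> carrier G" using f s by auto
    have L: "mprod G f v \<otimes> p = f s \<otimes> q"
      using mprod_lcm[OF G.monoid_axioms f rel uv(2), of "[s]"] s fs by (simp add: p_def q_def del: fold_simps)
    have "inv (mprod G f v) \<otimes> f s = p \<otimes> inv q"
    proof -
      have "f s = mprod G f v \<otimes> p \<otimes> inv q" using L pq fs by (simp add: G.m_assoc)
      then show ?thesis using pc[OF uv(2)] pq by (simp add: G.m_assoc G.inv_solve_left')
    qed
    then have "mprod G (signed_map G f) (w @ [a]) = mprod G f u \<otimes> (p \<otimes> inv q)"
      using E Inl pc uv fs by (simp add: signed_map_def G.m_assoc)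
    also have "\<dots> = mprod G f (u @ cw v [s]) \<otimes> inv q"
      using G.mprod_append[OF f uv(1), of "cw v [s]"] pc uv pq s
      by (simp add: p_def G.m_assoc del: fold_simps map_append foldr_append)
    finally have "mprod G (signed_map G f) (w @ [a]) = mprod G f (u @ cw v [s]) \<otimes> inv (mprod G f (cw [s] v))"
      by (simp add: q_def)
    moreover have "u @ cw v [s] \<in> lists S" "cw [s] v \<in> lists S" using uv s cw_closed[of v "[s]"] by simp_all
    ultimately show ?thesis by blast
  next
    case (Inr s)
    then have s: "s \<in> S" using a by simp
    have fs: "f s \<in> carrier G" using f s by auto
    have "mprod G (signed_map G f) (w @ [a]) = mprod G f u \<otimes> inv (mprod G f (s # v))"
      using E Inr pc uv fs by (simp add: signed_map_def G.m_assoc G.inv_mult_group)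
    moreover have "s # v \<in> lists S" using s uv by simp
    ultimately show ?thesis using uv(1) by blast
  qed
qed

end

end

section \<open>The action on left fractions and the embedding of the monoid\<close>

context garside_table
begin

text \<open>The pair \<open>(k, w)\<close> stands for the left fraction \<open>d\<^sup>-\<^sup>k w\<close>, on which the signed letters act
  by right multiplication; \<open>s\<inverse> = st s d\<inverse>\<close> and \<open>d\<inverse>\<close> is moved to the left by means of \<open>ps\<close>.\<close>

fun act :: "nat \<times> 'a list \<Rightarrow> 'a + 'a \<Rightarrow> nat \<times> 'a list" where
  "act (k, w) (Inl s) = (k, w @ [s])"
| "act (k, w) (Inr s) = (Suc k, map ps (w @ [st s]))"

text \<open>The equation d^-k u = d^-l v with denominators cleared, which is possible because powers
  of \<open>d\<close> commute.\<close>

definition frac_eq :: "nat \<times> 'a list \<Rightarrow> nat \<times> 'a list \<Rightarrow> bool" where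
  "frac_eq p q \<longleftrightarrow> snd p \<in> lists S \<and> snd q \<in> lists S \<and>
     sim (replicate (fst q) d @ snd p) (replicate (fst p) d @ snd q)"

lemma replicate_d [simp]: "replicate k d \<in> lists S"
  by auto

lemma frac_eq_refl: "snd p \<in> lists S \<Longrightarrow> frac_eq p p"
  by (simp add: frac_eq_def)

lemma frac_eq_sym: "frac_eq p q \<Longrightarrow> frac_eq q p"
  by (simp add: frac_eq_def sim_sym)

lemma replicate_commute_append: "replicate k d @ replicate l d @ w = replicate l d @ replicate k d @ w"
  by (metis append_assoc replicate_add add.commute)

lemma frac_eq_trans:
  assumes "frac_eq p q" "frac_eq q r"
  shows "frac_eq p r"
proof -
  obtain k u l v m w where pqr: "p = (k, u)" "q = (l, v)" "r = (m, w)" by (metis prod.exhaust)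
  let ?D = "\<lambda>n. replicate n d"
  have uvw: "u \<in> lists S" "v \<in> lists S" "w \<in> lists S"
    and 1: "sim (?D l @ u) (?D k @ v)" and 2: "sim (?D m @ v) (?D l @ w)"
    using assms by (simp_all add: frac_eq_def pqr)
  have "sim (?D m @ ?D l @ u) (?D m @ ?D k @ v)" using 1 uvw by (simp add: sim_left_cancel)
  moreover have "sim (?D k @ ?D m @ v) (?D k @ ?D l @ w)" using 2 uvw by (simp add: sim_left_cancel)
  ultimately have "sim (?D l @ ?D m @ u) (?D l @ ?D k @ w)"
    using sim_trans[of "?D l @ ?D m @ u" "?D k @ ?D m @ v" "?D l @ ?D k @ w"] uvw
      replicate_commute_append[of l m u] replicate_commute_append[of k m v] replicate_commute_append[of k l w]
    by (metis append_in_lists_conv replicate_d)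
  then have "sim (?D m @ u) (?D k @ w)" using uvw by (simp add: sim_left_cancel)
  then show ?thesis using uvw by (simp add: frac_eq_def pqr)
qed

lemma ps_d [simp]: "ps d = d"
  using ps_ph[of d] by (simp add: ph_def st_def)

text \<open>For an inverse letter, \<open>ps\<close> is applied to the cleared equation; it respects
  \<open>sim\<close> and fixes \<open>d\<close>.\<close>

lemma frac_eq_act:
  assumes "frac_eq p q" "a \<in> signed S"
  shows "frac_eq (act p a) (act q a)"
proof -
  obtain k u l v where pq: "p = (k, u)" "q = (l, v)" by (metis prod.exhaust)
  let ?D = "\<lambda>n. replicate n d"
  have uv: "u \<in> lists S" "v \<in> lists S" and s: "sim (?D l @ u) (?D k @ v)"
    using assms(1) by (simp_all add: frac_eq_def pq)
  show ?thesis
  proof (cases a)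
    case (Inl x)
    then have "x \<in> S" using assms(2) by simp
    then show ?thesis
      using sim_append_right[of "?D l @ u" "?D k @ v" "[x]"] s uv Inl by (simp add: pq frac_eq_def)
  next
    case (Inr x)
    then have x: "st x \<in> S" using assms(2) by simp
    have "sim (map ps (?D l @ u @ [st x])) (map ps (?D k @ v @ [st x]))"
      using sim_append_right[of "?D l @ u" "?D k @ v" "[st x]"] s uv x by (intro sim_map_ps) simp_all
    then have "sim ([d] @ ?D l @ map ps (u @ [st x])) ([d] @ ?D k @ map ps (v @ [st x]))"
      using uv x map_ps_closed[of "u @ [st x]"] map_ps_closed[of "v @ [st x]"]
      by (subst sim_left_cancel) simp_all
    then show ?thesis
      using uv x Inr map_ps_closed[of "u @ [st x]"] map_ps_closed[of "v @ [st x]"]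
      by (simp add: pq frac_eq_def)
  qed
qed

lemma frac_eq_foldl:
  "\<lbrakk>frac_eq p q; z \<in> lists (signed S)\<rbrakk> \<Longrightarrow> frac_eq (foldl act p z) (foldl act q z)"
  by (induction z arbitrary: p q) (simp_all add: frac_eq_act)

lemma frac_eq_relation:
  assumes "(l, r) \<in> grels" "snd p \<in> lists S"
  shows "frac_eq (foldl act p l) (foldl act p r)"
proof -
  obtain k w where p: "p = (k, w)" by (metis prod.exhaust)
  have w: "w \<in> lists S" using assms(2) p by simp
  let ?D = "replicate k d"
  have mw: "map ps w \<in> lists S" using w by simp
  have wd: "sim (map ps w @ [d]) (d # w)" using sim_d_word[OF mw] w by (simp del: map_map)
  \<comment> \<open>Acting by an inverse letter raises the exponent of the denominator by one. The
    new pair is the old fraction again once its word equals ps(w) d, which is d w.\<close>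
  have left_form: "frac_eq (Suc k, z) (k, w)" if z: "z \<in> lists S" "sim z (map ps w @ [d])" for z
  proof -
    have "sim z (d # w)" using sim_trans[OF _ _ _ z(2) wd] z w mw by simp
    then have "sim (?D @ z) (?D @ d # w)" using z w by (simp add: sim_left_cancel)
    then show ?thesis using z w by (simp add: frac_eq_def replicate_app_Cons_same)
  qed
  consider (fr) a where "a \<in> S" "l = [Inl a, Inr a]" "r = []"
    | (fl) a where "a \<in> S" "l = [Inr a, Inl a]" "r = []"
    | (e) "l = [Inl e]" "r = []"
    | (rel) x y where "x \<in> S" "y \<in> S" "l = [Inl x, Inl (x \<triangleright> y)]" "r = [Inl y, Inl (y \<triangleright> x)]"
    using assms(1) by (auto simp: free_rels_def pos_rels_def rels_def)
  then show ?thesis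
  proof cases
    case fr
    have "sim (w @ [a, st a]) (w @ [d])" using sim_st[of a] fr w by (simp add: sim_left_cancel)
    then have "sim (map ps (w @ [a, st a])) (map ps (w @ [d]))" using w fr by (intro sim_map_ps) simp_all
    then show ?thesis using left_form[of "map ps (w @ [a, st a])"] fr w mw by (simp add: p)
  next
    case fl
    \<comment> \<open>The letter whose product with a is \<open>d\<close>: st(st ?t) = st a, and
      \<open>st\<close> is injective.\<close>
    let ?t = "ps (st a)"
    have "st (st ?t) = st a" using ph_ps[of "st a"] fl by (simp add: ph_def)
    then have "st ?t = a" using bij_st fl by (auto simp: bij_betw_def inj_on_def)
    then have "sim [?t, a] [d]" using sim_st[of ?t] fl by simp
    then have "sim (map ps w @ [?t, a]) (map ps w @ [d])" using fl mw by (simp add: sim_left_cancel)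
    then show ?thesis using left_form[of "map ps w @ [?t, a]"] fl w mw by (simp add: p)
  next
    case e
    have "sim (w @ [e]) w" using sim_append_triv[of w "[e]"] w by simp
    then show ?thesis using e w by (simp add: p frac_eq_def sim_left_cancel)
  next
    case rel
    have "sim [x, x \<triangleright> y] [y, y \<triangleright> x]" using sim_lcm[of "[x]" "[y]"] rel by simp
    then show ?thesis using rel w by (simp add: p frac_eq_def sim_left_cancel)
  qed
qed

lemma frac_eq_presentation_cong:
  "\<lbrakk>(u, v) \<in> presentation_cong (signed S) grels; frac_eq p q\<rbrakk>
    \<Longrightarrow> frac_eq (foldl act p u) (foldl act q v)"
proof (induction arbitrary: p q rule: presentation_cong.induct)
  case (base u v x y)
  have "frac_eq (foldl act p x) (foldl act q x)" using base by (simp add: frac_eq_foldl)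
  then have "snd (foldl act p x) \<in> lists S" "frac_eq (foldl act (foldl act p x) v) (foldl act (foldl act q x) v)"
    using base(3) by (simp_all add: frac_eq_def[of "foldl act p x" "foldl act q x"] frac_eq_foldl)
  then have "frac_eq (foldl act (foldl act p x) u) (foldl act (foldl act q x) v)"
    using frac_eq_relation[OF base(1)] frac_eq_trans by blast
  then show ?case using base(5) by (simp add: frac_eq_foldl)
next
  case (refl w) then show ?case by (simp add: frac_eq_foldl)
next
  case (sym u v) then show ?case using frac_eq_sym by blast
next
  case (trans u v w)
  have "frac_eq q q" using trans.prems by (simp add: frac_eq_def)
  then show ?case using trans.IH(1)[OF trans.prems] trans.IH(2)[of q q] frac_eq_trans by blast
qed

text \<open>Acting on the fraction 1, the pair \<open>(0, [])\<close>, a positive word returns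
  itself with exponent 0. So congruent positive words are equal as fractions, that is, related by
  \<open>sim\<close>.\<close>

lemma positive_embeds:
  assumes "u \<in> lists S" "v \<in> lists S"
  shows "(map Inl u, map Inl v) \<in> presentation_cong (signed S) grels \<longleftrightarrow> sim u v"
proof
  assume "(map Inl u, map Inl v) \<in> presentation_cong (signed S) grels"
  then have "frac_eq (foldl act (0, []) (map Inl u)) (foldl act (0, []) (map Inl v))"
    by (rule frac_eq_presentation_cong) (simp add: frac_eq_refl)
  moreover have "foldl act (k, z) (map Inl w) = (k, z @ w)" for k z w
    by (induction w arbitrary: z) auto
  ultimately show "sim u v" by (simp add: frac_eq_def)
next
  assume s: "sim u v"
  let ?f = "\<lambda>x. gcl [Inl x]"
  have "([Inl e], []) \<in> grels" unfolding pos_rels_def rels_def by force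
  then have e: "?f e = \<one>\<^bsub>gmon\<^esub>" by (simp add: one_presented pcl_eq_iff presentation_cong_relation)
  have "mprod gmon ?f u = mprod gmon ?f v"
    using assms s by (intro mprod_sim monoid_presented pcl_pos_rel e) auto
  moreover have "mprod gmon ?f w = gcl (map Inl w)" if "w \<in> lists S" for w
    using mprod_pcl[of "map Inl w" "signed S" grels] that by (simp add: comp_def)
  ultimately show "(map Inl u, map Inl v) \<in> presentation_cong (signed S) grels"
    using assms by (simp add: pcl_eq_iff)
qed

end

section \<open>Garside monoids and groups characterised by tables\<close>

lemma garside_monoid_iff_table:
  fixes M :: "'b monoid"
  assumes "monoid M"
  shows "garside_monoid M \<longleftrightarrow> (\<exists>(m::nat) cm e d. garside_table {..<m} cm e d \<and>
    monoid_presented_by {..<m} (complement_table.rels {..<m} cm e) \<cong> M)"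
proof
  assume "garside_monoid M"
  then obtain m :: nat and cm e d f where T: "garside_table {..<m} cm e d" "table_of {..<m} cm e M f"
    by (rule garside_monoid_imp_table)
  interpret garside_table "{..<m}" cm e d by (rule T(1))
  show "\<exists>(m::nat) cm e d. garside_table {..<m} cm e d \<and>
    monoid_presented_by {..<m} (complement_table.rels {..<m} cm e) \<cong> M"
    using T(1) table_of_imp_iso[OF assms T(2)] by blast
next
  assume "\<exists>(m::nat) cm e d. garside_table {..<m} cm e d \<and>
    monoid_presented_by {..<m} (complement_table.rels {..<m} cm e) \<cong> M"
  then show "garside_monoid M"
    by (elim exE conjE) (rule garside_table.garside_monoid_iso_table[OF _ assms])
qed

lemma (in complement_table) signed_map_pcl:
  assumes "w \<in> lists (signed S)"
  shows "mprod gmon (signed_map gmon (\<lambda>x. gcl [Inl x])) w = gcl w"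
proof -
  interpret GT: group gmon by (rule gmon_group)
  have "signed_map gmon (\<lambda>x. gcl [Inl x]) a = gcl [a]" if a: "a \<in> signed S" for a
  proof (cases a)
    case (Inl x) then show ?thesis by (simp add: signed_map_def)
  next
    case (Inr x)
    then have x: "x \<in> S" using a by simp
    have "([Inl x, Inr x], []) \<in> grels" using x by (auto simp: free_rels_def)
    then have "gcl [Inl x] \<otimes>\<^bsub>gmon\<^esub> gcl [Inr x] = \<one>\<^bsub>gmon\<^esub>"
      using x by (simp add: pcl_mult one_presented pcl_eq_iff presentation_cong_relation)
    then have "inv\<^bsub>gmon\<^esub> (gcl [Inl x]) = gcl [Inr x]"
      using x by (intro GT.inv_equality[OF GT.inv_comm]) simp_all
    then show ?thesis by (simp add: Inr signed_map_def)
  qed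
  then have "map (signed_map gmon (\<lambda>x. gcl [Inl x])) w = map (\<lambda>a. gcl [a]) w"
    using assms by auto
  then show ?thesis using mprod_pcl[OF assms, of grels] by (simp only:)
qed

lemma (in garside_table) garside_group_iso_table:
  fixes G :: "'g monoid" (structure)
  assumes "group G" "gmon \<cong> G"
  shows "garside_group G"
proof -
  interpret G: group G by fact
  let ?c = "gcl"
  obtain h where h: "h \<in> iso gmon G" using assms(2) by (auto simp: is_iso_def)
  then have hom: "h \<in> hom gmon G" and surj: "h ` carrier gmon = carrier G"
    and inj: "inj_on h (carrier gmon)" by (simp_all add: iso_iff)
  define f where "f = (\<lambda>s. h (?c [Inl s]))"
  have f: "f ` S \<subseteq> carrier G" using hom_in_carrier[OF hom] by (auto simp: f_def)
  have rel: "f x \<otimes> f (x \<triangleright> y) = f y \<otimes> f (y \<triangleright> x)" if "x \<in> S" "y \<in> S" for x y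
    using pcl_pos_rel[OF that] that hom_mult[OF hom, of "?c [Inl x]" "?c [Inl (x \<triangleright> y)]"]
      hom_mult[OF hom, of "?c [Inl y]" "?c [Inl (y \<triangleright> x)]"] by (simp add: f_def)
  have letters: "(\<lambda>x. ?c [Inl x]) ` S \<subseteq> carrier gmon" by auto
  have fw: "mprod G f w = h (?c (map Inl w))" if "w \<in> lists S" for w
  proof -
    have "mprod gmon (\<lambda>x. ?c [Inl x]) w = ?c (map Inl w)"
      using mprod_pcl[of "map Inl w" "signed S" grels] that by (simp add: comp_def)
    then show ?thesis
      using iso_mprod[OF monoid_presented G.monoid_axioms h letters that] by (simp add: f_def comp_def)
  qed
  have feq: "mprod G f u = mprod G f v \<longleftrightarrow> sim u v" if "u \<in> lists S" "v \<in> lists S" for u v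
    using fw that inj_on_eq_iff[OF inj, of "?c (map Inl u)" "?c (map Inl v)"]
    by (simp add: pcl_eq_iff positive_embeds)
  \<comment> \<open>The Garside monoid is the submonoid of G formed by the values of positive words.
    By \<open>feq\<close>, which rests on \<open>positive_embeds\<close>, it is the monoid of the
    table.\<close>
  define M where "M = \<lparr>carrier = mprod G f ` lists S, mult = (\<otimes>), one = \<one>\<rparr>"
  have M_simps: "carrier M = mprod G f ` lists S" "mult M = (\<otimes>)" "one M = \<one>"
    by (simp_all add: M_def)
  have pc: "mprod G f w \<in> carrier G" if "w \<in> lists S" for w by (rule G.mprod_closed[OF f that])
  have mult: "mprod G f u \<otimes> mprod G f v = mprod G f (u @ v)" if "u \<in> lists S" "v \<in> lists S" for u v
    using G.mprod_append[OF f that] by simp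
  have M_mult: "x \<otimes>\<^bsub>M\<^esub> y = x \<otimes> y" and M_one: "\<one>\<^bsub>M\<^esub> = \<one>" for x y by (simp_all add: M_simps)
  have Mcc: "x \<in> carrier G" if "x \<in> carrier M" for x using that pc by (auto simp: M_simps(1))
  have Mc: "\<exists>w\<in>lists S. x = mprod G f w" if "x \<in> carrier M" for x
    using that by (auto simp: M_simps)
  have "monoid M"
  proof (rule monoidI)
    fix x y assume x: "x \<in> carrier M" and y: "y \<in> carrier M"
    obtain u where u: "u \<in> lists S" "x = mprod G f u" using Mc[OF x] by blast
    obtain v where v: "v \<in> lists S" "y = mprod G f v" using Mc[OF y] by blast
    have "x \<otimes> y = mprod G f (u @ v)" unfolding u(2) v(2) by (rule mult[OF u(1) v(1)])
    moreover have "u @ v \<in> lists S" using u v by simp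
    ultimately show "x \<otimes>\<^bsub>M\<^esub> y \<in> carrier M" unfolding M_simps by blast
  next
    show "\<one>\<^bsub>M\<^esub> \<in> carrier M" by (auto simp: M_simps intro!: image_eqI[of _ _ "[]"])
  qed (simp_all add: Mcc M_mult M_one G.m_assoc)
  moreover have "f x \<in> carrier M" if "x \<in> S" for x
    using that f by (auto simp: M_simps intro!: image_eqI[of _ _ "[x]"])
  then have "f ` S \<subseteq> carrier M" by blast
  moreover have "mprod M f w = mprod G f w" for w by (simp add: M_simps)
  ultimately have gM: "garside_monoid M"
    using Mc feq by (intro garside_monoid_of_table[of M f]) simp_all
  have "\<exists>x\<in>carrier M. \<exists>y\<in>carrier M. g = x \<otimes> inv y" if g: "g \<in> carrier G" for g
  proof -
    obtain X where X: "X \<in> carrier gmon" "g = h X" using g surj by blast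
    obtain w where w: "w \<in> lists (signed S)" "X = ?c w" using X(1) by (rule carrier_presentedE)
    have "mprod G (signed_map G f) w = g"
    proof -
      interpret GT: group gmon by (rule gmon_group)
      interpret H: group_hom gmon G h by unfold_locales (rule hom)
      have "signed_map G f a = h (signed_map gmon (\<lambda>x. ?c [Inl x]) a)" if "a \<in> signed S" for a
        using that by (cases a) (auto simp: signed_map_def f_def H.hom_inv)
      then have "map (signed_map G f) w = map (h \<circ> signed_map gmon (\<lambda>x. ?c [Inl x])) w" using w(1) by auto
      then have "mprod G (signed_map G f) w = mprod G (h \<circ> signed_map gmon (\<lambda>x. ?c [Inl x])) w"
        by (simp only:)
      also have "\<dots> = h (mprod gmon (signed_map gmon (\<lambda>x. ?c [Inl x])) w)"
        by (rule iso_mprod[OF monoid_presented G.monoid_axioms h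
              signed_map_closed[OF gmon_group letters pcl_pos_rel] w(1), symmetric])
      finally show ?thesis using signed_map_pcl[OF w(1)] X(2) w(2) by simp
    qed
    then show ?thesis
      using mprod_signed_map_fraction[OF assms(1) f rel w(1)] unfolding M_simps by fast
  qed
  moreover have "id \<in> hom M G" by (simp add: hom_def Mcc M_mult)
  ultimately have "group_of_fractions G M"
    unfolding group_of_fractions_def using assms(1) by (intro conjI bexI[of _ id]) auto
  then show ?thesis unfolding garside_group_def using gM by blast
qed

text \<open>The map is onto because G consists of fractions of M. It is injective because the
  elements of the presented group are fractions too: one sent to 1 has numerator and denominator
  with the same value in M, and \<open>positive_embeds\<close> makes them equal.\<close>

lemma (in garside_table) group_of_fractions_iso_table:
  fixes G :: "'g monoid" (structure) and M :: "'b monoid"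
  assumes "group_of_fractions G M" "table_of S cm e M f" "monoid M"
  shows "gmon \<cong> G"
proof -
  obtain i where i: "i \<in> hom M G" "inj_on i (carrier M)" and G: "group G"
    and frac: "\<And>g. g \<in> carrier G \<Longrightarrow> \<exists>x\<in>carrier M. \<exists>y\<in>carrier M. g = i x \<otimes> inv (i y)"
    using assms(1) unfolding group_of_fractions_def by blast
  interpret G: group G by (rule G)
  interpret M: monoid M by fact
  have f: "f ` S \<subseteq> carrier M" and fe: "f e = \<one>\<^bsub>M\<^esub>"
    and rel: "\<And>x y. \<lbrakk>x \<in> S; y \<in> S\<rbrakk> \<Longrightarrow> f x \<otimes>\<^bsub>M\<^esub> f (x \<triangleright> y) = f y \<otimes>\<^bsub>M\<^esub> f (y \<triangleright> x)"
    and surj: "\<And>x. x \<in> carrier M \<Longrightarrow> \<exists>w\<in>lists S. x = mprod M f w"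
    and eq: "\<And>u v. \<lbrakk>u \<in> lists S; v \<in> lists S\<rbrakk> \<Longrightarrow> mprod M f u = mprod M f v \<longleftrightarrow> sim u v"
    using assms(2) by (simp_all add: table_of_def)
  have fc: "f x \<in> carrier M" if "x \<in> S" for x using f that by auto
  have ic: "i x \<in> carrier G" if "x \<in> carrier M" for x using hom_in_carrier[OF i(1) that] .
  have i1: "i \<one>\<^bsub>M\<^esub> = \<one>"
  proof -
    have "i \<one>\<^bsub>M\<^esub> \<otimes> i \<one>\<^bsub>M\<^esub> = i \<one>\<^bsub>M\<^esub> \<otimes> \<one>"
      using hom_mult[OF i(1), of "\<one>\<^bsub>M\<^esub>" "\<one>\<^bsub>M\<^esub>"] ic by simp
    then show ?thesis using ic G.l_cancel[of "i \<one>\<^bsub>M\<^esub>"] by blast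
  qed
  define g where "g x = i (f x)" for x
  have g: "g ` S \<subseteq> carrier G" using fc ic by (auto simp: g_def)
  have grel: "g x \<otimes> g (x \<triangleright> y) = g y \<otimes> g (y \<triangleright> x)" if "x \<in> S" "y \<in> S" for x y
    using rel[OF that] that fc hom_mult[OF i(1), of "f x" "f (x \<triangleright> y)"]
      hom_mult[OF i(1), of "f y" "f (y \<triangleright> x)"] by (simp add: g_def)
  have gw: "mprod G g w = i (mprod M f w)" if "w \<in> lists S" for w
    using that
  proof (induction w)
    case (Cons x w)
    then show ?case using fc M.mprod_closed[OF f] hom_mult[OF i(1), of "f x" "mprod M f w"] by (simp add: g_def)
  qed (simp add: i1)
  have geq: "mprod G g u = mprod G g v \<longleftrightarrow> sim u v" if "u \<in> lists S" "v \<in> lists S" for u v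
    using gw that eq inj_on_eq_iff[OF i(2), of "mprod M f u" "mprod M f v"] M.mprod_closed[OF f] by simp
  note sc = signed_map_closed[OF G g grel]
  have "mprod G (signed_map G g) u = mprod G (signed_map G g) v"
    if uv0: "(u, v) \<in> grels" "u \<in> lists (signed S)" "v \<in> lists (signed S)" for u v
  proof (cases "(u, v) \<in> free_rels S")
    case True
    then obtain a where a: "a \<in> S" "v = []" "u = [Inl a, Inr a] \<or> u = [Inr a, Inl a]"
      by (auto simp: free_rels_def)
    then have "g a \<in> carrier G" using g by auto
    then show ?thesis using a by (auto simp: signed_map_def)
  next
    case False
    then obtain u' v' where uv: "(u', v') \<in> rels" "u = map Inl u'" "v = map Inl v'"
      using uv0(1) by (auto simp: pos_rels_def)
    then have c: "u' \<in> lists S" "v' \<in> lists S" using rels_closed by auto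
    then have "mprod G g u' = mprod G g v'" using geq sim_rels[OF uv(1)] by simp
    then show ?thesis
      using mprod_signed_map_Inl[OF G g grel, of u'] mprod_signed_map_Inl[OF G g grel, of v'] uv
      by (simp del: map_map)
  qed
  then obtain h where h: "h \<in> hom gmon G"
    "\<And>w. w \<in> lists (signed S) \<Longrightarrow> h (gcl w) = mprod G (signed_map G g) w"
    using presented_hom[OF G.monoid_axioms sc, of grels] by blast
  interpret GT: group gmon by (rule gmon_group)
  interpret H: group_hom gmon G h by unfold_locales (rule h(1))
  have hpos: "h (gcl (map Inl u)) = mprod G g u" if "u \<in> lists S" for u
    using h(2)[of "map Inl u"] that mprod_signed_map_Inl[OF G g grel, of u] by (simp del: map_map)
  have posc: "gcl (map Inl u) \<in> carrier gmon" if "u \<in> lists S" for u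
    using that by simp
  let ?l = "\<lambda>x. gcl [Inl x]"
  have letters: "?l ` S \<subseteq> carrier gmon" by auto
  have lpos: "mprod gmon ?l u = gcl (map Inl u)" if "u \<in> lists S" for u
    using mprod_pcl[of "map Inl u" "signed S" grels] that by (simp add: comp_def)
  have "inj_on h (carrier gmon)"
    unfolding H.inj_on_one_iff
  proof (intro allI impI)
    fix X assume X: "X \<in> carrier gmon" "h X = \<one>"
    obtain w where w: "w \<in> lists (signed S)" "X = gcl w" using X(1) by (rule carrier_presentedE)
    obtain u v where uv: "u \<in> lists S" "v \<in> lists S"
      "X = mprod gmon ?l u \<otimes>\<^bsub>gmon\<^esub> inv\<^bsub>gmon\<^esub> (mprod gmon ?l v)"
      using mprod_signed_map_fraction[OF gmon_group letters pcl_pos_rel w(1)] signed_map_pcl[OF w(1)] w(2) by auto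
    let ?u = "gcl (map Inl u)" and ?v = "gcl (map Inl v)"
    have X': "X = ?u \<otimes>\<^bsub>gmon\<^esub> inv\<^bsub>gmon\<^esub> ?v" using uv lpos by simp
    then have "\<one> = h ?u \<otimes> inv (h ?v)" using X(2) posc uv by simp
    then have "h ?u = h ?v"
      using H.hom_closed[OF posc[OF uv(1)]] H.hom_closed[OF posc[OF uv(2)]]
      by (metis G.inv_closed G.inv_equality G.inv_inv)
    then have "sim u v" using hpos geq uv by simp
    then have "?u = ?v" using uv positive_embeds[OF uv(1,2)] by (simp add: pcl_eq_iff)
    then show "X = \<one>\<^bsub>gmon\<^esub>" using X' posc[OF uv(2)] by simp
  qed
  moreover have "carrier G \<subseteq> h ` carrier gmon"
  proof
    fix x assume "x \<in> carrier G"
    then obtain a b where ab: "a \<in> carrier M" "b \<in> carrier M" "x = i a \<otimes> inv (i b)"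
      using frac by blast
    obtain u where u: "u \<in> lists S" "a = mprod M f u" using surj[OF ab(1)] by blast
    obtain v where v: "v \<in> lists S" "b = mprod M f v" using surj[OF ab(2)] by blast
    let ?u = "gcl (map Inl u)" and ?v = "gcl (map Inl v)"
    have "x = h (?u \<otimes>\<^bsub>gmon\<^esub> inv\<^bsub>gmon\<^esub> ?v)"
      using ab(3) u v posc hpos gw by simp
    moreover have "?u \<otimes>\<^bsub>gmon\<^esub> inv\<^bsub>gmon\<^esub> ?v \<in> carrier gmon" using posc u v by simp
    ultimately show "x \<in> h ` carrier gmon" by blast
  qed
  ultimately have "h \<in> iso gmon G"
    using h(1) hom_carrier[OF h(1)] by (simp add: iso_iff subset_antisym)
  then show ?thesis by (rule is_isoI)
qed

lemma garside_group_iff_table: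
  fixes G :: "'b monoid"
  assumes "group G"
  shows "garside_group G \<longleftrightarrow> (\<exists>(m::nat) cm e d. garside_table {..<m} cm e d \<and>
    monoid_presented_by (signed {..<m})
      (free_rels {..<m} \<union> complement_table.pos_rels {..<m} cm e) \<cong> G)"
proof
  assume "garside_group G"
  then obtain M :: "'b monoid" where M: "garside_monoid M" "group_of_fractions G M"
    by (auto simp: garside_group_def)
  then obtain m :: nat and cm e d f where T: "garside_table {..<m} cm e d" "table_of {..<m} cm e M f"
    by (meson garside_monoid_imp_table)
  interpret garside_table "{..<m}" cm e d by (rule T(1))
  have "monoid M" using M(1) by (simp add: garside_monoid_def gaussian_monoid_def atomic_monoid_def)
  then show "\<exists>(m::nat) cm e d. garside_table {..<m} cm e d \<and>
    monoid_presented_by (signed {..<m})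
      (free_rels {..<m} \<union> complement_table.pos_rels {..<m} cm e) \<cong> G"
    using T(1) group_of_fractions_iso_table[OF M(2) T(2)] by blast
next
  assume "\<exists>(m::nat) cm e d. garside_table {..<m} cm e d \<and>
    monoid_presented_by (signed {..<m})
      (free_rels {..<m} \<union> complement_table.pos_rels {..<m} cm e) \<cong> G"
  then show "garside_group G"
    by (elim exE conjE) (rule garside_table.garside_group_iso_table[OF _ assms])
qed

section \<open>Computable functions\<close>

text \<open>The equivalence states existence and uniqueness of the value together, so determinism of
  \<open>evaluates\<close> is established along with each program.\<close>

definition computes :: "recf \<Rightarrow> nat \<Rightarrow> (nat list \<Rightarrow> nat) \<Rightarrow> bool" where
  "computes p k F \<longleftrightarrow> (\<forall>xs y. length xs = k \<longrightarrow> evaluates p xs y \<longleftrightarrow> y = F xs)"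

inductive_cases evaluates_ZeroE: "evaluates Zero xs y"
inductive_cases evaluates_SuccessorE: "evaluates Successor xs y"
inductive_cases evaluates_ProjE: "evaluates (Proj i) xs y"
inductive_cases evaluates_CompE: "evaluates (Comp f gs) xs y"
inductive_cases evaluates_PrimRec0E: "evaluates (PrimRec f g) (0 # xs) y"
inductive_cases evaluates_PrimRecSucE: "evaluates (PrimRec f g) (Suc n # xs) y"
inductive_cases evaluates_MuE: "evaluates (Mu f) xs y"

lemma computesD: "\<lbrakk>computes p k F; length xs = k\<rbrakk> \<Longrightarrow> evaluates p xs y \<longleftrightarrow> y = F xs"
  by (simp add: computes_def)

lemma computes_cong: "\<lbrakk>computes p k F; \<And>xs. length xs = k \<Longrightarrow> F xs = G xs\<rbrakk> \<Longrightarrow> computes p k G"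
  by (simp add: computes_def)

lemma computes_Zero: "computes Zero k (\<lambda>xs. 0)"
  by (auto simp: computes_def elim: evaluates_ZeroE intro: evaluates.intros)

lemma computes_Successor: "computes Successor 1 (\<lambda>xs. Suc (hd xs))"
  by (auto simp: computes_def length_Suc_conv elim: evaluates_SuccessorE intro: evaluates.intros)

lemma computes_Proj: "i < k \<Longrightarrow> computes (Proj i) k (\<lambda>xs. xs ! i)"
  by (auto simp: computes_def elim: evaluates_ProjE intro: evaluates.intros)

lemma computes_Comp:
  assumes f: "computes f (length gs) F" and gs: "list_all2 (\<lambda>g G. computes g k G) gs Gs"
  shows "computes (Comp f gs) k (\<lambda>xs. F (map (\<lambda>G. G xs) Gs))"
  unfolding computes_def
proof (intro allI impI)
  fix xs :: "nat list" and y assume k: "length xs = k"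
  have all2: "list_all2 (\<lambda>g y. evaluates g xs y) gs ys \<longleftrightarrow> ys = map (\<lambda>G. G xs) Gs" for ys
    using gs
  proof (induction gs Gs arbitrary: ys rule: list_all2_induct)
    case (Cons g gs G Gs)
    then show ?case using computesD[OF _ k] by (auto simp: list_all2_Cons1)
  qed auto
  have "evaluates (Comp f gs) xs y \<longleftrightarrow> (\<exists>ys. list_all2 (\<lambda>g y. evaluates g xs y) gs ys \<and> evaluates f ys y)"
    by (auto elim: evaluates_CompE intro: evaluates.intros)
  then show "evaluates (Comp f gs) xs y \<longleftrightarrow> y = F (map (\<lambda>G. G xs) Gs)"
    using computesD[OF f, of "map (\<lambda>G. G xs) Gs" y] list_all2_lengthD[OF gs] by (simp add: all2)
qed

lemma computes_Comp1:
  "\<lbrakk>computes f 1 F; computes g k G\<rbrakk> \<Longrightarrow> computes (Comp f [g]) k (\<lambda>xs. F [G xs])"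
  using computes_Comp[of f "[g]" F k "[G]"] by simp

lemma computes_Comp2:
  "\<lbrakk>computes f 2 F; computes g k G; computes h k H\<rbrakk>
    \<Longrightarrow> computes (Comp f [g, h]) k (\<lambda>xs. F [G xs, H xs])"
  using computes_Comp[of f "[g, h]" F k "[G, H]"] by (simp add: numeral_2_eq_2)

lemma computes_Comp2':
  "\<lbrakk>computes f (Suc 1) F; computes g k G; computes h k H\<rbrakk>
    \<Longrightarrow> computes (Comp f [g, h]) k (\<lambda>xs. F [G xs, H xs])"
  by (rule computes_Comp2) (simp_all add: numeral_2_eq_2)

lemma computes_PrimRec:
  assumes f: "computes f k F" and g: "computes g (Suc (Suc k)) G"
  shows "computes (PrimRec f g) (Suc k) (\<lambda>xs. rec_nat (F (tl xs)) (\<lambda>n r. G (n # r # tl xs)) (hd xs))"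
proof -
  have "evaluates (PrimRec f g) (n # xs) y \<longleftrightarrow> y = rec_nat (F xs) (\<lambda>n r. G (n # r # xs)) n"
    if k: "length xs = k" for n xs y
  proof (induction n arbitrary: y)
    case 0
    have "evaluates (PrimRec f g) (0 # xs) y \<longleftrightarrow> evaluates f xs y"
      by (auto elim: evaluates_PrimRec0E intro: evaluates.intros)
    then show ?case using computesD[OF f k] by simp
  next
    case (Suc n)
    have "evaluates (PrimRec f g) (Suc n # xs) y
        \<longleftrightarrow> (\<exists>r. evaluates (PrimRec f g) (n # xs) r \<and> evaluates g (n # r # xs) y)"
      by (auto elim: evaluates_PrimRecSucE intro: evaluates.intros)
    then show ?case using Suc computesD[OF g, of "n # _ # xs"] k by simp
  qed
  then show ?thesis by (auto simp: computes_def length_Suc_conv)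
qed

lemma evaluates_Mu_iff:
  assumes f: "computes f (Suc k) F" and k: "length xs = k"
  shows "evaluates (Mu f) xs n \<longleftrightarrow> F (n # xs) = 0 \<and> (\<forall>m<n. F (m # xs) > 0)"
proof -
  have "evaluates (Mu f) xs n \<longleftrightarrow> evaluates f (n # xs) 0 \<and> (\<forall>m<n. \<exists>y>0. evaluates f (m # xs) y)"
    by (auto elim: evaluates_MuE intro: evaluates.intros)
  then show ?thesis using computesD[OF f, of "_ # xs"] k by auto
qed

lemma computes_Mu:
  assumes "computes f (Suc k) F"
    and "\<And>xs. length xs = k \<Longrightarrow> F (G xs # xs) = 0 \<and> (\<forall>m<G xs. F (m # xs) > 0)"
  shows "computes (Mu f) k G"
  unfolding computes_def
proof (intro allI impI)
  fix xs :: "nat list" and y assume k: "length xs = k"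
  show "evaluates (Mu f) xs y \<longleftrightarrow> y = G xs"
    unfolding evaluates_Mu_iff[OF assms(1) k] using assms(2)[OF k]
    by (metis less_irrefl linorder_neqE_nat)
qed

section \<open>Programs for arithmetic and the pairing function\<close>

lemma ex_computes_add: "\<exists>p. computes p 2 (\<lambda>xs. xs ! 0 + xs ! 1)"
proof -
  have "computes (PrimRec (Proj 0) (Comp Successor [Proj 1])) (Suc 1)
      (\<lambda>xs. rec_nat (tl xs ! 0) (\<lambda>n r. Suc (hd [(n # r # tl xs) ! 1])) (hd xs))"
    by (intro computes_PrimRec computes_Proj computes_Comp1[OF computes_Successor]) simp_all
  moreover have "rec_nat b (\<lambda>n r. Suc r) a = a + b" for a b :: nat by (induction a) auto
  ultimately have "computes (PrimRec (Proj 0) (Comp Successor [Proj 1])) (Suc 1) (\<lambda>xs. xs ! 0 + xs ! 1)"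
    by (elim computes_cong) (auto simp: length_Suc_conv)
  then show ?thesis by (auto simp: numeral_2_eq_2)
qed

lemma ex_computes_pred: "\<exists>p. computes p 1 (\<lambda>xs. hd xs - 1)"
proof -
  have "computes (PrimRec Zero (Proj 0)) (Suc 0) (\<lambda>xs. rec_nat 0 (\<lambda>n r. (n # r # tl xs) ! 0) (hd xs))"
    by (intro computes_PrimRec computes_Proj computes_Zero) simp_all
  moreover have "rec_nat 0 (\<lambda>n r. n) a = a - 1" for a :: nat by (cases a) auto
  ultimately show ?thesis by auto
qed

text \<open>The subtrahend comes first because primitive recursion runs over the first
  argument.\<close>

lemma ex_computes_diff: "\<exists>p. computes p 2 (\<lambda>xs. xs ! 1 - xs ! 0)"
proof -
  obtain pr where pr: "computes pr 1 (\<lambda>xs. hd xs - 1)" using ex_computes_pred by blast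
  have "computes (PrimRec (Proj 0) (Comp pr [Proj 1])) (Suc 1)
      (\<lambda>xs. rec_nat (tl xs ! 0) (\<lambda>n r. hd [(n # r # tl xs) ! 1] - 1) (hd xs))"
    by (intro computes_PrimRec computes_Proj computes_Comp1[OF pr]) simp_all
  moreover have "rec_nat b (\<lambda>n r. r - 1) a = b - a" for a b :: nat by (induction a) auto
  ultimately have "computes (PrimRec (Proj 0) (Comp pr [Proj 1])) (Suc 1) (\<lambda>xs. xs ! 1 - xs ! 0)"
    by (elim computes_cong) (auto simp: length_Suc_conv)
  then show ?thesis by (auto simp: numeral_2_eq_2)
qed

lemma ex_computes_triangle: "\<exists>p. computes p 1 (\<lambda>xs. triangle (hd xs))"
proof -
  obtain ad where ad: "computes ad 2 (\<lambda>xs. xs ! 0 + xs ! 1)" using ex_computes_add by blast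
  have "computes (PrimRec Zero (Comp ad [Proj 1, Comp Successor [Proj 0]])) (Suc 0)
    (\<lambda>xs. rec_nat 0 (\<lambda>n r. [(n # r # tl xs) ! 1, Suc (hd [(n # r # tl xs) ! 0])] ! 0 +
       [(n # r # tl xs) ! 1, Suc (hd [(n # r # tl xs) ! 0])] ! 1) (hd xs))"
    by (intro computes_PrimRec computes_Proj computes_Zero computes_Comp2[OF ad]
        computes_Comp1[OF computes_Successor]) simp_all
  moreover have "rec_nat 0 (\<lambda>n r. r + Suc n) a = triangle a" for a :: nat by (induction a) auto
  ultimately show ?thesis by auto
qed

lemma ex_computes_pair: "\<exists>p. computes p 2 (\<lambda>xs. prod_encode (xs ! 0, xs ! 1))"
proof -
  obtain ad where ad: "computes ad 2 (\<lambda>xs. xs ! 0 + xs ! 1)" using ex_computes_add by blast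
  obtain tr where tr: "computes tr 1 (\<lambda>xs. triangle (hd xs))" using ex_computes_triangle by blast
  have "computes (Comp ad [Comp tr [ad], Proj 0]) 2
     (\<lambda>xs. [triangle (hd [xs ! 0 + xs ! 1]), xs ! 0] ! 0 + [triangle (hd [xs ! 0 + xs ! 1]), xs ! 0] ! 1)"
    by (intro computes_Comp2[OF ad] computes_Comp1[OF tr] ad computes_Proj) simp
  then show ?thesis by (auto simp: prod_encode_def)
qed

text \<open>\<open>s\<close> is the diagonal of the Cantor pairing on which z lies. As the least
  number with a decidable property it can be found by \<open>Mu\<close>.\<close>

lemma prod_decode_diagonal:
  fixes z :: nat
  defines "s \<equiv> LEAST s. z < triangle (Suc s)"
  shows "prod_decode z = (z - triangle s, s - (z - triangle s))"
    and "z < triangle (Suc s)" and "m < s \<Longrightarrow> triangle (Suc m) \<le> z"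
proof -
  have "z < triangle (Suc z)" by (induction z) auto
  then show 1: "z < triangle (Suc s)" unfolding s_def by (rule LeastI)
  show 2: "triangle (Suc m) \<le> z" if "m < s" for m
    using not_less_Least[of m "\<lambda>s. z < triangle (Suc s)"] that by (simp add: s_def)
  have "triangle s \<le> z"
    using 2[of "s - 1"] by (cases s) (simp_all del: triangle_Suc)
  then have "prod_encode (z - triangle s, s - (z - triangle s)) = z"
    using 1 by (simp add: prod_encode_def)
  then show "prod_decode z = (z - triangle s, s - (z - triangle s))"
    by (metis prod_encode_inverse)
qed

lemma ex_computes_decode:
  "\<exists>p. computes p 1 (\<lambda>xs. fst (prod_decode (hd xs)))"
  "\<exists>p. computes p 1 (\<lambda>xs. snd (prod_decode (hd xs)))"
proof -
  obtain sb where sb: "computes sb 2 (\<lambda>xs. xs ! 1 - xs ! 0)" using ex_computes_diff by blast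
  obtain tr where tr: "computes tr 1 (\<lambda>xs. triangle (hd xs))" using ex_computes_triangle by blast
  \<comment> \<open>On the arguments s, z this is Suc z - triangle (Suc s), which vanishes exactly
    when z < triangle (Suc s).\<close>
  let ?t = "Comp sb [Comp tr [Comp Successor [Proj 0]], Comp Successor [Proj 1]]"
  have "computes ?t (Suc 1) (\<lambda>xs. [triangle (hd [Suc (hd [xs ! 0])]), Suc (hd [xs ! 1])] ! 1
      - [triangle (hd [Suc (hd [xs ! 0])]), Suc (hd [xs ! 1])] ! 0)"
    by (intro computes_Comp2[OF sb] computes_Comp1[OF tr] computes_Comp1[OF computes_Successor] computes_Proj)
      simp_all
  then have t: "computes ?t (Suc 1) (\<lambda>xs. Suc (xs ! 1) - triangle (Suc (xs ! 0)))"
    by (simp del: triangle_Suc)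
  have s: "computes (Mu ?t) 1 (\<lambda>xs. LEAST s. hd xs < triangle (Suc s))"
  proof (rule computes_Mu[OF t])
    fix xs :: "nat list" assume "length xs = 1"
    then obtain z where xs: "xs = [z]" by (auto simp: length_Suc_conv)
    show "Suc (((LEAST s. hd xs < triangle (Suc s)) # xs) ! 1)
        - triangle (Suc (((LEAST s. hd xs < triangle (Suc s)) # xs) ! 0)) = 0 \<and>
      (\<forall>m<LEAST s. hd xs < triangle (Suc s). 0 < Suc ((m # xs) ! 1) - triangle (Suc ((m # xs) ! 0)))"
      using prod_decode_diagonal(2)[of z] prod_decode_diagonal(3)[of _ z] by (simp add: xs Suc_le_eq less_Suc_eq_le del: triangle_Suc)
  qed
  let ?m = "Comp sb [Comp tr [Mu ?t], Proj 0]"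
  let ?s = "\<lambda>xs. LEAST s. hd xs < triangle (Suc s)"
  have "computes ?m 1 (\<lambda>xs. [triangle (hd [?s xs]), xs ! 0] ! 1 - [triangle (hd [?s xs]), xs ! 0] ! 0)"
    by (intro computes_Comp2[OF sb] computes_Comp1[OF tr] s computes_Proj) simp
  then have m: "computes ?m 1 (\<lambda>xs. fst (prod_decode (hd xs)))"
    by (rule computes_cong) (auto simp: prod_decode_diagonal(1) length_Suc_conv simp del: triangle_Suc)
  then show "\<exists>p. computes p 1 (\<lambda>xs. fst (prod_decode (hd xs)))" by blast
  have "computes (Comp sb [?m, Mu ?t]) 1
      (\<lambda>xs. [fst (prod_decode (hd xs)), ?s xs] ! 1 - [fst (prod_decode (hd xs)), ?s xs] ! 0)"
    by (intro computes_Comp2[OF sb] m s)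
  then have "computes (Comp sb [?m, Mu ?t]) 1 (\<lambda>xs. snd (prod_decode (hd xs)))"
    by (rule computes_cong) (auto simp: prod_decode_diagonal(1) length_Suc_conv simp del: triangle_Suc)
  then show "\<exists>p. computes p 1 (\<lambda>xs. snd (prod_decode (hd xs)))" by blast
qed

subsection \<open>Typed computability\<close>

text \<open>A bijection instead of an injection: every number decodes to a value, so programs need
  no test whether their input is a code.\<close>

class coded =
  fixes enc :: "'a \<Rightarrow> nat"
  assumes bij_enc: "bij enc"

definition dec :: "nat \<Rightarrow> 'a::coded" where
  "dec = inv_into UNIV enc"

lemma dec_enc [simp]: "dec (enc x) = x"
  unfolding dec_def by (rule inv_f_f[OF bij_is_inj[OF bij_enc]])

lemma enc_dec [simp]: "enc (dec n) = n"
  unfolding dec_def by (rule surj_f_inv_f[OF bij_is_surj[OF bij_enc]])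

lemma enc_eq_iff [simp]: "enc x = enc y \<longleftrightarrow> x = y"
  by (metis dec_enc)

instantiation nat :: coded
begin
definition enc_nat :: "nat \<Rightarrow> nat" where "enc_nat n = n"
instance by standard (simp add: enc_nat_def[abs_def] bij_id[unfolded id_def])
end

instantiation prod :: (coded, coded) coded
begin
definition enc_prod :: "'a \<times> 'b \<Rightarrow> nat" where "enc_prod x = prod_encode (map_prod enc enc x)"
instance
proof
  have "bij (map_prod enc enc :: 'a \<times> 'b \<Rightarrow> _)"
    using bij_enc[where 'a = 'a] bij_enc[where 'a = 'b] by (simp add: bij_def map_prod_inj_on[of _ UNIV _ UNIV, simplified] map_prod_surj)
  then show "bij (enc :: 'a \<times> 'b \<Rightarrow> nat)"
    using bij_comp[OF _ bij_prod_encode] by (simp add: enc_prod_def[abs_def] comp_def)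
qed
end

instantiation sum :: (coded, coded) coded
begin
definition enc_sum :: "'a + 'b \<Rightarrow> nat" where "enc_sum x = sum_encode (map_sum enc enc x)"
instance
proof
  have "map_sum dec dec (map_sum enc enc x) = x" for x :: "'a + 'b" by (cases x) auto
  moreover have "map_sum enc enc (map_sum dec dec x :: 'a + 'b) = x" for x by (cases x) auto
  ultimately have "bij (map_sum enc enc :: 'a + 'b \<Rightarrow> _)"
    by (intro o_bij[of "map_sum dec dec"]) (auto simp: fun_eq_iff)
  then show "bij (enc :: 'a + 'b \<Rightarrow> nat)"
    using bij_comp[OF _ bij_sum_encode] by (simp add: enc_sum_def[abs_def] comp_def)
qed
end

instantiation list :: (coded) coded
begin
definition enc_list :: "'a list \<Rightarrow> nat" where "enc_list xs = list_encode (map enc xs)"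
instance
proof
  have "map dec (map enc xs) = xs" for xs :: "'a list" by (simp add: comp_def)
  moreover have "map enc (map dec xs :: 'a list) = xs" for xs by (simp add: comp_def)
  ultimately have "bij (map enc :: 'a list \<Rightarrow> _)"
    by (intro o_bij[of "map dec"]) (auto simp: fun_eq_iff)
  then show "bij (enc :: 'a list \<Rightarrow> nat)"
    using bij_comp[OF _ bij_list_encode] by (simp add: enc_list_def[abs_def] comp_def)
qed
end

text \<open>Several arguments are packed into one coded value, so programs of arity one suffice and
  closure rules can follow the structure of a term.\<close>

definition computable :: "('a::coded \<Rightarrow> 'b::coded) \<Rightarrow> bool" where
  "computable f \<longleftrightarrow> (\<exists>p. computes p 1 (\<lambda>xs. enc (f (dec (hd xs)))))"

named_theorems computable_intros

lemma computable_ident [computable_intros]: "computable (\<lambda>x. x)"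
proof -
  have "computes (Proj 0) 1 (\<lambda>xs. enc (dec (hd xs)))"
    by (rule computes_cong[OF computes_Proj]) (auto simp: length_Suc_conv)
  then show ?thesis unfolding computable_def by blast
qed

lemma computable_const [computable_intros]: "computable (\<lambda>x. c)"
proof -
  have "\<exists>p. computes p 1 (\<lambda>xs. n)" for n
  proof (induction n)
    case 0 then show ?case using computes_Zero by blast
  next
    case (Suc n)
    then show ?case using computes_Comp1[OF computes_Successor] by force
  qed
  then show ?thesis by (simp add: computable_def)
qed

lemma computable_Suc [computable_intros]: "computable f \<Longrightarrow> computable (\<lambda>x. Suc (f x))"
  unfolding computable_def using computes_Comp1[OF computes_Successor] by (force simp: enc_nat_def)

lemma computable_Pair [computable_intros]:
  "\<lbrakk>computable f; computable g\<rbrakk> \<Longrightarrow> computable (\<lambda>x. (f x, g x))"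
  unfolding computable_def using ex_computes_pair computes_Comp2
  by (fastforce simp: enc_prod_def)

lemma prod_decode_enc: "prod_decode (enc p) = (enc (fst p), enc (snd p))"
  by (cases p) (simp add: enc_prod_def)

lemma computable_fst [computable_intros]: "computable f \<Longrightarrow> computable (\<lambda>x. fst (f x))"
  unfolding computable_def using ex_computes_decode(1) computes_Comp1
  by (fastforce simp: prod_decode_enc)

lemma computable_snd [computable_intros]: "computable f \<Longrightarrow> computable (\<lambda>x. snd (f x))"
  unfolding computable_def using ex_computes_decode(2) computes_Comp1
  by (fastforce simp: prod_decode_enc)

lemma computable_enc [computable_intros]: "computable f \<Longrightarrow> computable (\<lambda>x. enc (f x))"
  by (simp add: computable_def enc_nat_def)

lemma computable_dec [computable_intros]: "computable f \<Longrightarrow> computable (\<lambda>x. dec (f x))"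
  by (simp add: computable_def enc_nat_def)

lemma computable_compose:
  assumes "computable f" "computable g"
  shows "computable (\<lambda>x. f (g x))"
proof -
  obtain p where p: "computes p 1 (\<lambda>xs. enc (f (dec (hd xs))))" using assms by (auto simp: computable_def)
  obtain q where q: "computes q 1 (\<lambda>xs. enc (g (dec (hd xs))))" using assms by (auto simp: computable_def)
  show ?thesis using computes_Comp1[OF p q] by (auto simp: computable_def)
qed

lemma computable_rec_nat [computable_intros]:
  fixes f :: "'a::coded \<Rightarrow> 'b::coded"
  assumes f: "computable f" and g: "computable (\<lambda>z. g (fst z) (fst (snd z)) (snd (snd z)))" and n: "computable n"
  shows "computable (\<lambda>x. rec_nat (f x) (\<lambda>k r. g x k r) (n x))"
proof -
  obtain pf where pf: "computes pf 1 (\<lambda>xs. enc (f (dec (hd xs))))" using f unfolding computable_def by blast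
  obtain pg where pg: "computes pg 1 (\<lambda>xs. enc ((\<lambda>z. g (fst z) (fst (snd z)) (snd (snd z))) (dec (hd xs))))"
    using g unfolding computable_def by blast
  obtain pn where pn: "computes pn 1 (\<lambda>xs. enc (n (dec (hd xs))))" using n unfolding computable_def by blast
  obtain pr where pr: "computes pr 2 (\<lambda>xs. prod_encode (xs ! 0, xs ! 1))" using ex_computes_pair by blast
  \<comment> \<open>Primitive recursion passes counter, intermediate result and parameter as three
    arguments; \<open>?q\<close> repacks them as the coded triple of parameter, counter and
    result.\<close>
  let ?q = "Comp pg [Comp pr [Proj 2, Comp pr [Proj 0, Proj 1]]]"
  let ?G = "\<lambda>xs. enc (g (dec (xs ! 2)) (xs ! 0) (dec (xs ! 1)))"
  have "computes ?q (Suc (Suc 1)) (\<lambda>xs. (\<lambda>xs. enc ((\<lambda>z. g (fst z) (fst (snd z)) (snd (snd z))) (dec (hd xs))))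
      [(\<lambda>xs. prod_encode (xs ! 0, xs ! 1)) [xs ! 2, (\<lambda>xs. prod_encode (xs ! 0, xs ! 1)) [xs ! 0, xs ! 1]]])"
    by (intro computes_Comp1[OF pg] computes_Comp2[OF pr] computes_Proj) simp_all
  moreover have "dec (prod_encode (a, prod_encode (b, c))) = (dec a :: 'a, b, dec c :: 'b)" for a b c
  proof -
    have "prod_encode (a, prod_encode (b, c)) = enc (dec a :: 'a, b, dec c :: 'b)" by (simp add: enc_prod_def enc_nat_def)
    then show ?thesis by (simp only: dec_enc)
  qed
  ultimately have q: "computes ?q (Suc (Suc 1)) ?G" by simp
  have r: "rec_nat (enc (f x)) (\<lambda>k r. enc (g x k (dec r))) m = enc (rec_nat (f x) (g x) m)" for x m
    by (induction m) auto
  have P: "computes (PrimRec pf ?q) (Suc 1) (\<lambda>xs. rec_nat (enc (f (dec (hd (tl xs)))))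
      (\<lambda>n r. ?G (n # r # tl xs)) (hd xs))"
    by (rule computes_PrimRec[OF pf q])
  have "computes (Comp (PrimRec pf ?q) [pn, Proj 0]) 1
     (\<lambda>xs. (\<lambda>xs. rec_nat (enc (f (dec (hd (tl xs))))) (\<lambda>n r. ?G (n # r # tl xs)) (hd xs)) [enc (n (dec (hd xs))), xs ! 0])"
    by (intro computes_Comp2'[OF P] pn computes_Proj) simp
  then have "computes (Comp (PrimRec pf ?q) [pn, Proj 0]) 1
     (\<lambda>xs. enc (rec_nat (f (dec (hd xs))) (g (dec (hd xs))) (n (dec (hd xs)))))"
    by (rule computes_cong) (auto simp: length_Suc_conv r enc_nat_def)
  then show ?thesis unfolding computable_def by blast
qed

lemma computable_pred [computable_intros]: "computable f \<Longrightarrow> computable (\<lambda>x. f x - Suc 0)"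
proof -
  assume "computable f"
  then have "computable (\<lambda>x. rec_nat 0 (\<lambda>k r. k) (f x))" by (intro computable_intros)
  moreover have "rec_nat 0 (\<lambda>k r. k) n = n - Suc 0" for n :: nat by (cases n) auto
  ultimately show ?thesis by simp
qed

lemma computable_diff [computable_intros]:
  "\<lbrakk>computable f; computable g\<rbrakk> \<Longrightarrow> computable (\<lambda>x. f x - g x :: nat)"
proof -
  assume "computable f" "computable g"
  then have "computable (\<lambda>x. rec_nat (f x) (\<lambda>k r. r - Suc 0) (g x))" by (intro computable_intros)
  moreover have "rec_nat a (\<lambda>k r. r - Suc 0) n = a - n" for a n :: nat by (induction n) auto
  ultimately show ?thesis by simp
qed

lemma computable_if_zero:
  assumes "computable n" "computable f" "computable g"
  shows "computable (\<lambda>x. if n x = (0::nat) then f x else g x)"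
proof -
  have "computable (\<lambda>x. rec_nat (f x) (\<lambda>k r. g x) (n x))"
    using assms by (intro computable_intros computable_compose[of g fst])
  moreover have "rec_nat a (\<lambda>k r. b) n = (if n = 0 then a else b)" for a b :: 'b and n
    by (cases n) auto
  ultimately show ?thesis by simp
qed

text \<open>Truth is 0, as \<open>Mu\<close> searches for a zero.\<close>

definition decidable :: "('a::coded \<Rightarrow> bool) \<Rightarrow> bool" where
  "decidable P \<longleftrightarrow> computable (\<lambda>x. if P x then 0 else 1 :: nat)"

lemma computable_If [computable_intros]:
  assumes "decidable P" "computable f" "computable g"
  shows "computable (\<lambda>x. if P x then f x else g x)"
proof -
  have "(if (if P x then 0 else 1 :: nat) = 0 then f x else g x) = (if P x then f x else g x)" for x
    by simp
  then show ?thesis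
    using computable_if_zero[OF assms(1)[unfolded decidable_def] assms(2,3)] by (simp only:)
qed

lemma decidable_zero: "computable n \<Longrightarrow> decidable (\<lambda>x. n x = (0::nat))"
  unfolding decidable_def by (intro computable_if_zero computable_const)

lemma decidable_compose: "decidable P \<Longrightarrow> computable g \<Longrightarrow> decidable (\<lambda>x. P (g x))"
  unfolding decidable_def by (rule computable_compose)

text \<open>The rules for quantifiers and loops treat a binary predicate as one on pairs; this lemma
  substitutes computable functions for the two components.\<close>

lemma decidable2:
  assumes "decidable (\<lambda>z. Q (fst z) (snd z))" "computable f" "computable n"
  shows "decidable (\<lambda>z. Q (f z) (n z))"
  using decidable_compose[OF assms(1) computable_Pair[OF assms(2,3)]] by simp

lemma decidable_not [computable_intros]: "decidable P \<Longrightarrow> decidable (\<lambda>x. \<not> P x)"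
proof -
  assume "decidable P"
  then have "computable (\<lambda>x. if P x then 1 else 0 :: nat)" by (intro computable_intros)
  moreover have "(if P x then 1 else 0 :: nat) = (if \<not> P x then 0 else 1)" for x by simp
  ultimately show ?thesis unfolding decidable_def by (simp only:)
qed

lemma decidable_conj [computable_intros]:
  "\<lbrakk>decidable P; decidable Q\<rbrakk> \<Longrightarrow> decidable (\<lambda>x. P x \<and> Q x)"
proof -
  assume "decidable P" "decidable Q"
  then have "computable (\<lambda>x. if P x then (if Q x then 0 else 1) else 1 :: nat)" by (intro computable_intros)
  moreover have "(if P x then (if Q x then 0 else 1) else 1 :: nat) = (if P x \<and> Q x then 0 else 1)" for x by simp
  ultimately show ?thesis by (simp add: decidable_def)
qed

lemma decidable_disj [computable_intros]:
  "\<lbrakk>decidable P; decidable Q\<rbrakk> \<Longrightarrow> decidable (\<lambda>x. P x \<or> Q x)"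
  using decidable_not[OF decidable_conj[OF decidable_not[of P] decidable_not[of Q]]] by simp

lemma decidable_le [computable_intros]:
  "\<lbrakk>computable f; computable g\<rbrakk> \<Longrightarrow> decidable (\<lambda>x. f x \<le> (g x :: nat))"
  using decidable_zero[OF computable_diff] by simp

lemma decidable_less [computable_intros]:
  "\<lbrakk>computable f; computable g\<rbrakk> \<Longrightarrow> decidable (\<lambda>x. f x < (g x :: nat))"
  using decidable_le[OF computable_Suc] by (simp add: Suc_le_eq)

lemma decidable_eq [computable_intros]:
  assumes "computable f" "computable g"
  shows "decidable (\<lambda>x. f x = g x)"
proof -
  have "decidable (\<lambda>x. enc (f x) \<le> enc (g x) \<and> enc (g x) \<le> enc (f x))"
    using assms by (intro computable_intros)
  then show ?thesis by (simp add: eq_iff[symmetric])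
qed

lemma decidable_ex_less [computable_intros]:
  fixes P :: "'a::coded \<Rightarrow> nat \<Rightarrow> bool"
  assumes "decidable (\<lambda>z. P (fst z) (snd z))" "computable n"
  shows "decidable (\<lambda>x. \<exists>k<n x. P x k)"
proof -
  have "computable (\<lambda>x. rec_nat (1::nat) (\<lambda>k r. if P x k then 0 else r) (n x))"
    using assms(2) by (intro computable_intros decidable2[OF assms(1)])
  moreover have "rec_nat (1::nat) (\<lambda>k r. if P x k then 0 else r) n = (if \<exists>k<n. P x k then 0 else 1)" for x n
    by (induction n) (auto simp: less_Suc_eq)
  ultimately show ?thesis by (simp add: decidable_def)
qed

lemma decidable_all_less [computable_intros]:
  fixes P :: "'a::coded \<Rightarrow> nat \<Rightarrow> bool"
  assumes "decidable (\<lambda>z. P (fst z) (snd z))" "computable n"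
  shows "decidable (\<lambda>x. \<forall>k<n x. P x k)"
  using decidable_not[OF decidable_ex_less[OF decidable_not[OF assms(1)] assms(2)]] by simp

subsection \<open>Lists\<close>

lemma computable_Cons [computable_intros]:
  "\<lbrakk>computable f; computable g\<rbrakk> \<Longrightarrow> computable (\<lambda>x. f x # g x)"
proof -
  assume "computable f" "computable g"
  then have "computable (\<lambda>x. dec (Suc (enc (f x, g x))) :: 'b list)" by (intro computable_intros)
  moreover have "Suc (enc (a, w)) = enc (a # w)" for a :: 'b and w
    by (simp add: enc_list_def enc_prod_def)
  ultimately show ?thesis by simp
qed

text \<open>On the empty list \<open>uncons\<close> and \<open>total_nth\<close> return unspecified but fixed values.\<close>

definition uncons :: "'a::coded list \<Rightarrow> 'a \<times> 'a list" where
  "uncons xs = dec (enc xs - Suc 0)"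

lemma uncons_Cons [simp]: "uncons (x # xs) = (x, xs)"
proof -
  have "enc (x # xs) - Suc 0 = enc (x, xs)" by (simp add: enc_list_def enc_prod_def)
  then show ?thesis by (simp only: uncons_def dec_enc)
qed

lemma computable_uncons [computable_intros]: "computable f \<Longrightarrow> computable (\<lambda>x. uncons (f x))"
  unfolding uncons_def by (intro computable_intros)

text \<open>Lets a loop over a list run as many times as its code says, before the length is known
  to be computable.\<close>

lemma length_le_enc: "length xs \<le> enc xs"
proof (induction xs)
  case (Cons x xs)
  have "enc xs \<le> prod_encode (enc x, enc xs)" by (rule le_prod_encode_2)
  then show ?case using Cons by (simp add: enc_list_def)
qed simp

lemma computable_foldl [computable_intros]:
  assumes f: "computable (\<lambda>z. f (fst z) (fst (snd z)) (snd (snd z)))" and a: "computable a" and xs: "computable xs"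
  shows "computable (\<lambda>x. foldl (f x) (a x) (xs x))"
proof -
  \<comment> \<open>The state consists of the accumulator and the rest of the list. Once the rest is
    empty, the surplus rounds change nothing.\<close>
  let ?step = "\<lambda>x s. if snd s = [] then s else (f x (fst s) (fst (uncons (snd s))), snd (uncons (snd s)))"
  have f': "computable (\<lambda>z. f (fst z) (fst (snd (snd z))) (fst (uncons (snd (snd (snd z))))))"
    using computable_compose[OF f, of "\<lambda>z. (fst z, fst (snd (snd z)), fst (uncons (snd (snd (snd z)))))"]
    by (simp add: computable_intros)
  have "computable (\<lambda>x. fst (rec_nat (a x, xs x) (\<lambda>k. ?step x) (enc (xs x))))"
    using a xs by (intro computable_intros f')
  moreover have "rec_nat (b, w) (\<lambda>k. ?step x) n = (foldl (f x) b (take n w), drop n w)" for x b w n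
  proof (induction n)
    case (Suc n)
    show ?case
    proof (cases "n < length w")
      case True
      then have "drop n w = w ! n # drop (Suc n) w" by (simp add: Cons_nth_drop_Suc)
      then show ?thesis using Suc True by (simp add: take_Suc_conv_app_nth)
    next
      case False then show ?thesis using Suc by simp
    qed
  qed simp
  ultimately show ?thesis by (simp add: take_all[OF length_le_enc])
qed

lemma computable_rev [computable_intros]: "computable f \<Longrightarrow> computable (\<lambda>x. rev (f x))"
proof -
  assume "computable f"
  then have "computable (\<lambda>x. foldl (\<lambda>acc y. y # acc) [] (f x))" by (intro computable_intros)
  moreover have "foldl (\<lambda>acc y. y # acc) zs w = rev w @ zs" for w zs :: "'b list" by (induction w arbitrary: zs) auto
  ultimately show ?thesis by simp
qed

lemma computable_append [computable_intros]:
  "\<lbrakk>computable f; computable g\<rbrakk> \<Longrightarrow> computable (\<lambda>x. f x @ g x)"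
proof -
  assume "computable f" "computable g"
  then have "computable (\<lambda>x. foldl (\<lambda>acc y. y # acc) (g x) (rev (f x)))" by (intro computable_intros)
  moreover have "foldl (\<lambda>acc y. y # acc) zs w = rev w @ zs" for w zs :: "'b list" by (induction w arbitrary: zs) auto
  ultimately show ?thesis by simp
qed

lemma computable_length [computable_intros]: "computable f \<Longrightarrow> computable (\<lambda>x. length (f x))"
proof -
  assume "computable f"
  then have "computable (\<lambda>x. foldl (\<lambda>acc y. Suc acc) 0 (f x))" by (intro computable_intros)
  moreover have "foldl (\<lambda>acc y. Suc acc) n w = length w + n" for w :: "'b list" and n by (induction w arbitrary: n) auto
  ultimately show ?thesis by simp
qed

lemma foldl_append_concat: "foldl (\<lambda>acc y. acc @ f y) zs w = zs @ concat (map f w)"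
  by (induction w arbitrary: zs) auto

lemma computable_concat_map [computable_intros]:
  assumes f: "computable (\<lambda>z. f (fst z) (snd z))" and xs: "computable xs"
  shows "computable (\<lambda>x. concat (map (f x) (xs x)))"
proof -
  have f': "computable (\<lambda>z. f (fst z) (snd (snd z)))"
    using computable_compose[OF f, of "\<lambda>z. (fst z, snd (snd z))"] by (simp add: computable_intros)
  have "computable (\<lambda>x. foldl (\<lambda>acc y. acc @ f x y) [] (xs x))"
    using xs by (intro computable_intros f')
  then show ?thesis by (simp add: foldl_append_concat)
qed

lemma computable_map [computable_intros]:
  assumes f: "computable (\<lambda>z. f (fst z) (snd z))" and xs: "computable xs"
  shows "computable (\<lambda>x. map (f x) (xs x))"
proof -
  have "computable (\<lambda>x. concat (map (\<lambda>y. [f x y]) (xs x)))" using xs by (intro computable_intros f)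
  then show ?thesis by simp
qed

definition total_nth :: "'a::coded list \<Rightarrow> nat \<Rightarrow> 'a" where
  "total_nth xs n = fst (uncons (drop n xs))"

lemma total_nth_eq_nth [simp]: "n < length xs \<Longrightarrow> total_nth xs n = xs ! n"
  by (simp add: total_nth_def Cons_nth_drop_Suc[symmetric])

lemma computable_total_nth [computable_intros]:
  assumes f: "computable f" and n: "computable n"
  shows "computable (\<lambda>x. total_nth (f x) (n x))"
proof -
  have "computable (\<lambda>x. rec_nat (f x) (\<lambda>k r. if r = [] then [] else snd (uncons r)) (n x))"
    using f n by (intro computable_intros)
  moreover have "rec_nat w (\<lambda>k r. if r = [] then [] else snd (uncons r)) m = drop m w" for w :: "'b list" and m
  proof (induction m)
    case (Suc m)
    then show ?case
      by (cases "drop m w") (simp_all add: drop_Suc tl_drop[symmetric] drop_eq_Nil)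
  qed simp
  ultimately have "computable (\<lambda>x. drop (n x) (f x))" by simp
  then show ?thesis unfolding total_nth_def by (intro computable_intros)
qed

lemma decidable_ball_set [computable_intros]:
  assumes "decidable (\<lambda>z. P (fst z) (snd z))" "computable xs"
  shows "decidable (\<lambda>x. \<forall>y\<in>set (xs x). P x y)"
proof -
  have "decidable (\<lambda>z. P (fst z) (total_nth (xs (fst z)) (snd z)))"
    by (intro decidable2[OF assms(1)] computable_intros computable_compose[OF assms(2)])
  then have "decidable (\<lambda>x. \<forall>i<length (xs x). P x (total_nth (xs x) i))"
    using assms(2) by (intro computable_intros)
  moreover have "(\<forall>i<length w. P x (total_nth w i)) \<longleftrightarrow> (\<forall>y\<in>set w. P x y)" for x w
    by (simp add: all_set_conv_all_nth)
  ultimately show ?thesis by simp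
qed

lemma decidable_mem [computable_intros]:
  assumes "computable f" "computable xs"
  shows "decidable (\<lambda>x. f x \<in> set (xs x))"
proof -
  have "decidable (\<lambda>x. \<not> (\<forall>y\<in>set (xs x). f x \<noteq> y))"
    by (intro computable_intros computable_compose[OF assms(1)] assms(2))
  then show ?thesis by simp
qed

section \<open>Recursively enumerable predicates\<close>

definition re :: "('a::coded \<Rightarrow> bool) \<Rightarrow> bool" where
  "re P \<longleftrightarrow> (\<exists>Q. decidable (\<lambda>z. Q (fst z) (snd z)) \<and> (\<forall>x. P x \<longleftrightarrow> (\<exists>n::nat. Q x n)))"

named_theorems re_intros

lemma reE:
  assumes "re P"
  obtains Q where "decidable (\<lambda>z. Q (fst z) (snd z))" "\<And>x. P x \<longleftrightarrow> (\<exists>n::nat. Q x n)"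
  using assms unfolding re_def by blast

lemma reI:
  assumes "decidable (\<lambda>z. Q (fst z) (snd z))" "\<And>x. P x \<longleftrightarrow> (\<exists>n::nat. Q x n)"
  shows "re P"
  using assms unfolding re_def by blast

lemma re_decidable: "decidable P \<Longrightarrow> re P"
  by (rule reI[of "\<lambda>x n. P x", OF decidable_compose[OF _ computable_fst[OF computable_ident]]]) auto

lemma re_compose: "re P \<Longrightarrow> computable f \<Longrightarrow> re (\<lambda>x. P (f x))"
proof (erule reE)
  fix Q assume Q: "decidable (\<lambda>z. Q (fst z) (snd z))"
    "\<And>x. P x \<longleftrightarrow> (\<exists>n::nat. Q x n)" and f: "computable f"
  show "re (\<lambda>x. P (f x))"
  proof (rule reI)
    show "decidable (\<lambda>z. Q (f (fst z)) (snd z))"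
      by (intro decidable2[OF Q(1)] computable_compose[OF f] computable_intros)
  qed (rule Q(2))
qed

lemma re2:
  assumes "re (\<lambda>z. Q (fst z) (snd z))" "computable f" "computable n"
  shows "re (\<lambda>z. Q (f z) (n z))"
  using re_compose[OF assms(1) computable_Pair[OF assms(2,3)]] by simp

lemma re_conj [re_intros]: "\<lbrakk>re P; re P'\<rbrakk> \<Longrightarrow> re (\<lambda>x. P x \<and> P' x)"
proof (elim reE)
  fix Q Q' assume Q: "decidable (\<lambda>z. Q (fst z) (snd z))"
    "\<And>x. P x \<longleftrightarrow> (\<exists>n::nat. Q x n)"
    and Q': "decidable (\<lambda>z. Q' (fst z) (snd z))"
    "\<And>x. P' x \<longleftrightarrow> (\<exists>n::nat. Q' x n)"
  show "re (\<lambda>x. P x \<and> P' x)"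
  proof (rule reI)
    show "decidable (\<lambda>z. Q (fst z) (fst (dec (snd z) :: nat \<times> nat)) \<and> Q' (fst z) (snd (dec (snd z) :: nat \<times> nat)))"
      by (intro computable_intros decidable2[OF Q(1)] decidable2[OF Q'(1)])
    show "P x \<and> P' x \<longleftrightarrow> (\<exists>n. Q x (fst (dec n :: nat \<times> nat)) \<and> Q' x (snd (dec n :: nat \<times> nat)))" for x
    proof
      assume "P x \<and> P' x"
      then obtain m n where "Q x m" "Q' x n" unfolding Q(2) Q'(2) by blast
      then show "\<exists>n. Q x (fst (dec n :: nat \<times> nat)) \<and> Q' x (snd (dec n :: nat \<times> nat))"
        by (intro exI[of _ "enc (m, n)"]) simp
    qed (auto simp: Q(2) Q'(2))
  qed
qed

lemma re_disj [re_intros]: "\<lbrakk>re P; re P'\<rbrakk> \<Longrightarrow> re (\<lambda>x. P x \<or> P' x)"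
proof (elim reE)
  fix Q Q' assume Q: "decidable (\<lambda>z. Q (fst z) (snd z))"
    "\<And>x. P x \<longleftrightarrow> (\<exists>n::nat. Q x n)"
    and Q': "decidable (\<lambda>z. Q' (fst z) (snd z))"
    "\<And>x. P' x \<longleftrightarrow> (\<exists>n::nat. Q' x n)"
  show "re (\<lambda>x. P x \<or> P' x)"
  proof (rule reI)
    show "decidable (\<lambda>z. Q (fst z) (snd z) \<or> Q' (fst z) (snd z))"
      by (intro computable_intros Q Q')
    show "P x \<or> P' x \<longleftrightarrow> (\<exists>n. Q x n \<or> Q' x n)" for x
      unfolding Q(2) Q'(2) by blast
  qed
qed

lemma re_ex [re_intros]:
  fixes P :: "'a::coded \<Rightarrow> 'b::coded \<Rightarrow> bool"
  assumes "re (\<lambda>z. P (fst z) (snd z))"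
  shows "re (\<lambda>x. \<exists>y. P x y)"
  using assms
proof (rule reE)
  fix Q assume Q: "decidable (\<lambda>z. Q (fst z) (snd z))"
    "\<And>x. P (fst x) (snd x) \<longleftrightarrow> (\<exists>n::nat. Q x n)"
  show "re (\<lambda>x. \<exists>y. P x y)"
  proof (rule reI)
    show "decidable (\<lambda>z. Q (fst z, fst (dec (snd z) :: 'b \<times> nat)) (snd (dec (snd z) :: 'b \<times> nat)))"
      by (intro computable_intros decidable2[OF Q(1)])
    show "(\<exists>y. P x y) \<longleftrightarrow> (\<exists>n. Q (x, fst (dec n :: 'b \<times> nat)) (snd (dec n :: 'b \<times> nat)))" for x
    proof
      assume "\<exists>y. P x y"
      then obtain y n where "Q (x, y) n" using Q(2)[of "(x, _)"] by auto
      then show "\<exists>n. Q (x, fst (dec n :: 'b \<times> nat)) (snd (dec n :: 'b \<times> nat))"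
        by (intro exI[of _ "enc (y, n)"]) simp
    next
      assume "\<exists>n. Q (x, fst (dec n :: 'b \<times> nat)) (snd (dec n :: 'b \<times> nat))"
      then show "\<exists>y. P x y" using Q(2)[of "(x, _)"] by auto
    qed
  qed
qed

text \<open>The finitely many witnesses are replaced by one common bound N, and the search below N
  is decidable.\<close>

lemma re_all_less [re_intros]:
  fixes P :: "'a::coded \<Rightarrow> nat \<Rightarrow> bool"
  assumes "re (\<lambda>z. P (fst z) (snd z))" and n: "computable n"
  shows "re (\<lambda>x. \<forall>k<n x. P x k)"
  using assms(1)
proof (rule reE)
  fix Q assume Q: "decidable (\<lambda>z. Q (fst z) (snd z))"
    "\<And>x. P (fst x) (snd x) \<longleftrightarrow> (\<exists>n::nat. Q x n)"
  show "re (\<lambda>x. \<forall>k<n x. P x k)"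
  proof (rule reI)
    show "decidable (\<lambda>z. \<forall>k<n (fst z). \<exists>j<snd z. Q (fst z, k) j)"
      by (intro computable_intros decidable2[OF Q(1)] computable_compose[OF n])
    show "(\<forall>k<n x. P x k) \<longleftrightarrow> (\<exists>N. \<forall>k<n x. \<exists>j<N. Q (x, k) j)" for x
    proof
      assume "\<forall>k<n x. P x k"
      then have "\<forall>k<n x. \<exists>j. Q (x, k) j" using Q(2)[of "(x, _)"] by simp
      then obtain j where j: "\<And>k. k < n x \<Longrightarrow> Q (x, k) (j k)" by metis
      have "j k < Suc (Max (j ` {..<n x}))" if "k < n x" for k
        using that by (simp add: less_Suc_eq_le)
      then show "\<exists>N. \<forall>k<n x. \<exists>j<N. Q (x, k) j" using j by blast
    next
      assume "\<exists>N. \<forall>k<n x. \<exists>j<N. Q (x, k) j"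
      then show "\<forall>k<n x. P x k" using Q(2)[of "(x, _)"] by auto
    qed
  qed
qed

lemma re_ball_set [re_intros]:
  assumes "re (\<lambda>z. P (fst z) (snd z))" "computable xs"
  shows "re (\<lambda>x. \<forall>y\<in>set (xs x). P x y)"
proof -
  have "re (\<lambda>z. P (fst z) (total_nth (xs (fst z)) (snd z)))"
    by (intro re2[OF assms(1)] computable_intros computable_compose[OF assms(2)])
  then have "re (\<lambda>x. \<forall>i<length (xs x). P x (total_nth (xs x) i))"
    using assms(2) by (intro re_intros computable_intros)
  moreover have "(\<forall>i<length w. P x (total_nth w i)) \<longleftrightarrow> (\<forall>y\<in>set w. P x y)" for x w
    by (simp add: all_set_conv_all_nth)
  ultimately show ?thesis by simp
qed

text \<open>\<open>Mu\<close> searches for the least witness and halts exactly when there is one.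
  Because \<open>enc\<close> is onto, each input number is the code of some value.\<close>

lemma re_imp_recursively_enumerable:
  fixes P :: "'a::coded \<Rightarrow> bool"
  assumes "re P"
  shows "recursively_enumerable {enc x | x. P x}"
  using assms
proof (rule reE)
  fix Q assume Q: "decidable (\<lambda>z. Q (fst z) (snd z))"
    "\<And>x. P x \<longleftrightarrow> (\<exists>n::nat. Q x n)"
  obtain p where "computes p 1 (\<lambda>xs. enc ((\<lambda>z. if Q (fst z) (snd z) then 0 else 1 :: nat) (dec (hd xs))))"
    using Q(1) unfolding decidable_def computable_def by blast
  moreover obtain pr where pr: "computes pr 2 (\<lambda>xs. prod_encode (xs ! 0, xs ! 1))" using ex_computes_pair by blast
  ultimately have "computes (Comp p [Comp pr [Proj 1, Proj 0]]) (Suc 1)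
    (\<lambda>xs. (\<lambda>xs. enc ((\<lambda>z. if Q (fst z) (snd z) then 0 else 1 :: nat) (dec (hd xs))))
      [(\<lambda>xs. prod_encode (xs ! 0, xs ! 1)) [xs ! 1, xs ! 0]])"
    by (intro computes_Comp1 computes_Comp2 computes_Proj) simp_all
  moreover have "dec (prod_encode (a, b)) = (dec a :: 'a, b)" for a b
  proof -
    have "prod_encode (a, b) = enc (dec a :: 'a, b)" by (simp add: enc_prod_def enc_nat_def)
    then show ?thesis by (simp only: dec_enc)
  qed
  ultimately have c: "computes (Comp p [Comp pr [Proj 1, Proj 0]]) (Suc 1)
    (\<lambda>xs. if Q (dec (xs ! 1)) (xs ! 0) then 0 else 1)"
    by (simp add: enc_nat_def)
  let ?p = "Mu (Comp p [Comp pr [Proj 1, Proj 0]])"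
  have "evaluates ?p [z] n \<longleftrightarrow> Q (dec z) n \<and> (\<forall>m<n. \<not> Q (dec z) m)" for z n
    using evaluates_Mu_iff[OF c, of "[z]" n] by auto
  then have "(\<exists>n. evaluates ?p [z] n) \<longleftrightarrow> P (dec z)" for z
    unfolding Q(2) by (metis exists_least_iff)
  then have "{enc x | x. P x} = {z. \<exists>y. evaluates ?p [z] y}"
    by (auto simp: set_eq_iff) (metis enc_dec)
  then show ?thesis unfolding recursively_enumerable_def by blast
qed

section \<open>Isomorphism of finite presentations is recursively enumerable\<close>

lemma computable_double: "computable f \<Longrightarrow> computable (\<lambda>x. 2 * f x :: nat)"
proof -
  assume "computable f"
  then have "computable (\<lambda>x. rec_nat 0 (\<lambda>k r. Suc (Suc r)) (f x))" by (intro computable_intros)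
  moreover have "rec_nat 0 (\<lambda>k r. Suc (Suc r)) n = 2 * n" for n :: nat by (induction n) auto
  ultimately show ?thesis by simp
qed

lemma computable_Inl [computable_intros]:
  "computable f \<Longrightarrow> computable (\<lambda>x. Inl (f x) :: 'b::coded + 'c::coded)"
proof -
  assume "computable f"
  then have "computable (\<lambda>x. dec (2 * enc (f x)) :: 'b + 'c)" by (intro computable_intros computable_double)
  moreover have "2 * enc a = enc (Inl a :: 'b + 'c)" for a by (simp add: enc_sum_def sum_encode_def)
  ultimately show ?thesis by simp
qed

lemma computable_Inr [computable_intros]:
  "computable f \<Longrightarrow> computable (\<lambda>x. Inr (f x) :: 'b::coded + 'c::coded)"
proof -
  assume "computable f"
  then have "computable (\<lambda>x. dec (Suc (2 * enc (f x))) :: 'b + 'c)" by (intro computable_intros computable_double)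
  moreover have "Suc (2 * enc a) = enc (Inr a :: 'b + 'c)" for a by (simp add: enc_sum_def sum_encode_def)
  ultimately show ?thesis by simp
qed

lemma computable_upt [computable_intros]: "computable f \<Longrightarrow> computable (\<lambda>x. [0..<f x])"
proof -
  assume "computable f"
  then have "computable (\<lambda>x. rec_nat [] (\<lambda>k r. r @ [k]) (f x))" by (intro computable_intros)
  moreover have "rec_nat [] (\<lambda>k r. r @ [k]) n = [0..<n]" for n by (induction n) auto
  ultimately show ?thesis by simp
qed

lemma re_eq [re_intros]: "\<lbrakk>computable f; computable g\<rbrakk> \<Longrightarrow> re (\<lambda>x. f x = g x)"
  by (intro re_decidable decidable_eq)

lemma re_mem [re_intros]: "\<lbrakk>computable f; computable g\<rbrakk> \<Longrightarrow> re (\<lambda>x. f x \<in> set (g x))"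
  by (intro re_decidable decidable_mem)

section \<open>Derivations as finite data\<close>

text \<open>A derivation becomes a single list, hence one coded witness, and its steps are covered
  by a bounded quantifier. The start u is prepended, so all indices used lie inside the
  list.\<close>

lemma rtranclp_iff_chain:
  "S\<^sup>*\<^sup>* u v \<longleftrightarrow> (\<exists>w. total_nth (u # w) (length w) = v \<and>
     (\<forall>i<length w. S (total_nth (u # w) i) (total_nth (u # w) (Suc i))))"
proof
  assume "S\<^sup>*\<^sup>* u v"
  then have "\<exists>w. (u # w) ! length w = v \<and> (\<forall>i<length w. S ((u # w) ! i) ((u # w) ! Suc i))"
  proof (induction rule: rtranclp_induct)
    case base then show ?case by (intro exI[of _ "[]"]) simp
  next
    case (step y z)
    then obtain w where w: "(u # w) ! length w = y" "\<forall>i<length w. S ((u # w) ! i) ((u # w) ! Suc i)" by blast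
    have "(u # w @ [z]) ! i = (u # w) ! i" if "i \<le> length w" for i
      using that by (cases i) (auto simp: nth_append)
    then show ?case using w step(2)
      by (intro exI[of _ "w @ [z]"]) (auto simp: less_Suc_eq nth_append)
  qed
  then show "\<exists>w. total_nth (u # w) (length w) = v \<and>
     (\<forall>i<length w. S (total_nth (u # w) i) (total_nth (u # w) (Suc i)))" by (auto simp del: nth_Cons_Suc)
next
  assume "\<exists>w. total_nth (u # w) (length w) = v \<and>
     (\<forall>i<length w. S (total_nth (u # w) i) (total_nth (u # w) (Suc i)))"
  then obtain w where w: "total_nth (u # w) (length w) = v"
    "\<And>i. i < length w \<Longrightarrow> S (total_nth (u # w) i) (total_nth (u # w) (Suc i))" by blast
  have "S\<^sup>*\<^sup>* u (total_nth (u # w) i)" if "i \<le> length w" for i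
    using that
  proof (induction i)
    case (Suc i)
    then show ?case using w(2)[of i] by simp
  qed simp
  then show "S\<^sup>*\<^sup>* u v" using w(1) by blast
qed

lemma re3:
  assumes "re (\<lambda>z. S (fst z) (fst (snd z)) (snd (snd z)))" "computable a" "computable b" "computable c"
  shows "re (\<lambda>z. S (a z) (b z) (c z))"
  using re_compose[OF assms(1) computable_Pair[OF assms(2) computable_Pair[OF assms(3,4)]]] by simp

lemma re_rtranclp:
  assumes "re (\<lambda>z. S (fst z) (fst (snd z)) (snd (snd z)))" "computable f" "computable g"
  shows "re (\<lambda>x. (S x)\<^sup>*\<^sup>* (f x) (g x))"
  unfolding rtranclp_iff_chain
  by (intro re_intros re3[OF assms(1)] computable_intros
      computable_compose[OF assms(2)] computable_compose[OF assms(3)])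

definition rewrite_step :: "('x list \<times> 'x list) list \<Rightarrow> 'x list \<Rightarrow> 'x list \<Rightarrow> bool" where
  "rewrite_step R u v \<longleftrightarrow> (\<exists>x y l r. ((l, r) \<in> set R \<or> (r, l) \<in> set R) \<and> u = x @ l @ y \<and> v = x @ r @ y)"

lemma re_rewrite_step:
  "re (\<lambda>z :: ('x::coded list \<times> 'x list) list \<times> 'x list \<times> 'x list.
     rewrite_step (fst z) (fst (snd z)) (snd (snd z)))"
  unfolding rewrite_step_def by (intro re_intros computable_intros)

lemma re_rewrite [re_intros]:
  "\<lbrakk>computable R; computable f; computable g\<rbrakk> \<Longrightarrow> re (\<lambda>x. (rewrite_step (R x))\<^sup>*\<^sup>* (f x) (g x))"
proof -
  assume *: "computable R" "computable f" "computable g"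
  have "re (\<lambda>z. rewrite_step (R (fst z)) (fst (snd z)) (snd (snd z)))"
    by (intro re3[OF re_rewrite_step] computable_intros computable_compose[OF *(1)])
  then show ?thesis using re_rtranclp[of "\<lambda>x. rewrite_step (R x)" f g] * by simp
qed

text \<open>\<open>rewrite_step\<close> mentions no alphabet. A step from a word over
  \<open>A\<close> stays over \<open>A\<close>, since the context is part of that word and the new
  side belongs to a relation over \<open>A\<close>.\<close>

lemma presentation_cong_iff_rewrite:
  assumes R: "set R \<subseteq> lists A \<times> lists A" and u: "u \<in> lists A"
  shows "(u, v) \<in> presentation_cong A (set R) \<longleftrightarrow> (rewrite_step R)\<^sup>*\<^sup>* u v"
proof
  assume "(u, v) \<in> presentation_cong A (set R)"
  then show "(rewrite_step R)\<^sup>*\<^sup>* u v"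
  proof (induction rule: presentation_cong.induct)
    case (base u v x y)
    then have "rewrite_step R (x @ u @ y) (x @ v @ y)" unfolding rewrite_step_def by blast
    then show ?case by simp
  next
    case (sym u v)
    have "symp (rewrite_step R)" unfolding rewrite_step_def symp_def by blast
    then show ?case using sym by (metis symp_def symp_rtranclp)
  next
    case (trans u v w)
    show ?case by (rule rtranclp_trans[OF trans.IH])
  qed simp
next
  assume "(rewrite_step R)\<^sup>*\<^sup>* u v"
  then show "(u, v) \<in> presentation_cong A (set R)"
  proof (induction rule: rtranclp_induct)
    case base then show ?case using u by (rule presentation_cong.refl)
  next
    case (step v w)
    then obtain x y l r where *: "(l, r) \<in> set R \<or> (r, l) \<in> set R" "v = x @ l @ y" "w = x @ r @ y"
      unfolding rewrite_step_def by blast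
    have "v \<in> lists A" using presentation_cong_in_lists[OF step.IH] by blast
    then have xy: "x \<in> lists A" "y \<in> lists A" using *(2) by simp_all
    have lr: "l \<in> lists A" "r \<in> lists A" using *(1) R by blast+
    have "(v, w) \<in> presentation_cong A (set R)"
      using *(1)
    proof
      assume "(l, r) \<in> set R"
      then show ?thesis unfolding *(2,3) using lr xy by (rule presentation_cong.base)
    next
      assume "(r, l) \<in> set R"
      then have "(w, v) \<in> presentation_cong A (set R)"
        unfolding *(2,3) using lr(2,1) xy by (rule presentation_cong.base)
      then show ?thesis by (rule presentation_cong.sym)
    qed
    with step.IH show ?case by (rule presentation_cong.trans)
  qed
qed

section \<open>Searchable certificates of isomorphism\<close>

type_synonym 'x presentation = "'x list \<times> ('x list \<times> 'x list) list"

definition wf_pres :: "'x presentation \<Rightarrow> bool" where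
  "wf_pres P \<longleftrightarrow> set (snd P) \<subseteq> lists (set (fst P)) \<times> lists (set (fst P))"

abbreviation pmon :: "'x presentation \<Rightarrow> 'x list set monoid" where
  "pmon P \<equiv> monoid_presented_by (set (fst P)) (set (snd P))"

text \<open>A substitution is stored as a list indexed by the codes of the letters, so that it can
  be searched for. \<open>iso_words\<close> is the conjunction of two such halves with the roles of
  the presentations exchanged.\<close>

definition iso_half ::
  "'x::coded presentation \<Rightarrow> 'y::coded presentation \<Rightarrow> 'y list list \<Rightarrow> 'x list list \<Rightarrow> bool" where
  "iso_half P Q s t \<longleftrightarrow>
     (\<forall>a\<in>set (fst P). (\<forall>c\<in>set (total_nth s (enc a)). c \<in> set (fst Q)) \<and>
        (rewrite_step (snd P))\<^sup>*\<^sup>* (concat (map (\<lambda>b. total_nth t (enc b)) (total_nth s (enc a)))) [a]) \<and>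
     (\<forall>p\<in>set (snd P). (rewrite_step (snd Q))\<^sup>*\<^sup>*
        (concat (map (\<lambda>a. total_nth s (enc a)) (fst p))) (concat (map (\<lambda>a. total_nth s (enc a)) (snd p))))"

text \<open>A list reproduces a substitution only on the finitely many letters of the alphabet; in
  well-formed presentations no other values occur.\<close>

lemma iso_words_cong:
  assumes "wf_pres P" "wf_pres Q" "\<And>a. a \<in> set (fst P) \<Longrightarrow> \<sigma> a = \<sigma>' a"
    "\<And>b. b \<in> set (fst Q) \<Longrightarrow> \<tau> b = \<tau>' b"
    "iso_words (set (fst P)) (set (snd P)) (set (fst Q)) (set (snd Q)) \<sigma> \<tau>"
  shows "iso_words (set (fst P)) (set (snd P)) (set (fst Q)) (set (snd Q)) \<sigma>' \<tau>'"
proof -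
  have s: "subst_word \<sigma> w = subst_word \<sigma>' w" if "w \<in> lists (set (fst P))" for w
    using that assms(3) by (induction w) auto
  have t: "subst_word \<tau> w = subst_word \<tau>' w" if "w \<in> lists (set (fst Q))" for w
    using that assms(4) by (induction w) auto
  have R: "u \<in> lists (set (fst P)) \<and> v \<in> lists (set (fst P))" if "(u, v) \<in> set (snd P)" for u v
    using assms(1) that unfolding wf_pres_def by blast
  have Q: "u \<in> lists (set (fst Q)) \<and> v \<in> lists (set (fst Q))" if "(u, v) \<in> set (snd Q)" for u v
    using assms(2) that unfolding wf_pres_def by blast
  show ?thesis
    using assms(5) unfolding iso_words_def
    using s t R Q assms(3,4) by auto (metis (no_types, lifting) s t R Q)+
qed

text \<open>Rewriting agrees with the congruence only from words over the alphabet. Each half is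
  therefore compared under the premise that the opposite substitution produces such words; if its
  own substitution does not, both sides of the comparison are false.\<close>

lemma iso_words_iff_half:
  assumes "wf_pres P" "wf_pres Q"
  shows "iso_words (set (fst P)) (set (snd P)) (set (fst Q)) (set (snd Q))
      (\<lambda>a. total_nth s (enc a)) (\<lambda>b. total_nth t (enc b)) \<longleftrightarrow> iso_half P Q s t \<and> iso_half Q P t s"
    (is "iso_words ?A ?R ?B ?Q ?s ?t \<longleftrightarrow> _")
proof -
  have half: "(\<forall>a\<in>set (fst P). total_nth s (enc a) \<in> lists (set (fst Q)) \<and>
        (subst_word (\<lambda>b. total_nth t (enc b)) (total_nth s (enc a)), [a]) \<in> presentation_cong (set (fst P)) (set (snd P))) \<and>
      (\<forall>(u, v)\<in>set (snd P). (subst_word (\<lambda>a. total_nth s (enc a)) u, subst_word (\<lambda>a. total_nth s (enc a)) v)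
        \<in> presentation_cong (set (fst Q)) (set (snd Q))) \<longleftrightarrow> iso_half P Q s t"
    if P: "wf_pres P" and Q: "wf_pres Q"
      and t: "\<And>b. b \<in> set (fst Q) \<Longrightarrow> total_nth t (enc b) \<in> lists (set (fst P))"
    for P :: "'c::coded presentation" and Q :: "'d::coded presentation" and s t
  proof -
    note ci = presentation_cong_iff_rewrite[OF P[unfolded wf_pres_def]]
      presentation_cong_iff_rewrite[OF Q[unfolded wf_pres_def]]
    have 1: "(\<forall>a\<in>set (fst P). total_nth s (enc a) \<in> lists (set (fst Q)) \<and>
        (subst_word (\<lambda>b. total_nth t (enc b)) (total_nth s (enc a)), [a]) \<in> presentation_cong (set (fst P)) (set (snd P)))
      \<longleftrightarrow> (\<forall>a\<in>set (fst P). (\<forall>c\<in>set (total_nth s (enc a)). c \<in> set (fst Q)) \<and>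
        (rewrite_step (snd P))\<^sup>*\<^sup>* (concat (map (\<lambda>b. total_nth t (enc b)) (total_nth s (enc a)))) [a])"
    proof (intro ball_cong conj_cong)
      fix a :: 'c assume "\<forall>c\<in>set (total_nth s (enc a)). c \<in> set (fst Q)"
      then have "total_nth s (enc a) \<in> lists (set (fst Q))" by (simp add: in_lists_conv_set)
      then have "subst_word (\<lambda>b. total_nth t (enc b)) (total_nth s (enc a)) \<in> lists (set (fst P))"
        using subst_word_closed[of "set (fst Q)" "\<lambda>b. total_nth t (enc b)" "set (fst P)"] t by blast
      then show "(subst_word (\<lambda>b. total_nth t (enc b)) (total_nth s (enc a)), [a]) \<in> presentation_cong (set (fst P)) (set (snd P))
        \<longleftrightarrow> (rewrite_step (snd P))\<^sup>*\<^sup>* (concat (map (\<lambda>b. total_nth t (enc b)) (total_nth s (enc a)))) [a]"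
        by (rule ci(1))
    qed (simp_all add: in_lists_conv_set)
    have 2: "(\<forall>(u, v)\<in>set (snd P). (subst_word (\<lambda>a. total_nth s (enc a)) u, subst_word (\<lambda>a. total_nth s (enc a)) v)
        \<in> presentation_cong (set (fst Q)) (set (snd Q)))
      \<longleftrightarrow> (\<forall>p\<in>set (snd P). (rewrite_step (snd Q))\<^sup>*\<^sup>*
        (concat (map (\<lambda>a. total_nth s (enc a)) (fst p))) (concat (map (\<lambda>a. total_nth s (enc a)) (snd p))))"
      if s: "\<And>a. a \<in> set (fst P) \<Longrightarrow> total_nth s (enc a) \<in> lists (set (fst Q))"
    proof (intro ball_cong)
      fix p assume p: "p \<in> set (snd P)"
      with P have "p \<in> lists (set (fst P)) \<times> lists (set (fst P))" unfolding wf_pres_def by (rule subsetD)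
      then have "fst p \<in> lists (set (fst P))" by (simp only: mem_Times_iff)
      then have "subst_word (\<lambda>a. total_nth s (enc a)) (fst p) \<in> lists (set (fst Q))"
        using subst_word_closed[of "set (fst P)" "\<lambda>a. total_nth s (enc a)" "set (fst Q)"] s by blast
      then show "(case p of (u, v) \<Rightarrow> (subst_word (\<lambda>a. total_nth s (enc a)) u, subst_word (\<lambda>a. total_nth s (enc a)) v)
        \<in> presentation_cong (set (fst Q)) (set (snd Q))) \<longleftrightarrow> (rewrite_step (snd Q))\<^sup>*\<^sup>*
        (concat (map (\<lambda>a. total_nth s (enc a)) (fst p))) (concat (map (\<lambda>a. total_nth s (enc a)) (snd p)))"
        unfolding case_prod_beta by (rule ci(2))
    qed simp
    show ?thesis
    proof (cases "\<forall>a\<in>set (fst P). total_nth s (enc a) \<in> lists (set (fst Q))")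
      case True
      show ?thesis unfolding iso_half_def using arg_cong2[OF 1 2[OF True[rule_format]], of "(\<and>)"] .
    next
      case False
      then have "\<not> (\<forall>a\<in>set (fst P). \<forall>c\<in>set (total_nth s (enc a)). c \<in> set (fst Q))"
        by (simp add: in_lists_conv_set)
      with False show ?thesis unfolding iso_half_def by blast
    qed
  qed
  show ?thesis
  proof
    assume L: "iso_words ?A ?R ?B ?Q ?s ?t"
    then have cl: "\<And>a. a \<in> ?A \<Longrightarrow> ?s a \<in> lists ?B" "\<And>b. b \<in> ?B \<Longrightarrow> ?t b \<in> lists ?A"
      by (simp_all add: iso_words_def)
    have "iso_half P Q s t"
      using L by (subst half[OF assms cl(2), symmetric]) (simp_all add: iso_words_def)
    moreover have "iso_half Q P t s"
      using L by (subst half[OF assms(2,1) cl(1), symmetric]) (simp_all add: iso_words_def)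
    ultimately show "iso_half P Q s t \<and> iso_half Q P t s" ..
  next
    assume H: "iso_half P Q s t \<and> iso_half Q P t s"
    show "iso_words ?A ?R ?B ?Q ?s ?t"
    proof -
      have cl: "\<And>a. a \<in> ?A \<Longrightarrow> ?s a \<in> lists ?B" "\<And>b. b \<in> ?B \<Longrightarrow> ?t b \<in> lists ?A"
        using H by (auto simp: iso_half_def in_lists_conv_set)
      show ?thesis
        using half[OF assms cl(2), of s] half[OF assms(2,1) cl(1), of t] H
        unfolding iso_words_def by meson
    qed
  qed
qed

lemma pmon_iso_iff:
  assumes "wf_pres P" "wf_pres Q"
  shows "pmon P \<cong> pmon Q \<longleftrightarrow> (\<exists>s t. iso_half P Q s t \<and> iso_half Q P t s)"
proof
  assume "pmon P \<cong> pmon Q"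
  then obtain \<sigma> \<tau> where w: "iso_words (set (fst P)) (set (snd P)) (set (fst Q)) (set (snd Q)) \<sigma> \<tau>"
    using iso_imp_iso_words assms unfolding wf_pres_def by blast
  \<comment> \<open>A list that reaches the largest code of a letter stores all values that
    matter.\<close>
  have tab: "\<exists>s. \<forall>a\<in>A. \<phi> a = total_nth s (enc a)"
    if "finite A" for A :: "'c::coded set" and \<phi> :: "'c \<Rightarrow> 'd::coded list"
  proof (intro exI ballI)
    fix a assume "a \<in> A"
    then have "enc a < Suc (Max (enc ` A))" using that by (simp add: less_Suc_eq_le)
    then show "\<phi> a = total_nth (map (\<lambda>i. \<phi> (dec i)) [0..<Suc (Max (enc ` A))]) (enc a)" by (simp del: upt_Suc)
  qed
  obtain s where s: "\<forall>a\<in>set (fst P). \<sigma> a = total_nth s (enc a)" using tab[of "set (fst P)" \<sigma>] by auto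
  obtain t where t: "\<forall>b\<in>set (fst Q). \<tau> b = total_nth t (enc b)" using tab[of "set (fst Q)" \<tau>] by auto
  have "iso_words (set (fst P)) (set (snd P)) (set (fst Q)) (set (snd Q))
      (\<lambda>a. total_nth s (enc a)) (\<lambda>b. total_nth t (enc b))"
    by (rule iso_words_cong[OF assms _ _ w]) (use s t in simp_all)
  then show "\<exists>s t. iso_half P Q s t \<and> iso_half Q P t s" using iso_words_iff_half[OF assms] by blast
next
  assume "\<exists>s t. iso_half P Q s t \<and> iso_half Q P t s"
  then show "pmon P \<cong> pmon Q" using iso_words_iff_half[OF assms] iso_words_imp_iso by blast
qed

lemma re_iso_half [re_intros]:
  assumes "computable p" "computable q" "computable s" "computable t"
  shows "re (\<lambda>x. iso_half (p x) (q x) (s x) (t x))"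
proof -
  have "re (\<lambda>z. iso_half (fst z) (fst (snd z)) (fst (snd (snd z))) (snd (snd (snd z))))"
    unfolding iso_half_def by (intro re_intros computable_intros)
  from re_compose[OF this, of "\<lambda>x. (p x, q x, s x, t x)"]
  show ?thesis using assms by (simp add: computable_Pair)
qed

section \<open>Garside presentations\<close>

text \<open>A table is stored as \<open>(m, e, d, rows)\<close> with elements \<open>{..<m}\<close>.\<close>

type_synonym table = "nat \<times> nat \<times> nat \<times> nat list list"

definition tcm :: "table \<Rightarrow> nat \<Rightarrow> nat \<Rightarrow> nat" where
  "tcm T x y = total_nth (total_nth (snd (snd (snd T))) x) y"

definition good_table :: "table \<Rightarrow> bool" where
  "good_table T \<longleftrightarrow> garside_table {..<fst T} (tcm T) (fst (snd T)) (fst (snd (snd T)))"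

text \<open>All quantifiers become bounded by m, which makes the conditions decidable.\<close>

lemma garside_table_nat_iff:
  "garside_table {..<m} cm e d \<longleftrightarrow> (\<forall>x<m. \<forall>y<m. cm x y < m) \<and> e < m \<and>
     (\<forall>x<m. cm x x = e \<and> cm x e = e \<and> cm e x = x) \<and>
     (\<forall>x<m. \<forall>y<m. \<forall>z<m. cm (cm x y) (cm x z) = cm (cm y x) (cm y z)) \<and> d < m \<and>
     (\<forall>x<m. cm d x = e) \<and> (\<forall>x<m. \<exists>y<m. cm y d = x)" for m :: nat
  unfolding garside_table_def complement_table_def garside_table_axioms_def by (auto simp: Bex_def)

lemma computable_tcm [computable_intros]:
  "\<lbrakk>computable T; computable f; computable g\<rbrakk> \<Longrightarrow> computable (\<lambda>x. tcm (T x) (f x) (g x))"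
  unfolding tcm_def by (intro computable_intros)

lemma decidable_good_table: "decidable good_table"
  unfolding good_table_def garside_table_nat_iff by (intro computable_intros)

definition table_rels :: "table \<Rightarrow> (nat list \<times> nat list) list" where
  "table_rels T = ([fst (snd T)], []) #
     concat (map (\<lambda>x. map (\<lambda>y. ([x, tcm T x y], [y, tcm T y x])) [0..<fst T]) [0..<fst T])"

lemma set_table_rels:
  "good_table T \<Longrightarrow> set (table_rels T) = complement_table.rels {..<fst T} (tcm T) (fst (snd T))"
  unfolding good_table_def garside_table_def
  by (auto simp: complement_table.rels_def table_rels_def)

definition table_pres :: "table \<Rightarrow> nat presentation" where
  "table_pres T = ([0..<fst T], table_rels T)"

definition signed_list :: "nat \<Rightarrow> (nat + nat) list" where
  "signed_list n = map Inl [0..<n] @ map Inr [0..<n]"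

definition free_rels_list :: "nat \<Rightarrow> ((nat + nat) list \<times> (nat + nat) list) list" where
  "free_rels_list n = concat (map (\<lambda>a. [([Inl a, Inr a], []), ([Inr a, Inl a], [])]) [0..<n])"

definition table_gpres :: "table \<Rightarrow> (nat + nat) presentation" where
  "table_gpres T = (signed_list (fst T),
     free_rels_list (fst T) @ map (\<lambda>p. (map Inl (fst p), map Inl (snd p))) (table_rels T))"

definition monoid_pres :: "monoid_presentation \<Rightarrow> nat presentation" where
  "monoid_pres P = ([0..<fst P], snd P)"

definition group_pres :: "group_presentation \<Rightarrow> (nat + nat) presentation" where
  "group_pres P = (signed_list (fst P), free_rels_list (fst P) @ snd P)"

lemma set_signed_list: "set (signed_list n) = signed {..<n}"
  by (auto simp: signed_list_def signed_def)

lemma set_free_rels_list: "set (free_rels_list n) = free_rels {..<n}"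
  by (auto simp: free_rels_list_def free_rels_def)

lemma table_exists:
  fixes m :: nat
  assumes "garside_table {..<m} cm e d"
  shows "\<exists>T. good_table T \<and> fst T = m \<and> fst (snd T) = e \<and> (\<forall>x<m. \<forall>y<m. tcm T x y = cm x y)"
proof -
  let ?T = "(m, e, d, map (\<lambda>x. map (cm x) [0..<m]) [0..<m])"
  have t: "tcm ?T x y = cm x y" if "x < m" "y < m" for x y using that by (simp add: tcm_def)
  have "garside_table {..<m} (tcm ?T) e d"
    using assms unfolding garside_table_nat_iff by (simp add: t) (metis t)
  then show ?thesis using t by (intro exI[of _ ?T]) (simp add: good_table_def)
qed

lemma rels_cong:
  fixes m :: nat
  assumes "complement_table {..<m} cm e" "complement_table {..<m} cm' e"
    "\<And>x y. \<lbrakk>x < m; y < m\<rbrakk> \<Longrightarrow> cm x y = cm' x y"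
  shows "complement_table.rels {..<m} cm e = complement_table.rels {..<m} cm' e"
  using assms(3) unfolding complement_table.rels_def[OF assms(1)] complement_table.rels_def[OF assms(2)] by force

text \<open>With \<open>\<Phi>\<close> arbitrary, the passage from functions \<open>cm\<close> to
  coded tables is made once for monoids and groups; only the values below m enter the
  relations.\<close>

lemma ex_table_iff:
  fixes \<Phi> :: "nat \<Rightarrow> (nat list \<times> nat list) set \<Rightarrow> bool"
  shows "(\<exists>(m::nat) cm e d. garside_table {..<m} cm e d \<and> \<Phi> m (complement_table.rels {..<m} cm e))
    \<longleftrightarrow> (\<exists>T. good_table T \<and> \<Phi> (fst T) (set (table_rels T)))"
proof
  assume "\<exists>(m::nat) cm e d. garside_table {..<m} cm e d \<and> \<Phi> m (complement_table.rels {..<m} cm e)"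
  then obtain m :: nat and cm e d where T: "garside_table {..<m} cm e d" "\<Phi> m (complement_table.rels {..<m} cm e)"
    by blast
  obtain T where T': "good_table T" "fst T = m" "fst (snd T) = e" "\<forall>x<m. \<forall>y<m. tcm T x y = cm x y"
    using table_exists[OF T(1)] by blast
  have "complement_table.rels {..<m} (tcm T) e = complement_table.rels {..<m} cm e"
    using T(1) T' by (intro rels_cong) (auto simp: good_table_def garside_table_def)
  then show "\<exists>T. good_table T \<and> \<Phi> (fst T) (set (table_rels T))"
    using T(2) T' set_table_rels[OF T'(1)] by (intro exI[of _ T]) simp
next
  assume "\<exists>T. good_table T \<and> \<Phi> (fst T) (set (table_rels T))"
  then obtain T where T: "good_table T" "\<Phi> (fst T) (set (table_rels T))" by blast
  show "\<exists>(m::nat) cm e d. garside_table {..<m} cm e d \<and> \<Phi> m (complement_table.rels {..<m} cm e)"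
    using T(1)[unfolded good_table_def] T(2)[unfolded set_table_rels[OF T(1)]] by blast
qed

lemma wf_table_pres: "good_table T \<Longrightarrow> wf_pres (table_pres T)"
  using complement_table.rels_closed[of "{..<fst T}" "tcm T" "fst (snd T)"]
  by (simp add: wf_pres_def table_pres_def set_table_rels good_table_def garside_table_def atLeast0LessThan)

lemma set_table_gpres:
  assumes "good_table T"
  shows "set (snd (table_gpres T)) = free_rels {..<fst T} \<union>
    complement_table.pos_rels {..<fst T} (tcm T) (fst (snd T))"
proof -
  have "complement_table {..<fst T} (tcm T) (fst (snd T))"
    using assms by (simp add: good_table_def garside_table_def)
  then show ?thesis
    by (simp add: table_gpres_def set_free_rels_list set_table_rels[OF assms]
        complement_table.pos_rels_def case_prod_beta)
qed

lemma wf_table_gpres: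
  assumes "good_table T"
  shows "wf_pres (table_gpres T)"
proof -
  have "complement_table {..<fst T} (tcm T) (fst (snd T))"
    using assms by (simp add: good_table_def garside_table_def)
  from complement_table.grels_closed[OF this] show ?thesis
    by (simp add: wf_pres_def set_table_gpres[OF assms]) (simp add: table_gpres_def set_signed_list)
qed

lemma wf_monoid_pres: "wf_monoid_presentation P \<longleftrightarrow> wf_pres (monoid_pres P)"
  by (cases P) (simp add: wf_pres_def monoid_pres_def atLeast0LessThan)

lemma presented_monoid_pmon: "presented_monoid P = pmon (monoid_pres P)"
  by (cases P) (simp add: monoid_pres_def atLeast0LessThan)

lemma presented_group_pmon: "presented_group P = pmon (group_pres P)"
  by (cases P) (simp add: group_pres_def set_signed_list set_free_rels_list signed_def free_rels_def
      signed_alphabet_def free_reductions_def)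

lemma wf_group_pres: "wf_group_presentation P \<longleftrightarrow> wf_pres (group_pres P)"
proof -
  have "free_rels {..<n} \<subseteq> lists (signed {..<n}) \<times> lists (signed {..<n})" for n :: nat
    by (auto simp: free_rels_def signed_def)
  then show ?thesis
    by (cases P) (simp add: wf_pres_def group_pres_def set_signed_list set_free_rels_list
      signed_alphabet_def signed_def)
qed

section \<open>Both properties as existence of a coded table\<close>

lemma garside_monoid_presented_iff:
  "garside_monoid (presented_monoid P) \<longleftrightarrow> (\<exists>T. good_table T \<and> pmon (table_pres T) \<cong> pmon (monoid_pres P))"
  using ex_table_iff[of "\<lambda>m R. monoid_presented_by {..<m} R \<cong> pmon (monoid_pres P)"]
  unfolding presented_monoid_pmon garside_monoid_iff_table[OF monoid_presented]
  by (simp add: table_pres_def atLeast0LessThan)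

lemma garside_group_presented_iff:
  "garside_group (presented_group P) \<longleftrightarrow> (\<exists>T. good_table T \<and> pmon (table_gpres T) \<cong> pmon (group_pres P))"
proof -
  have "group (pmon (group_pres P))"
    using signed_group[of "{..<fst P}" "set (snd (group_pres P))"]
    by (simp add: group_pres_def set_signed_list set_free_rels_list)
  note iff = garside_group_iff_table[OF this]
  let ?\<Phi> = "\<lambda>m R. monoid_presented_by (signed {..<m}) (free_rels {..<m} \<union> (\<lambda>(u, v). (map Inl u, map Inl v)) ` R)
      \<cong> pmon (group_pres P)"
  have "complement_table.pos_rels {..<m} cm e = (\<lambda>(u, v). (map Inl u, map Inl v)) ` complement_table.rels {..<m} cm e"
    if "garside_table {..<m} cm e d" for m :: nat and cm e d
  proof -
    have "complement_table {..<m} cm e" using that by (simp only: garside_table_def)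
    then show ?thesis by (rule complement_table.pos_rels_def)
  qed
  then have "garside_table {..<m} cm e d \<and> monoid_presented_by (signed {..<m})
        (free_rels {..<m} \<union> complement_table.pos_rels {..<m} cm e) \<cong> pmon (group_pres P) \<longleftrightarrow>
      garside_table {..<m} cm e d \<and> ?\<Phi> m (complement_table.rels {..<m} cm e)" for m :: nat and cm e d
    by (cases "garside_table {..<m} cm e d") simp_all
  then have "garside_group (presented_group P) \<longleftrightarrow> (\<exists>(m::nat) cm e d. garside_table {..<m} cm e d \<and>
      ?\<Phi> m (complement_table.rels {..<m} cm e))"
    unfolding presented_group_pmon iff by (simp only:)
  also have "\<dots> \<longleftrightarrow> (\<exists>T. good_table T \<and> ?\<Phi> (fst T) (set (table_rels T)))"
    by (rule ex_table_iff)
  finally show ?thesis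
    by (simp add: table_gpres_def set_signed_list set_free_rels_list case_prod_beta)
qed

lemma computable_table_rels [computable_intros]: "computable T \<Longrightarrow> computable (\<lambda>x. table_rels (T x))"
proof -
  assume T: "computable T"
  have "computable table_rels" unfolding table_rels_def by (intro computable_intros)
  from computable_compose[OF this T] show ?thesis .
qed

lemma decidable_wf_pres: "computable p \<Longrightarrow> decidable (\<lambda>x. wf_pres (p x))"
proof -
  assume p: "computable p"
  have "decidable (\<lambda>P :: 'b presentation. \<forall>r\<in>set (snd P).
      (\<forall>a\<in>set (fst r). a \<in> set (fst P)) \<and> (\<forall>a\<in>set (snd r). a \<in> set (fst P)))"
    by (intro computable_intros)
  moreover have "wf_pres P \<longleftrightarrow> (\<forall>r\<in>set (snd P).
      (\<forall>a\<in>set (fst r). a \<in> set (fst P)) \<and> (\<forall>a\<in>set (snd r). a \<in> set (fst P)))" for P :: "'b presentation"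
    by (auto simp: wf_pres_def in_lists_conv_set subset_iff)
  ultimately have "decidable (\<lambda>P :: 'b presentation. wf_pres P)" by (simp only:)
  from decidable_compose[OF this p] show ?thesis .
qed

text \<open>Serves monoids and groups alike. Keeping \<open>wf_pres (q P)\<close> in the predicate
  permits the use of \<open>pmon_iso_iff\<close>, which trades the isomorphism for a search for two
  lists.\<close>

lemma re_table_iso:
  fixes q :: "'a::coded \<Rightarrow> 'x::coded presentation" and t :: "table \<Rightarrow> 'y::coded presentation"
  assumes "computable q" "computable t" "\<And>T. good_table T \<Longrightarrow> wf_pres (t T)"
  shows "re (\<lambda>P. wf_pres (q P) \<and> (\<exists>T. good_table T \<and> pmon (t T) \<cong> pmon (q P)))"
proof -
  have "re (\<lambda>P. wf_pres (q P) \<and> (\<exists>T. good_table T \<and>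
      (\<exists>s u. iso_half (t T) (q P) s u \<and> iso_half (q P) (t T) u s)))"
    by (intro re_intros computable_intros re_decidable[OF decidable_wf_pres]
        re_decidable[OF decidable_compose[OF decidable_good_table]]
        computable_compose[OF assms(1)] computable_compose[OF assms(2)])
  moreover have "(wf_pres (q P) \<and> (\<exists>T. good_table T \<and> pmon (t T) \<cong> pmon (q P))) \<longleftrightarrow>
    (wf_pres (q P) \<and> (\<exists>T. good_table T \<and>
      (\<exists>s u. iso_half (t T) (q P) s u \<and> iso_half (q P) (t T) u s)))" for P
    using pmon_iso_iff assms(3) by blast
  ultimately show ?thesis by (simp only:)
qed

lemma computable_signed_list [computable_intros]: "computable f \<Longrightarrow> computable (\<lambda>x. signed_list (f x))"
  unfolding signed_list_def by (intro computable_intros)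

lemma computable_free_rels_list [computable_intros]: "computable f \<Longrightarrow> computable (\<lambda>x. free_rels_list (f x))"
  unfolding free_rels_list_def by (intro computable_intros)

text \<open>The prescribed coding of presentations is the one built up by the class instances,
  because \<open>enc\<close> is the identity on numbers.\<close>

lemma monoid_presentation_code_enc: "monoid_presentation_code P = enc P"
proof (cases P)
  case (Pair n R)
  have "map enc u = u" for u :: "nat list" by (simp add: enc_nat_def map_idI)
  then have "enc = (\<lambda>(u, v). prod_encode (list_encode u, list_encode v :: nat))"
    by (auto simp: fun_eq_iff enc_prod_def enc_list_def)
  then show ?thesis by (simp add: Pair enc_prod_def[of "(n, R)"] enc_nat_def enc_list_def[of R])
qed

lemma group_presentation_code_enc: "group_presentation_code P = enc P"
proof (cases P)
  case (Pair n R)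
  have "map_sum enc enc x = x" for x :: "nat + nat" by (cases x) (simp_all add: enc_nat_def)
  then have "enc u = list_encode (map sum_encode u)" for u :: "(nat + nat) list"
    by (simp add: enc_list_def enc_sum_def[abs_def])
  then have "enc = (\<lambda>(u, v). prod_encode (list_encode (map sum_encode u), list_encode (map sum_encode v)))"
    by (auto simp: fun_eq_iff enc_prod_def)
  then show ?thesis by (simp add: Pair enc_prod_def[of "(n, R)"] enc_nat_def enc_list_def[of R])
qed

theorem mainTheorem2:
  shows "recursively_enumerable
           {group_presentation_code P | P.
              wf_group_presentation P \<and> garside_group (presented_group P)} \<and>
         recursively_enumerable
           {monoid_presentation_code P | P.
              wf_monoid_presentation P \<and> garside_monoid (presented_monoid P)}"
proof
  have "computable group_pres" "computable table_gpres"
    unfolding group_pres_def table_gpres_def by (intro computable_intros)+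
  from re_table_iso[OF this wf_table_gpres]
  have "re (\<lambda>P. wf_group_presentation P \<and> garside_group (presented_group P))"
    unfolding wf_group_pres garside_group_presented_iff .
  from re_imp_recursively_enumerable[OF this]
  show "recursively_enumerable {group_presentation_code P | P.
      wf_group_presentation P \<and> garside_group (presented_group P)}"
    by (simp add: group_presentation_code_enc)
next
  have "computable monoid_pres" "computable table_pres"
    unfolding monoid_pres_def table_pres_def by (intro computable_intros)+
  from re_table_iso[OF this wf_table_pres]
  have "re (\<lambda>P. wf_monoid_presentation P \<and> garside_monoid (presented_monoid P))"
    unfolding wf_monoid_pres garside_monoid_presented_iff .
  from re_imp_recursively_enumerable[OF this]
  show "recursively_enumerable {monoid_presentation_code P | P.
      wf_monoid_presentation P \<and> garside_monoid (presented_monoid P)}"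
    by (simp add: monoid_presentation_code_enc)
qed

end
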